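(* Let $\{\mathcal{A}_n\mid n\ge 0\}$ be a multiplicity-free family of algebras over a field $\Bbbk$ and let $(J_n\mid n\in\mathbb{N})$ be a JM-sequence in it. For any $n\ge 1$ and any $\lambda\in\operatorname{Irr}(n)$, $$\varepsilon(\lambda)=\sum_{\mu}P^\lambda_\mu(J_n)\cdot\varepsilon(\mu),$$ where $\mu$ varies over the set of immediate predecessors of $\lambda$ in the branching graph (i.e. the $\mu\in\operatorname{Irr}(n-1)$ with an edge $\mu\to\lambda$).
   Context: All algebras are finite-dimensional, associative and unital. A finite-dimensional algebra over $\Bbbk$ is split semisimple if it is isomorphic to a direct sum of matrix algebras over $\Bbbk$. A multiplicity-free family of algebras over $\Bbbk$ is a family $\{\mathcal{A}_n\mid n\ge 0\}$ of finite-dimensional split semisimple $\Bbbk$-algebras such that: (a) $\mathcal{A}_0\cong\Bbbk$; (b) for each $n$ there is a unity-preserving algebra embedding $\mathcal{A}_n\hookrightarrow\mathcal{A}_{n+1}$ (by which $\mathcal{A}_n$ is regarded as a subalgebra of $\mathcal{A}_{n+1}$); (c) the restriction to $\mathcal{A}_{n-1}$ of any irreducible $\mathcal{A}_n$-module is isomorphic to a direct sum of pairwise non-isomorphic irreducible $\mathcal{A}_{n-1}$-modules. $\operatorname{Irr}(n)$ is the set of isomorphism classes of irreducible left $\mathcal{A}_n$-modules, and $V^\lambda$ is a representative of $\lambda\in\operatorname{Irr}(n)$. For $\lambda\in\operatorname{Irr}(n)$, $\varepsilon(\lambda)\in Z(\mathcal{A}_n)$ is the primitive central idempotent of $\mathcal{A}_n$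 acting as the identity on $V^\lambda$ and as zero on $V^{\lambda'}$ for $\lambda\ne\lambda'\in\operatorname{Irr}(n)$. The branching graph has vertex set $\bigsqcup_{n\ge0}\operatorname{Irr}(n)$, with an edge $\mu\to\lambda$ ($\mu\in\operatorname{Irr}(n-1)$, $\lambda\in\operatorname{Irr}(n)$) if and only if $V^\mu$ is isomorphic to a direct summand of the restriction of $V^\lambda$ to $\mathcal{A}_{n-1}$. $\operatorname{Tab}(n)$ is the set of paths $\mathsf T=(\lambda_0\to\lambda_1\to\cdots\to\lambda_n)$ in the branching graph starting at the unique element $\lambda_0=\varnothing$ of $\operatorname{Irr}(0)$, with $\lambda_k\in\operatorname{Irr}(k)$; $\operatorname{type}(\mathsf T)=\lambda_n$, and $\overline{\mathsf T}\in\operatorname{Tab}(n-1)$ is obtained from $\mathsf T$ by deleting its last edge. Set $\varepsilon_{\mathsf T}=\varepsilon(\lambda_1)\cdots\varepsilon(\lambda_n)\in\mathcal{A}_n$ (equal to $1$ if $n=0$). For $n\ge1$, $\mathcal{X}_n$ is the (commutative) subalgebra of $\mathcal{A}_n$ generated by $Z(\mathcal{A}_1),\dots,Z(\mathcal{A}_n)$; $\{\varepsilon_{\mathsf T}\mid\mathsf T\in\operatorname{Tab}(n)\}$ is a $\Bbbk$-basis of $\mathcal{X}_n$, and $\mathcal{X}_1\subset\mathcal{X}_2\subset\cdots$. A sequence $(J_n\mid n\in\mathbb{N})$, $\mathbb{N}=\{1,2,\dots\}$, with $J_n\in\mathcal{X}_n$ for all $n$, is additively central if $J_1+\cdots+J_n\in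 Z(\mathcal{A}_n)$ for all $n\in\mathbb{N}$; it is separating if $\mathcal{X}_n=\langle J_1,\dots,J_n\rangle$ (the subalgebra generated) for all $n\in\mathbb{N}$; it is a JM-sequence (Jucys--Murphy sequence) if it is both. For $\mathsf T\in\operatorname{Tab}(n)$ and $1\le k\le n$ the scalars $c_{\mathsf T}(k)\in\Bbbk$ are defined by $J_k=\sum_{\mathsf T\in\operatorname{Tab}(n)}c_{\mathsf T}(k)\,\varepsilon_{\mathsf T}$. For $\mathsf T\in\operatorname{Tab}(n)$, $$P_{\mathsf T}(J_n)=\prod_{\substack{\mathsf S\in\operatorname{Tab}(n)\\ \mathsf S\ne\mathsf T,\ \overline{\mathsf S}=\overline{\mathsf T}}}\frac{J_n-c_{\mathsf S}(n)}{c_{\mathsf T}(n)-c_{\mathsf S}(n)}$$ (the denominators are nonzero for a separating sequence). For a JM-sequence, $P_{\mathsf T}(J_n)$ depends only on $\lambda=\operatorname{type}(\mathsf T)$ and $\mu=\operatorname{type}(\overline{\mathsf T})$, and one writes $P^\lambda_\mu(J_n)=P_{\mathsf T}(J_n)$. *)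

theory Defs
  imports "Jordan_Normal_Form.Matrix" "HOL-Algebra.Algebra"
begin

section \<open>Algebras over a field\<close>

text \<open>An algebra over the field \<open>'k\<close> is a record of type \<open>('k, 'a) module\<close>, which carries
  a ring structure together with a scalar multiplication. The locale \<open>algebra\<close> of HOL-Algebra
  is not used because it requires commutativity.\<close>

definition field_algebra :: "('k::field, 'k) module" where
  "field_algebra = \<lparr>carrier = UNIV, mult = (*), one = 1,
     ring.zero = 0, add = (+), smult = (*)\<rparr>"

definition fd_algebra :: "('k::field, 'a) module \<Rightarrow> bool" where
  "fd_algebra A \<longleftrightarrow> ring A \<and> module (field_algebra :: ('k, 'k) module) A \<and>
     (\<forall>c. \<forall>x\<in>carrier A. \<forall>y\<in>carrier A.
        (c \<odot>\<^bsub>A\<^esub> x) \<otimes>\<^bsub>A\<^esub> y = c \<odot>\<^bsub>A\<^esub> (x \<otimes>\<^bsub>A\<^esub> y) \<and>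
        x \<otimes>\<^bsub>A\<^esub> (c \<odot>\<^bsub>A\<^esub> y) = c \<odot>\<^bsub>A\<^esub> (x \<otimes>\<^bsub>A\<^esub> y)) \<and>
     (\<exists>B. finite B \<and> B \<subseteq> carrier A \<and>
        (\<forall>x\<in>carrier A. \<exists>c. x = (\<Oplus>\<^bsub>A\<^esub>b\<in>B. c b \<odot>\<^bsub>A\<^esub> b)))"

definition algebra_hom :: "('k, 'a) module \<Rightarrow> ('k, 'b) module \<Rightarrow> ('a \<Rightarrow> 'b) set" where
  "algebra_hom A B =
     {h \<in> ring_hom A B. \<forall>c. \<forall>x\<in>carrier A. h (c \<odot>\<^bsub>A\<^esub> x) = c \<odot>\<^bsub>B\<^esub> h x}"

definition algebra_iso :: "('k, 'a) module \<Rightarrow> ('k, 'b) module \<Rightarrow> bool" where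
  "algebra_iso A B \<longleftrightarrow> (\<exists>h\<in>algebra_hom A B. bij_betw h (carrier A) (carrier B))"

text \<open>External direct sum of finitely many records, with all operations componentwise; it serves
  both for direct sums of algebras and (ignoring \<open>mult\<close> and \<open>one\<close>) for direct sums of modules.\<close>

definition direct_sum :: "nat \<Rightarrow> (nat \<Rightarrow> ('s, 'v) module) \<Rightarrow> ('s, nat \<Rightarrow> 'v) module" where
  "direct_sum r M =
     \<lparr>carrier = \<Pi>\<^sub>E i\<in>{..<r}. carrier (M i),
      mult = (\<lambda>x y. \<lambda>i\<in>{..<r}. x i \<otimes>\<^bsub>M i\<^esub> y i),
      one = (\<lambda>i\<in>{..<r}. \<one>\<^bsub>M i\<^esub>),
      ring.zero = (\<lambda>i\<in>{..<r}. \<zero>\<^bsub>M i\<^esub>),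
      add = (\<lambda>x y. \<lambda>i\<in>{..<r}. x i \<oplus>\<^bsub>M i\<^esub> y i),
      smult = (\<lambda>s x. \<lambda>i\<in>{..<r}. s \<odot>\<^bsub>M i\<^esub> x i)\<rparr>"

text \<open>\<open>module_mat TYPE('k) d d\<close> is the full matrix algebra, including its multiplication.\<close>

definition split_semisimple :: "('k::field, 'a) module \<Rightarrow> bool" where
  "split_semisimple A \<longleftrightarrow> fd_algebra A \<and>
     (\<exists>r d. (\<forall>i<r. 0 < d i) \<and>
        algebra_iso A (direct_sum r (\<lambda>i. module_mat TYPE('k) (d i) (d i))))"

definition center :: "('k, 'a) module \<Rightarrow> 'a set" where
  "center A = {z \<in> carrier A. \<forall>x\<in>carrier A. z \<otimes>\<^bsub>A\<^esub> x = x \<otimes>\<^bsub>A\<^esub> z}"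

definition subalg :: "'a set \<Rightarrow> ('k, 'a) module \<Rightarrow> bool" where
  "subalg B A \<longleftrightarrow> subring B A \<and> (\<forall>c. \<forall>x\<in>B. c \<odot>\<^bsub>A\<^esub> x \<in> B)"

definition generated_subalg :: "('k, 'a) module \<Rightarrow> 'a set \<Rightarrow> 'a set" where
  "generated_subalg A S = \<Inter>{B. subalg B A \<and> S \<subseteq> B}"

definition central_idempotent :: "('k, 'a) module \<Rightarrow> 'a \<Rightarrow> bool" where
  "central_idempotent A e \<longleftrightarrow> e \<in> center A \<and> e \<otimes>\<^bsub>A\<^esub> e = e"

definition primitive_central_idempotent :: "('k, 'a) module \<Rightarrow> 'a \<Rightarrow> bool" where
  "primitive_central_idempotent A e \<longleftrightarrow> central_idempotent A e \<and> e \<noteq> \<zero>\<^bsub>A\<^esub> \<and>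
     \<not> (\<exists>f g. central_idempotent A f \<and> central_idempotent A g \<and>
          f \<noteq> \<zero>\<^bsub>A\<^esub> \<and> g \<noteq> \<zero>\<^bsub>A\<^esub> \<and> f \<otimes>\<^bsub>A\<^esub> g = \<zero>\<^bsub>A\<^esub> \<and> e = f \<oplus>\<^bsub>A\<^esub> g)"


section \<open>Left modules\<close>

text \<open>Left modules over a not necessarily commutative ring; in the record \<open>V\<close> the fields \<open>mult\<close>
  and \<open>one\<close> are irrelevant. Over an algebra the action of a scalar \<open>c\<close> is that of \<open>c \<odot> \<one>\<close>.\<close>

definition left_module :: "('k, 'a) module \<Rightarrow> ('a, 'v) module \<Rightarrow> bool" where
  "left_module A V \<longleftrightarrow> abelian_group V \<and>
     (\<forall>a\<in>carrier A. \<forall>v\<in>carrier V. a \<odot>\<^bsub>V\<^esub> v \<in> carrier V) \<and>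
     (\<forall>a\<in>carrier A. \<forall>b\<in>carrier A. \<forall>v\<in>carrier V.
        (a \<oplus>\<^bsub>A\<^esub> b) \<odot>\<^bsub>V\<^esub> v = a \<odot>\<^bsub>V\<^esub> v \<oplus>\<^bsub>V\<^esub> b \<odot>\<^bsub>V\<^esub> v) \<and>
     (\<forall>a\<in>carrier A. \<forall>v\<in>carrier V. \<forall>w\<in>carrier V.
        a \<odot>\<^bsub>V\<^esub> (v \<oplus>\<^bsub>V\<^esub> w) = a \<odot>\<^bsub>V\<^esub> v \<oplus>\<^bsub>V\<^esub> a \<odot>\<^bsub>V\<^esub> w) \<and>
     (\<forall>a\<in>carrier A. \<forall>b\<in>carrier A. \<forall>v\<in>carrier V.
        (a \<otimes>\<^bsub>A\<^esub> b) \<odot>\<^bsub>V\<^esub> v = a \<odot>\<^bsub>V\<^esub> (b \<odot>\<^bsub>V\<^esub> v)) \<and>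
     (\<forall>v\<in>carrier V. \<one>\<^bsub>A\<^esub> \<odot>\<^bsub>V\<^esub> v = v)"

definition module_iso ::
  "('k, 'a) module \<Rightarrow> ('a, 'v) module \<Rightarrow> ('a, 'w) module \<Rightarrow> bool" where
  "module_iso A V W \<longleftrightarrow> (\<exists>f\<in>iso (add_monoid V) (add_monoid W).
     \<forall>a\<in>carrier A. \<forall>v\<in>carrier V. f (a \<odot>\<^bsub>V\<^esub> v) = a \<odot>\<^bsub>W\<^esub> f v)"

definition irreducible_module :: "('k, 'a) module \<Rightarrow> ('a, 'v) module \<Rightarrow> bool" where
  "irreducible_module A V \<longleftrightarrow> left_module A V \<and> carrier V \<noteq> {\<zero>\<^bsub>V\<^esub>} \<and>
     (\<forall>U. submodule U A V \<longrightarrow> U = {\<zero>\<^bsub>V\<^esub>} \<or> U = carrier V)"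

lemma left_moduleD:
  assumes "left_module A V"
  shows "abelian_group V"
    and "\<And>a v. a \<in> carrier A \<Longrightarrow> v \<in> carrier V \<Longrightarrow> a \<odot>\<^bsub>V\<^esub> v \<in> carrier V"
    and "\<And>a b v. a \<in> carrier A \<Longrightarrow> b \<in> carrier A \<Longrightarrow> v \<in> carrier V \<Longrightarrow>
      (a \<oplus>\<^bsub>A\<^esub> b) \<odot>\<^bsub>V\<^esub> v = a \<odot>\<^bsub>V\<^esub> v \<oplus>\<^bsub>V\<^esub> b \<odot>\<^bsub>V\<^esub> v"
    and "\<And>a v w. a \<in> carrier A \<Longrightarrow> v \<in> carrier V \<Longrightarrow> w \<in> carrier V \<Longrightarrow>
      a \<odot>\<^bsub>V\<^esub> (v \<oplus>\<^bsub>V\<^esub> w) = a \<odot>\<^bsub>V\<^esub> v \<oplus>\<^bsub>V\<^esub> a \<odot>\<^bsub>V\<^esub> w"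
    and "\<And>a b v. a \<in> carrier A \<Longrightarrow> b \<in> carrier A \<Longrightarrow> v \<in> carrier V \<Longrightarrow>
      (a \<otimes>\<^bsub>A\<^esub> b) \<odot>\<^bsub>V\<^esub> v = a \<odot>\<^bsub>V\<^esub> (b \<odot>\<^bsub>V\<^esub> v)"
    and "\<And>v. v \<in> carrier V \<Longrightarrow> \<one>\<^bsub>A\<^esub> \<odot>\<^bsub>V\<^esub> v = v"
  using assms unfolding left_module_def by blast+

lemma submodule_of_left_moduleI:
  fixes A :: "('k, 'a) module" and V :: "('a, 'v) module"
  assumes A: "ring A" and V: "left_module A V"
    and U: "U \<subseteq> carrier V" "U \<noteq> {}"
    and add: "\<And>u w. u \<in> U \<Longrightarrow> w \<in> U \<Longrightarrow> u \<oplus>\<^bsub>V\<^esub> w \<in> U"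
    and smult: "\<And>a u. a \<in> carrier A \<Longrightarrow> u \<in> U \<Longrightarrow> a \<odot>\<^bsub>V\<^esub> u \<in> U"
  shows "submodule U A V"
proof -
  interpret A: ring A by (rule A)
  interpret V: abelian_group V by (rule left_moduleD(1)[OF V])
  note D = left_moduleD(2-)[OF V]
  have zero: "\<zero>\<^bsub>A\<^esub> \<odot>\<^bsub>V\<^esub> u = \<zero>\<^bsub>V\<^esub>" if "u \<in> carrier V" for u
    using D(2)[OF A.zero_closed A.zero_closed that] D(1)[OF A.zero_closed that]
    by (metis A.l_zero A.zero_closed V.add.r_cancel_one')
  have neg: "\<ominus>\<^bsub>V\<^esub> u \<in> U" if "u \<in> U" for u
  proof -
    have u: "u \<in> carrier V" using that U by blast
    have 1: "\<ominus>\<^bsub>A\<^esub> \<one>\<^bsub>A\<^esub> \<in> carrier A" by simp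
    have "(\<ominus>\<^bsub>A\<^esub> \<one>\<^bsub>A\<^esub>) \<odot>\<^bsub>V\<^esub> u \<oplus>\<^bsub>V\<^esub> u = \<zero>\<^bsub>V\<^esub>"
      using D(2)[OF 1 A.one_closed u] zero[OF u] D(5)[OF u] by (simp add: A.l_neg)
    then have "\<ominus>\<^bsub>V\<^esub> u = (\<ominus>\<^bsub>A\<^esub> \<one>\<^bsub>A\<^esub>) \<odot>\<^bsub>V\<^esub> u"
      using V.minus_equality D(1)[OF 1 u] u by blast
    then show ?thesis using smult[OF 1 that] by simp
  qed
  have "subgroup U (add_monoid V)"
    by (rule V.add.subgroupI) (use U add neg in \<open>auto simp: a_inv_def\<close>)
  then show ?thesis
    unfolding submodule_def submodule_axioms_def using smult by blast
qed

lemma irreducible_module_on_sets: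
  fixes A :: "('k, 'a) module" and V :: "('a, 'v) module"
  assumes A: "ring A" and V: "irreducible_module A V"
  shows "\<exists>W :: ('a, 'a set) module. irreducible_module A W \<and> module_iso A V W"
proof -
  interpret A: ring A by (rule A)
  have lV: "left_module A V"
    and irr: "\<And>U. submodule U A V \<Longrightarrow> U = {\<zero>\<^bsub>V\<^esub>} \<or> U = carrier V"
    and nz: "carrier V \<noteq> {\<zero>\<^bsub>V\<^esub>}"
    using V unfolding irreducible_module_def by blast+
  interpret V: abelian_group V by (rule left_moduleD(1)[OF lV])
  note D = left_moduleD(2-)[OF lV]
  obtain v where v: "v \<in> carrier V" "v \<noteq> \<zero>\<^bsub>V\<^esub>"
    using nz V.zero_closed by blast
  let ?orb = "(\<lambda>a. a \<odot>\<^bsub>V\<^esub> v) ` carrier A"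
  have "submodule ?orb A V"
  proof (rule submodule_of_left_moduleI[OF A lV])
    show "?orb \<subseteq> carrier V" using D(1) v by blast
    show "?orb \<noteq> {}" using A.one_closed by blast
    show "u \<oplus>\<^bsub>V\<^esub> w \<in> ?orb" if "u \<in> ?orb" "w \<in> ?orb" for u w
      using that D(2)[symmetric] v by (auto intro!: imageI)
    show "a \<odot>\<^bsub>V\<^esub> u \<in> ?orb" if "a \<in> carrier A" "u \<in> ?orb" for a u
      using that D(4)[symmetric] v by (auto intro!: imageI)
  qed
  moreover have "v \<in> ?orb" using D(5)[OF v(1)] A.one_closed by (metis imageI)
  ultimately have orb: "?orb = carrier V" using irr v by blast
  define g where "g = (\<lambda>w. {a \<in> carrier A. a \<odot>\<^bsub>V\<^esub> v = w})"
  have inj: "inj_on g (carrier V)"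
  proof (rule inj_onI)
    fix x y assume x: "x \<in> carrier V" and y: "y \<in> carrier V" and eq: "g x = g y"
    obtain a where a: "a \<in> carrier A" "x = a \<odot>\<^bsub>V\<^esub> v" using x orb by blast
    have "a \<in> g x" using a by (simp add: g_def)
    then have "a \<in> g y" using eq by simp
    then show "x = y" using a by (simp add: g_def)
  qed
  define h where "h = inv_into (carrier V) g"
  have hg: "h (g x) = x" if "x \<in> carrier V" for x
    using inj that by (simp add: h_def)
  define W :: "('a, 'a set) module" where
    "W = \<lparr>carrier = g ` carrier V, mult = (\<lambda>x y. x), one = {},
      ring.zero = g \<zero>\<^bsub>V\<^esub>, add = (\<lambda>x y. g (h x \<oplus>\<^bsub>V\<^esub> h y)),
      smult = (\<lambda>a x. g (a \<odot>\<^bsub>V\<^esub> h x))\<rparr>"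
  have W: "carrier W = g ` carrier V" "\<zero>\<^bsub>W\<^esub> = g \<zero>\<^bsub>V\<^esub>"
    "\<And>x y. x \<oplus>\<^bsub>W\<^esub> y = g (h x \<oplus>\<^bsub>V\<^esub> h y)"
    "\<And>a x. a \<odot>\<^bsub>W\<^esub> x = g (a \<odot>\<^bsub>V\<^esub> h x)"
    by (simp_all add: W_def)
  have "abelian_group W"
  proof (rule abelian_groupI)
    fix x assume "x \<in> carrier W"
    then obtain u where u: "u \<in> carrier V" "x = g u" by (auto simp: W)
    show "\<exists>y\<in>carrier W. y \<oplus>\<^bsub>W\<^esub> x = \<zero>\<^bsub>W\<^esub>"
      using u by (intro bexI[of _ "g (\<ominus>\<^bsub>V\<^esub> u)"]) (auto simp: W hg V.l_neg)
  qed (auto simp: W hg V.a_ac)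
  then have lW: "left_module A W"
    unfolding left_module_def using D by (auto simp: W hg)
  have iso: "module_iso A V W"
    unfolding module_iso_def
  proof (rule bexI[of _ g])
    show "g \<in> iso (add_monoid V) (add_monoid W)"
      using inj by (auto simp: iso_def hom_def bij_betw_def W hg)
  qed (auto simp: W hg)
  have "U = {\<zero>\<^bsub>W\<^esub>} \<or> U = carrier W" if U: "submodule U A W" for U
  proof -
    have sub: "subgroup U (add_monoid W)"
      and sm: "\<And>a x. a \<in> carrier A \<Longrightarrow> x \<in> U \<Longrightarrow> a \<odot>\<^bsub>W\<^esub> x \<in> U"
      using U unfolding submodule_def submodule_axioms_def by blast+
    have Uc: "U \<subseteq> g ` carrier V" using subgroup.subset[OF sub] by (simp add: W)
    have hc: "h x \<in> carrier V" if "x \<in> U" for x using that Uc hg by auto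
    have gh: "g (h x) = x" if "x \<in> U" for x using that Uc hg by auto
    have "submodule (h ` U) A V"
    proof (rule submodule_of_left_moduleI[OF A lV])
      show "h ` U \<subseteq> carrier V" using Uc hg by auto
      show "h ` U \<noteq> {}" using subgroup.one_closed[OF sub] by blast
      show "u \<oplus>\<^bsub>V\<^esub> w \<in> h ` U" if uw: "u \<in> h ` U" "w \<in> h ` U" for u w
      proof -
        obtain x y where xy: "x \<in> U" "y \<in> U" "u = h x" "w = h y" using uw by blast
        have "x \<oplus>\<^bsub>W\<^esub> y \<in> U" using subgroup.m_closed[OF sub xy(1,2)] by simp
        moreover have "h (x \<oplus>\<^bsub>W\<^esub> y) = u \<oplus>\<^bsub>V\<^esub> w"
          using xy hc by (simp add: W hg)
        ultimately show ?thesis by (metis imageI)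
      qed
      show "a \<odot>\<^bsub>V\<^esub> u \<in> h ` U" if au: "a \<in> carrier A" "u \<in> h ` U" for a u
      proof -
        obtain x where x: "x \<in> U" "u = h x" using au by blast
        have "h (a \<odot>\<^bsub>W\<^esub> x) = a \<odot>\<^bsub>V\<^esub> u"
          using x hc D(1) au by (simp add: W hg)
        then show ?thesis using sm[OF au(1) x(1)] by (metis imageI)
      qed
    qed
    then have "h ` U = {\<zero>\<^bsub>V\<^esub>} \<or> h ` U = carrier V" by (rule irr)
    moreover have "U = g ` h ` U" using gh by (force simp: image_image)
    ultimately show ?thesis by (auto simp: W)
  qed
  moreover have "carrier W \<noteq> {\<zero>\<^bsub>W\<^esub>}"
  proof
    assume "carrier W = {\<zero>\<^bsub>W\<^esub>}"
    then have "g v = g \<zero>\<^bsub>V\<^esub>" using v by (auto simp: W)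
    then show False using inj v by (auto dest: inj_onD)
  qed
  ultimately show ?thesis
    using lW iso unfolding irreducible_module_def by blast
qed

text \<open>Irreducible modules are taken with carrier in the type \<open>'a set\<close>. This loses nothing: an
  irreducible module is isomorphic to a quotient of the regular module by a left ideal, and the
  elements of that quotient are subsets of the algebra (see \<open>irreducible_module_on_sets\<close> above).\<close>

definition Irr :: "('k, 'a) module \<Rightarrow> ('a, 'a set) module set set" where
  "Irr A = {V. irreducible_module A V} //
     {(V, W). irreducible_module A V \<and> irreducible_module A W \<and> module_iso A V W}"

definition Vrep :: "('a, 'a set) module set \<Rightarrow> ('a, 'a set) module" where
  "Vrep \<nu> = (SOME V. V \<in> \<nu>)"

definition eps :: "('k, 'a) module \<Rightarrow> ('a, 'a set) module set \<Rightarrow> 'a" where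
  "eps A \<nu> = (THE e. primitive_central_idempotent A e \<and>
     (\<forall>v\<in>carrier (Vrep \<nu>). e \<odot>\<^bsub>Vrep \<nu>\<^esub> v = v) \<and>
     (\<forall>\<nu>'\<in>Irr A. \<nu>' \<noteq> \<nu> \<longrightarrow>
        (\<forall>v\<in>carrier (Vrep \<nu>'). e \<odot>\<^bsub>Vrep \<nu>'\<^esub> v = \<zero>\<^bsub>Vrep \<nu>'\<^esub>)))"

definition restrict_scalars :: "('a \<Rightarrow> 'b) \<Rightarrow> ('b, 'v) module \<Rightarrow> ('a, 'v) module" where
  "restrict_scalars h V = \<lparr>carrier = carrier V, mult = mult V, one = one V,
     ring.zero = ring.zero V, add = add V, smult = (\<lambda>a v. h a \<odot>\<^bsub>V\<^esub> v)\<rparr>"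

definition direct_summand :: "('k, 'a) module \<Rightarrow> 'v set \<Rightarrow> ('a, 'v) module \<Rightarrow> bool" where
  "direct_summand A U V \<longleftrightarrow> submodule U A V \<and>
     (\<exists>W. submodule W A V \<and> U \<inter> W = {\<zero>\<^bsub>V\<^esub>} \<and> U <+>\<^bsub>V\<^esub> W = carrier V)"


section \<open>Multiplicity-free families\<close>

definition multiplicity_free_restriction ::
  "('k, 'a) module \<Rightarrow> ('k, 'a) module \<Rightarrow> ('a \<Rightarrow> 'a) \<Rightarrow> bool" where
  "multiplicity_free_restriction A B h \<longleftrightarrow>
     (\<forall>V :: ('a, 'a set) module. irreducible_module B V \<longrightarrow>
        (\<exists>r (M :: nat \<Rightarrow> ('a, 'a set) module).
           (\<forall>i<r. irreducible_module A (M i)) \<and>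
           (\<forall>i<r. \<forall>j<r. i \<noteq> j \<longrightarrow> \<not> module_iso A (M i) (M j)) \<and>
           module_iso A (restrict_scalars h V) (direct_sum r M)))"

text \<open>The embeddings \<open>\<iota> n : A n \<rightarrow> A (n + 1)\<close> are part of the data.\<close>

definition multiplicity_free_family ::
  "(nat \<Rightarrow> ('k::field, 'a) module) \<Rightarrow> (nat \<Rightarrow> 'a \<Rightarrow> 'a) \<Rightarrow> bool" where
  "multiplicity_free_family A \<iota> \<longleftrightarrow>
     (\<forall>n. split_semisimple (A n)) \<and>
     algebra_iso (A 0) (field_algebra :: ('k, 'k) module) \<and>
     (\<forall>n. \<iota> n \<in> algebra_hom (A n) (A (Suc n)) \<and> inj_on (\<iota> n) (carrier (A n))) \<and>
     (\<forall>n. multiplicity_free_restriction (A n) (A (Suc n)) (\<iota> n))"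

text \<open>\<open>incl \<iota> m n\<close> is the composite embedding of \<open>A m\<close> into \<open>A n\<close>, for \<open>m \<le> n\<close>.\<close>

primrec incl :: "(nat \<Rightarrow> 'a \<Rightarrow> 'a) \<Rightarrow> nat \<Rightarrow> nat \<Rightarrow> 'a \<Rightarrow> 'a" where
  "incl \<iota> m 0 x = x"
| "incl \<iota> m (Suc n) x = (if m \<le> n then \<iota> n (incl \<iota> m n x) else x)"

definition edge :: "(nat \<Rightarrow> ('k, 'a) module) \<Rightarrow> (nat \<Rightarrow> 'a \<Rightarrow> 'a) \<Rightarrow> nat \<Rightarrow>
    ('a, 'a set) module set \<Rightarrow> ('a, 'a set) module set \<Rightarrow> bool" where
  "edge A \<iota> m \<mu> \<nu> \<longleftrightarrow> \<mu> \<in> Irr (A m) \<and> \<nu> \<in> Irr (A (Suc m)) \<and>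
     (let R = restrict_scalars (\<iota> m) (Vrep \<nu>) in
        \<exists>U. direct_summand (A m) U R \<and> module_iso (A m) (Vrep \<mu>) (R\<lparr>carrier := U\<rparr>))"

text \<open>A path \<open>\<nu>\<^sub>0 \<rightarrow> \<dots> \<rightarrow> \<nu>\<^sub>n\<close> is the list \<open>[\<nu>\<^sub>0, \<dots>, \<nu>\<^sub>n]\<close> of its vertices, so its type is
  its \<open>last\<close> entry and deleting the last edge is \<open>butlast\<close>.\<close>

definition Tab :: "(nat \<Rightarrow> ('k, 'a) module) \<Rightarrow> (nat \<Rightarrow> 'a \<Rightarrow> 'a) \<Rightarrow> nat \<Rightarrow>
    ('a, 'a set) module set list set" where
  "Tab A \<iota> n = {T. length T = Suc n \<and> T ! 0 \<in> Irr (A 0) \<and>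
     (\<forall>k<n. edge A \<iota> k (T ! k) (T ! Suc k))}"

definition eps_path :: "(nat \<Rightarrow> ('k, 'a) module) \<Rightarrow> (nat \<Rightarrow> 'a \<Rightarrow> 'a) \<Rightarrow> nat \<Rightarrow>
    ('a, 'a set) module set list \<Rightarrow> 'a" where
  "eps_path A \<iota> n T =
     foldr (\<lambda>k x. incl \<iota> k n (eps (A k) (T ! k)) \<otimes>\<^bsub>A n\<^esub> x) [1..<Suc n] \<one>\<^bsub>A n\<^esub>"

text \<open>The Gelfand--Zetlin subalgebra (usually written as calligraphic X with index n).\<close>

definition GZ :: "(nat \<Rightarrow> ('k, 'a) module) \<Rightarrow> (nat \<Rightarrow> 'a \<Rightarrow> 'a) \<Rightarrow> nat \<Rightarrow> 'a set" where
  "GZ A \<iota> n = generated_subalg (A n) (\<Union>k\<in>{1..n}. incl \<iota> k n ` center (A k))"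


section \<open>Jucys--Murphy sequences\<close>

text \<open>Only the entries \<open>J n\<close> with \<open>n \<ge> 1\<close> are relevant.\<close>

definition additively_central ::
  "(nat \<Rightarrow> ('k, 'a) module) \<Rightarrow> (nat \<Rightarrow> 'a \<Rightarrow> 'a) \<Rightarrow> (nat \<Rightarrow> 'a) \<Rightarrow> bool" where
  "additively_central A \<iota> J \<longleftrightarrow>
     (\<forall>n\<ge>1. (\<Oplus>\<^bsub>A n\<^esub>k\<in>{1..n}. incl \<iota> k n (J k)) \<in> center (A n))"

definition separating ::
  "(nat \<Rightarrow> ('k, 'a) module) \<Rightarrow> (nat \<Rightarrow> 'a \<Rightarrow> 'a) \<Rightarrow> (nat \<Rightarrow> 'a) \<Rightarrow> bool" where
  "separating A \<iota> J \<longleftrightarrow>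
     (\<forall>n\<ge>1. GZ A \<iota> n = generated_subalg (A n) ((\<lambda>k. incl \<iota> k n (J k)) ` {1..n}))"

definition JM_sequence ::
  "(nat \<Rightarrow> ('k, 'a) module) \<Rightarrow> (nat \<Rightarrow> 'a \<Rightarrow> 'a) \<Rightarrow> (nat \<Rightarrow> 'a) \<Rightarrow> bool" where
  "JM_sequence A \<iota> J \<longleftrightarrow>
     (\<forall>n\<ge>1. J n \<in> GZ A \<iota> n) \<and> additively_central A \<iota> J \<and> separating A \<iota> J"

text \<open>The family \<open>(c\<^sub>T(k))\<close> indexed by \<open>T \<in> Tab n\<close>; extensionality makes it unique as a function.\<close>

definition JM_coeff :: "(nat \<Rightarrow> ('k, 'a) module) \<Rightarrow> (nat \<Rightarrow> 'a \<Rightarrow> 'a) \<Rightarrow> (nat \<Rightarrow> 'a) \<Rightarrow>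
    nat \<Rightarrow> nat \<Rightarrow> ('a, 'a set) module set list \<Rightarrow> 'k" where
  "JM_coeff A \<iota> J n k = (THE c. c \<in> extensional (Tab A \<iota> n) \<and>
     incl \<iota> k n (J k) = (\<Oplus>\<^bsub>A n\<^esub>T\<in>Tab A \<iota> n. c T \<odot>\<^bsub>A n\<^esub> eps_path A \<iota> n T))"

text \<open>The product is taken in the commutative subalgebra \<open>GZ A \<iota> n\<close>, because \<open>finprod\<close> is
  meant for commutative monoids.\<close>

definition P_path :: "(nat \<Rightarrow> ('k::field, 'a) module) \<Rightarrow> (nat \<Rightarrow> 'a \<Rightarrow> 'a) \<Rightarrow> (nat \<Rightarrow> 'a) \<Rightarrow>
    nat \<Rightarrow> ('a, 'a set) module set list \<Rightarrow> 'a" where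
  "P_path A \<iota> J n T =
     (\<Otimes>\<^bsub>(A n)\<lparr>carrier := GZ A \<iota> n\<rparr>\<^esub>
        S\<in>{S \<in> Tab A \<iota> n. S \<noteq> T \<and> butlast S = butlast T}.
        (1 / (JM_coeff A \<iota> J n n T - JM_coeff A \<iota> J n n S)) \<odot>\<^bsub>A n\<^esub>
        (J n \<ominus>\<^bsub>A n\<^esub> JM_coeff A \<iota> J n n S \<odot>\<^bsub>A n\<^esub> \<one>\<^bsub>A n\<^esub>))"

text \<open>The common value of \<open>P_path A \<iota> J n T\<close> over all \<open>T\<close> of type \<open>\<nu>\<close> whose truncation has
  type \<open>\<mu>\<close>.\<close>

definition P_type :: "(nat \<Rightarrow> ('k::field, 'a) module) \<Rightarrow> (nat \<Rightarrow> 'a \<Rightarrow> 'a) \<Rightarrow> (nat \<Rightarrow> 'a) \<Rightarrow>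
    nat \<Rightarrow> ('a, 'a set) module set \<Rightarrow> ('a, 'a set) module set \<Rightarrow> 'a" where
  "P_type A \<iota> J n \<nu> \<mu> = (THE p. \<forall>T\<in>Tab A \<iota> n.
     last T = \<nu> \<and> last (butlast T) = \<mu> \<longrightarrow> P_path A \<iota> J n T = p)"

end

theory Submission
  imports Defs
begin

text \<open>Write \<open>\<epsilon>(\<nu>)\<close> for \<open>eps (A n) \<nu>\<close> and \<open>\<epsilon>\<^sub>T\<close> for \<open>eps_path A \<iota> n T\<close>, and suppress the embeddings.

  Since \<open>1\<close> is the sum of all \<open>\<epsilon>(\<mu>)\<close> with \<open>\<mu> \<in> Irr (A (n - 1))\<close>, and \<open>\<epsilon>(\<mu>) \<epsilon>(\<nu>)\<close> vanishes unless
  there is an edge from \<open>\<mu>\<close> to \<open>\<nu>\<close>, \<open>\<epsilon>(\<nu>)\<close> is the sum of \<open>\<epsilon>(\<mu>) \<epsilon>(\<nu>)\<close> over the predecessors \<open>\<mu>\<close>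
  of \<open>\<nu>\<close> (\<open>eps_sum_over_predecessors\<close>). The formula therefore holds term by term, once it is known
  that \<open>P_type A \<iota> J n \<nu> \<mu>\<close> times \<open>\<epsilon>(\<mu>)\<close> equals \<open>\<epsilon>(\<mu>) \<epsilon>(\<nu>)\<close> (\<open>P_type_mult_eps\<close>).

  To see this, expand \<open>\<epsilon>(\<mu>)\<close> as the sum of \<open>\<epsilon>\<^sub>S\<close> over the paths \<open>S\<close> ending in \<open>\<mu>\<close>, and each \<open>\<epsilon>\<^sub>S\<close> as
  the sum of \<open>\<epsilon>\<^sub>T\<close> over the extensions \<open>T\<close> of \<open>S\<close> by one edge. The \<open>\<epsilon>\<^sub>T\<close> are nonzero orthogonal
  idempotents on which \<open>J n\<close> acts by the scalars \<open>JM_coeff A \<iota> J n n T\<close>, so \<open>P_path A \<iota> J n T\<close> is the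
  Lagrange interpolation polynomial in \<open>J n\<close> that fixes \<open>\<epsilon>\<^sub>T\<close> and kills its siblings, provided that
  siblings have different eigenvalues. They do because the sequence is separating
  (\<open>siblings_separated\<close>): siblings agree on \<open>J 1, \<dots>, J (n - 1)\<close>, so if they agreed on \<open>J n\<close>, then no
  element of \<open>GZ A \<iota> n\<close> could tell them apart, yet \<open>\<epsilon>\<^sub>T\<close> itself does. That this polynomial
  depends only on \<open>\<mu>\<close> and \<open>\<nu>\<close> is additive centrality (\<open>J_eigenvalue_by_last_edge\<close>): \<open>J n\<close> is the
  difference of two partial sums, one central in \<open>A n\<close> and one central in \<open>A (n - 1)\<close>, so its eigenvalue
  on a path is a function of \<open>\<nu>\<close> minus a function of \<open>\<mu>\<close>.

  All of this rests on the representation theory of a split semisimple algebra: the irreducible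
  modules correspond to the matrix blocks, \<open>\<epsilon>(\<nu>)\<close> is the identity matrix of a block, central elements
  are scalar on each block, and a block acts faithfully on its irreducible module. These facts are
  derived from the multiplication table of the matrix units. Restriction enters in two
  places: a submodule isomorphic to \<open>V\<^sup>\<mu>\<close> inside \<open>V\<^sup>\<nu>\<close> makes the \<open>\<epsilon>\<^sub>T\<close> nonzero, and the multiplicity-free
  decomposition of \<open>V\<^sup>\<nu>\<close> shows that \<open>\<epsilon>(\<mu>) \<epsilon>(\<nu>) \<noteq> 0\<close> forces an edge.\<close>

section \<open>Sums, scalars and generated subalgebras\<close>

lemma (in abelian_monoid) finsum_eq_zeroI:
  assumes "\<And>i. i \<in> I \<Longrightarrow> f i = \<zero>"
  shows "finsum G f I = \<zero>"
  using assms by (rule add.finprod_one_eqI)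

lemma (in abelian_monoid) finsum_single_term:
  assumes "finite I" "j \<in> I" "f j \<in> carrier G" "\<And>i. i \<in> I \<Longrightarrow> i \<noteq> j \<Longrightarrow> f i = \<zero>"
  shows "finsum G f I = f j"
proof -
  have "finsum G f I = finsum G f {j}"
    using assms by (intro add.finprod_mono_neutral_cong_right) (auto, metis zero_closed)
  then show ?thesis using assms by simp
qed

lemma (in abelian_monoid) finsum_nested:
  assumes "finite I" "\<And>i. i \<in> I \<Longrightarrow> finite (B i)"
    and "\<And>i j. i \<in> I \<Longrightarrow> j \<in> I \<Longrightarrow> i \<noteq> j \<Longrightarrow> B i \<inter> B j = {}"
    and "\<And>i x. i \<in> I \<Longrightarrow> x \<in> B i \<Longrightarrow> g x \<in> carrier G"
  shows "finsum G g (\<Union>i\<in>I. B i) = (\<Oplus>i\<in>I. finsum G g (B i))"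
  by (rule add.finprod_UN_disjoint[of I B g, simplified])
    (use assms in \<open>auto simp: pairwise_def disjnt_def\<close>)

lemma ring_hom_finsum:
  assumes R: "ring R" and S: "ring S" and h: "h \<in> ring_hom R S"
    and f: "\<And>i. i \<in> I \<Longrightarrow> f i \<in> carrier R"
  shows "h (finsum R f I) = (\<Oplus>\<^bsub>S\<^esub>i\<in>I. h (f i))"
proof -
  interpret ring_hom_ring R S h using R S h by (simp add: ring_hom_ring.intro ring_hom_ring_axioms.intro)
  show ?thesis using f hom_finsum[of f I] by (simp add: comp_def Pi_def)
qed

locale field_alg =
  fixes A :: "('k::field, 'a) module" (structure)
  assumes fd: "fd_algebra A"
begin

sublocale ring A using fd by (simp add: fd_algebra_def)

lemma scalar_module: "module (field_algebra :: ('k, 'k) module) A"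
  using fd by (simp add: fd_algebra_def)

lemma scalar_closed [simp, intro]: "x \<in> carrier A \<Longrightarrow> c \<odot> x \<in> carrier A"
  using module.smult_closed[OF scalar_module, of c x] by (simp add: field_algebra_def)

lemma scalar_add_left: "x \<in> carrier A \<Longrightarrow> (c + c') \<odot> x = c \<odot> x \<oplus> c' \<odot> x"
  using module.smult_l_distr[OF scalar_module, of c c' x] by (simp add: field_algebra_def)

lemma scalar_scalar: "x \<in> carrier A \<Longrightarrow> c \<odot> (c' \<odot> x) = (c * c') \<odot> x"
  using module.smult_assoc1[OF scalar_module, of c c' x] by (simp add: field_algebra_def)

lemma scalar_one [simp]: "x \<in> carrier A \<Longrightarrow> 1 \<odot> x = x"
  using module.smult_one[OF scalar_module, of x] by (simp add: field_algebra_def)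

lemma scalar_zero_left [simp]: "x \<in> carrier A \<Longrightarrow> 0 \<odot> x = \<zero>"
  using module.smult_l_null[OF scalar_module, of x] by (simp add: field_algebra_def)

lemma scalar_zero_right [simp]: "c \<odot> \<zero> = \<zero>"
  using module.smult_r_null[OF scalar_module, of c] by (simp add: field_algebra_def)

lemma scalar_mult_left:
  "x \<in> carrier A \<Longrightarrow> y \<in> carrier A \<Longrightarrow> (c \<odot> x) \<otimes> y = c \<odot> (x \<otimes> y)"
  using fd by (simp add: fd_algebra_def)

lemma scalar_mult_right:
  "x \<in> carrier A \<Longrightarrow> y \<in> carrier A \<Longrightarrow> x \<otimes> (c \<odot> y) = c \<odot> (x \<otimes> y)"
  using fd by (simp add: fd_algebra_def)

lemma scalar_eq_zeroD:
  assumes "c \<odot> x = \<zero>" "x \<in> carrier A" "x \<noteq> \<zero>"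
  shows "c = 0"
proof (rule ccontr)
  assume "c \<noteq> 0"
  then have "x = (1 / c) \<odot> (c \<odot> x)" using assms(2) by (simp add: scalar_scalar)
  also have "\<dots> = \<zero>" by (simp only: assms(1) scalar_zero_right)
  finally show False using assms(3) by simp
qed

lemma scalar_diff_left: "x \<in> carrier A \<Longrightarrow> (c - c') \<odot> x = c \<odot> x \<ominus> c' \<odot> x"
  using scalar_add_left[of x "c - c'" c'] by (simp add: minus_eq a_assoc r_neg)

lemma scalar_cancel:
  assumes "c \<odot> x = c' \<odot> x" "x \<in> carrier A" "x \<noteq> \<zero>"
  shows "c = c'"
  using scalar_eq_zeroD[of "c - c'" x] assms by (simp add: scalar_diff_left)

lemma scalar_uminus: "x \<in> carrier A \<Longrightarrow> (- c) \<odot> x = \<ominus> (c \<odot> x)"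
  using scalar_diff_left[of x 0 c] by (simp add: minus_eq)

lemma centerD:
  assumes "z \<in> center A"
  shows "z \<in> carrier A" "x \<in> carrier A \<Longrightarrow> z \<otimes> x = x \<otimes> z"
  using assms by (auto simp: center_def)

lemma subalgI:
  assumes "B \<subseteq> carrier A" "\<one> \<in> B" "\<And>x y. x \<in> B \<Longrightarrow> y \<in> B \<Longrightarrow> x \<otimes> y \<in> B"
    "\<And>x y. x \<in> B \<Longrightarrow> y \<in> B \<Longrightarrow> x \<oplus> y \<in> B" "\<And>c x. x \<in> B \<Longrightarrow> c \<odot> x \<in> B"
  shows "subalg B A"
proof -
  have "\<ominus> x \<in> B" if "x \<in> B" for x
    using scalar_uminus[of x 1] assms(1) assms(5)[of x "-1"] that by auto
  then have "subring B A" using assms by (intro subringI) auto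
  then show ?thesis using assms by (simp add: subalg_def)
qed

lemma subalgD:
  assumes "subalg B A"
  shows "B \<subseteq> carrier A" "\<one> \<in> B" "\<And>x y. x \<in> B \<Longrightarrow> y \<in> B \<Longrightarrow> x \<otimes> y \<in> B"
    "\<And>x y. x \<in> B \<Longrightarrow> y \<in> B \<Longrightarrow> x \<oplus> y \<in> B" "\<And>c x. x \<in> B \<Longrightarrow> c \<odot> x \<in> B"
    "\<And>x y. x \<in> B \<Longrightarrow> y \<in> B \<Longrightarrow> x \<ominus> y \<in> B"
proof -
  have s: "subring B A" using assms by (simp add: subalg_def)
  show "B \<subseteq> carrier A" "\<one> \<in> B" "\<And>x y. x \<in> B \<Longrightarrow> y \<in> B \<Longrightarrow> x \<otimes> y \<in> B"
    "\<And>x y. x \<in> B \<Longrightarrow> y \<in> B \<Longrightarrow> x \<oplus> y \<in> B" "\<And>c x. x \<in> B \<Longrightarrow> c \<odot> x \<in> B"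
    using subringE[OF s] assms by (auto simp: subalg_def)
  show "\<And>x y. x \<in> B \<Longrightarrow> y \<in> B \<Longrightarrow> x \<ominus> y \<in> B"
    using subringE[OF s] by (auto simp: minus_eq)
qed

lemma subalg_generated:
  assumes "S \<subseteq> carrier A"
  shows "subalg (generated_subalg A S) A"
proof -
  have "subalg (carrier A) A" by (rule subalgI) auto
  then have "generated_subalg A S \<subseteq> carrier A"
    using assms by (auto simp: generated_subalg_def)
  then show ?thesis
    by (rule subalgI) (auto simp: generated_subalg_def dest: subalgD(2-5))
qed

lemma generated_incl: "S \<subseteq> generated_subalg A S"
  by (auto simp: generated_subalg_def)

lemma generated_minimal: "subalg B A \<Longrightarrow> S \<subseteq> B \<Longrightarrow> generated_subalg A S \<subseteq> B"
  by (auto simp: generated_subalg_def)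

lemma subalg_centralizer:
  assumes "S \<subseteq> carrier A"
  shows "subalg {x \<in> carrier A. \<forall>s\<in>S. x \<otimes> s = s \<otimes> x} A"
proof (rule subalgI)
  fix x y assume xy: "x \<in> {x \<in> carrier A. \<forall>s\<in>S. x \<otimes> s = s \<otimes> x}"
    "y \<in> {x \<in> carrier A. \<forall>s\<in>S. x \<otimes> s = s \<otimes> x}"
  show "x \<otimes> y \<in> {x \<in> carrier A. \<forall>s\<in>S. x \<otimes> s = s \<otimes> x}"
  proof (safe)
    fix s assume s: "s \<in> S"
    have c: "s \<in> carrier A" "x \<in> carrier A" "y \<in> carrier A" "x \<otimes> s = s \<otimes> x" "y \<otimes> s = s \<otimes> y"
      using s xy assms by auto
    have "x \<otimes> y \<otimes> s = x \<otimes> s \<otimes> y" using c by (metis m_assoc)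
    then show "x \<otimes> y \<otimes> s = s \<otimes> (x \<otimes> y)" using c by (metis m_assoc)
  qed (use xy in auto)
qed (use assms in \<open>auto simp: l_distr r_distr subsetD scalar_mult_left scalar_mult_right\<close>)

text \<open>The generators lie in the centralizer of the generators, hence so does the whole generated
  subalgebra; so the generators centralize it, and the same argument once more finishes.\<close>

lemma generated_commutative:
  assumes S: "S \<subseteq> carrier A" and comm: "\<And>s t. s \<in> S \<Longrightarrow> t \<in> S \<Longrightarrow> s \<otimes> t = t \<otimes> s"
    and x: "x \<in> generated_subalg A S" and y: "y \<in> generated_subalg A S"
  shows "x \<otimes> y = y \<otimes> x"
proof -
  let ?C = "\<lambda>S. {x \<in> carrier A. \<forall>s\<in>S. x \<otimes> s = s \<otimes> x}"
  have 1: "generated_subalg A S \<subseteq> ?C S"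
    using S comm by (intro generated_minimal subalg_centralizer) auto
  then have "generated_subalg A S \<subseteq> carrier A" by blast
  then have "generated_subalg A S \<subseteq> ?C (generated_subalg A S)"
    using S 1 by (intro generated_minimal[OF subalg_centralizer]) force+
  then show ?thesis using x y by blast
qed

text \<open>Whether all of a generated subalgebra acts on a set of elements by common scalars can thus be
  checked on generators.\<close>

lemma subalg_common_eigenvectors:
  assumes "\<And>e. e \<in> D \<Longrightarrow> e \<in> carrier A"
  shows "subalg {x \<in> carrier A. \<exists>c. \<forall>e\<in>D. x \<otimes> e = c \<odot> e} A" (is "subalg ?B _")
proof (rule subalgI)
  show "\<one> \<in> ?B" using assms by (auto intro!: exI[of _ 1])
next
  fix x y assume "x \<in> ?B" "y \<in> ?B"
  then obtain c c' where x: "x \<in> carrier A" "\<And>e. e \<in> D \<Longrightarrow> x \<otimes> e = c \<odot> e"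
    and y: "y \<in> carrier A" "\<And>e. e \<in> D \<Longrightarrow> y \<otimes> e = c' \<odot> e" by blast
  have "\<forall>e\<in>D. x \<otimes> y \<otimes> e = (c' * c) \<odot> e"
    using x y assms by (auto simp: m_assoc scalar_mult_right scalar_scalar)
  then show "x \<otimes> y \<in> ?B" using x(1) y(1) by blast
  have "\<forall>e\<in>D. (x \<oplus> y) \<otimes> e = (c + c') \<odot> e"
    using x y assms by (auto simp: l_distr scalar_add_left)
  then show "x \<oplus> y \<in> ?B" using x(1) y(1) by blast
next
  fix c x assume "x \<in> ?B"
  then obtain c' where x: "x \<in> carrier A" "\<And>e. e \<in> D \<Longrightarrow> x \<otimes> e = c' \<odot> e" by blast
  have "\<forall>e\<in>D. (c \<odot> x) \<otimes> e = (c * c') \<odot> e"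
    using x assms by (auto simp: scalar_mult_left scalar_scalar)
  then show "c \<odot> x \<in> ?B" using x(1) by blast
qed auto

end

section \<open>Left modules\<close>

locale lmodule = A: ring A + V: abelian_group V
  for A :: "('k, 'a) module" and V :: "('a, 'v) module" +
  assumes left_module: "left_module A V"
begin

lemmas act_closed [simp, intro] = left_moduleD(2)[OF left_module]
lemmas act_add_left = left_moduleD(3)[OF left_module]
lemmas act_add_right = left_moduleD(4)[OF left_module]
lemmas act_mult = left_moduleD(5)[OF left_module]
lemmas act_one [simp] = left_moduleD(6)[OF left_module]

lemma act_zero_left [simp]: "v \<in> carrier V \<Longrightarrow> \<zero>\<^bsub>A\<^esub> \<odot>\<^bsub>V\<^esub> v = \<zero>\<^bsub>V\<^esub>"
  using act_add_left[of "\<zero>\<^bsub>A\<^esub>" "\<zero>\<^bsub>A\<^esub>" v] act_closed[of "\<zero>\<^bsub>A\<^esub>" v]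
  by (metis A.l_zero A.zero_closed V.add.r_cancel_one')

lemma act_zero_right [simp]: "a \<in> carrier A \<Longrightarrow> a \<odot>\<^bsub>V\<^esub> \<zero>\<^bsub>V\<^esub> = \<zero>\<^bsub>V\<^esub>"
  using act_add_right[of a "\<zero>\<^bsub>V\<^esub>" "\<zero>\<^bsub>V\<^esub>"] act_closed[of a "\<zero>\<^bsub>V\<^esub>"]
  by (metis V.l_zero V.zero_closed V.add.r_cancel_one')

lemma act_uminus_left:
  assumes "a \<in> carrier A" "v \<in> carrier V"
  shows "(\<ominus>\<^bsub>A\<^esub> a) \<odot>\<^bsub>V\<^esub> v = \<ominus>\<^bsub>V\<^esub> (a \<odot>\<^bsub>V\<^esub> v)"
proof -
  have "(\<ominus>\<^bsub>A\<^esub> a) \<odot>\<^bsub>V\<^esub> v \<oplus>\<^bsub>V\<^esub> a \<odot>\<^bsub>V\<^esub> v = \<zero>\<^bsub>V\<^esub>"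
    using act_add_left[of "\<ominus>\<^bsub>A\<^esub> a" a v] assms by (simp add: A.l_neg)
  then show ?thesis using V.minus_equality assms by (metis A.a_inv_closed act_closed)
qed

lemma act_uminus_right:
  assumes "a \<in> carrier A" "v \<in> carrier V"
  shows "a \<odot>\<^bsub>V\<^esub> (\<ominus>\<^bsub>V\<^esub> v) = \<ominus>\<^bsub>V\<^esub> (a \<odot>\<^bsub>V\<^esub> v)"
proof -
  have "a \<odot>\<^bsub>V\<^esub> (\<ominus>\<^bsub>V\<^esub> v) \<oplus>\<^bsub>V\<^esub> a \<odot>\<^bsub>V\<^esub> v = \<zero>\<^bsub>V\<^esub>"
    using act_add_right[of a "\<ominus>\<^bsub>V\<^esub> v" v] assms by (simp add: V.l_neg)
  then show ?thesis using V.minus_equality assms by (metis V.a_inv_closed act_closed)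
qed

lemma act_diff_left:
  "a \<in> carrier A \<Longrightarrow> b \<in> carrier A \<Longrightarrow> v \<in> carrier V \<Longrightarrow>
    (a \<ominus>\<^bsub>A\<^esub> b) \<odot>\<^bsub>V\<^esub> v = a \<odot>\<^bsub>V\<^esub> v \<ominus>\<^bsub>V\<^esub> b \<odot>\<^bsub>V\<^esub> v"
  by (simp add: A.minus_eq V.minus_eq act_add_left act_uminus_left)

lemma diff_eq_zero_iff:
  "u \<in> carrier V \<Longrightarrow> v \<in> carrier V \<Longrightarrow> u \<ominus>\<^bsub>V\<^esub> v = \<zero>\<^bsub>V\<^esub> \<longleftrightarrow> u = v"
  by (metis V.a_inv_closed V.minus_eq V.minus_equality V.minus_minus V.r_neg)

lemma act_finsum_eq_zero:
  assumes "finite I" "\<And>i. i \<in> I \<Longrightarrow> f i \<in> carrier A" "v \<in> carrier V"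
    "\<And>i. i \<in> I \<Longrightarrow> f i \<odot>\<^bsub>V\<^esub> v = \<zero>\<^bsub>V\<^esub>"
  shows "finsum A f I \<odot>\<^bsub>V\<^esub> v = \<zero>\<^bsub>V\<^esub>"
  using assms by (induction I rule: finite_induct) (auto simp: act_add_left Pi_def)

lemma submoduleI:
  assumes "U \<subseteq> carrier V" "U \<noteq> {}" "\<And>u w. u \<in> U \<Longrightarrow> w \<in> U \<Longrightarrow> u \<oplus>\<^bsub>V\<^esub> w \<in> U"
    "\<And>a u. a \<in> carrier A \<Longrightarrow> u \<in> U \<Longrightarrow> a \<odot>\<^bsub>V\<^esub> u \<in> U"
  shows "submodule U A V"
  using assms A.ring_axioms left_module by (intro submodule_of_left_moduleI)

end

lemma lmoduleI: "ring A \<Longrightarrow> left_module A V \<Longrightarrow> lmodule A V"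
  by (simp add: lmodule_def lmodule_axioms_def left_moduleD(1))

lemma irreducible_lmodule: "ring A \<Longrightarrow> irreducible_module A V \<Longrightarrow> lmodule A V"
  by (simp add: irreducible_module_def lmoduleI)

lemma irreducibleD:
  assumes "irreducible_module A V"
  shows "submodule U A V \<Longrightarrow> u \<in> U \<Longrightarrow> u \<noteq> \<zero>\<^bsub>V\<^esub> \<Longrightarrow> U = carrier V"
    and "\<exists>v\<in>carrier V. v \<noteq> \<zero>\<^bsub>V\<^esub>"
proof -
  show "submodule U A V \<Longrightarrow> u \<in> U \<Longrightarrow> u \<noteq> \<zero>\<^bsub>V\<^esub> \<Longrightarrow> U = carrier V"
    using assms unfolding irreducible_module_def by blast
  have "\<zero>\<^bsub>V\<^esub> \<in> carrier V"
    using assms unfolding irreducible_module_def left_module_def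
    by (meson abelian_group.axioms(1) abelian_monoid.zero_closed)
  then show "\<exists>v\<in>carrier V. v \<noteq> \<zero>\<^bsub>V\<^esub>"
    using assms unfolding irreducible_module_def by blast
qed

lemma module_isoI:
  assumes "bij_betw f (carrier V) (carrier W)"
    "\<And>u v. u \<in> carrier V \<Longrightarrow> v \<in> carrier V \<Longrightarrow> f (u \<oplus>\<^bsub>V\<^esub> v) = f u \<oplus>\<^bsub>W\<^esub> f v"
    "\<And>a v. a \<in> carrier A \<Longrightarrow> v \<in> carrier V \<Longrightarrow> f (a \<odot>\<^bsub>V\<^esub> v) = a \<odot>\<^bsub>W\<^esub> f v"
  shows "module_iso A V W"
  unfolding module_iso_def
  by (rule bexI[of _ f]) (use assms in \<open>auto simp: iso_def hom_def bij_betw_def\<close>)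

lemma module_isoE:
  assumes "module_iso A V W"
  obtains f where "bij_betw f (carrier V) (carrier W)"
    "\<And>u v. u \<in> carrier V \<Longrightarrow> v \<in> carrier V \<Longrightarrow> f (u \<oplus>\<^bsub>V\<^esub> v) = f u \<oplus>\<^bsub>W\<^esub> f v"
    "\<And>a v. a \<in> carrier A \<Longrightarrow> v \<in> carrier V \<Longrightarrow> f (a \<odot>\<^bsub>V\<^esub> v) = a \<odot>\<^bsub>W\<^esub> f v"
  using assms by (auto simp: module_iso_def iso_def hom_def)

lemma module_iso_refl: "module_iso A V V"
  by (rule module_isoI[of id]) auto

lemma module_iso_sym:
  assumes "lmodule A V" "module_iso A V W"
  shows "module_iso A W V"
proof -
  interpret lmodule A V by fact
  obtain f where f: "bij_betw f (carrier V) (carrier W)"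
    "\<And>u v. u \<in> carrier V \<Longrightarrow> v \<in> carrier V \<Longrightarrow> f (u \<oplus>\<^bsub>V\<^esub> v) = f u \<oplus>\<^bsub>W\<^esub> f v"
    "\<And>a v. a \<in> carrier A \<Longrightarrow> v \<in> carrier V \<Longrightarrow> f (a \<odot>\<^bsub>V\<^esub> v) = a \<odot>\<^bsub>W\<^esub> f v"
    using assms(2) by (rule module_isoE) blast
  define g where "g = the_inv_into (carrier V) f"
  have inj: "inj_on f (carrier V)" and im: "carrier W = f ` carrier V"
    using f(1) by (auto simp: bij_betw_def)
  have gf: "g (f v) = v" if "v \<in> carrier V" for v
    using the_inv_into_f_f[OF inj that] by (simp add: g_def)
  show ?thesis
  proof (rule module_isoI)
    show "bij_betw g (carrier W) (carrier V)" unfolding g_def by (rule bij_betw_the_inv_into[OF f(1)])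
  qed (auto simp: im gf f(2,3)[symmetric])
qed

lemma module_iso_trans:
  assumes "module_iso A U V" "module_iso A V W"
  shows "module_iso A U W"
proof -
  obtain f where f: "bij_betw f (carrier U) (carrier V)"
    "\<And>u v. u \<in> carrier U \<Longrightarrow> v \<in> carrier U \<Longrightarrow> f (u \<oplus>\<^bsub>U\<^esub> v) = f u \<oplus>\<^bsub>V\<^esub> f v"
    "\<And>a v. a \<in> carrier A \<Longrightarrow> v \<in> carrier U \<Longrightarrow> f (a \<odot>\<^bsub>U\<^esub> v) = a \<odot>\<^bsub>V\<^esub> f v"
    using assms(1) by (rule module_isoE) blast
  obtain g where g: "bij_betw g (carrier V) (carrier W)"
    "\<And>u v. u \<in> carrier V \<Longrightarrow> v \<in> carrier V \<Longrightarrow> g (u \<oplus>\<^bsub>V\<^esub> v) = g u \<oplus>\<^bsub>W\<^esub> g v"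
    "\<And>a v. a \<in> carrier A \<Longrightarrow> v \<in> carrier V \<Longrightarrow> g (a \<odot>\<^bsub>V\<^esub> v) = a \<odot>\<^bsub>W\<^esub> g v"
    using assms(2) by (rule module_isoE) blast
  have "f u \<in> carrier V" if "u \<in> carrier U" for u
    using f(1) that by (auto simp: bij_betw_def)
  then show ?thesis
    by (intro module_isoI[of "g \<circ> f"]) (use f g in \<open>auto intro: bij_betw_trans\<close>)
qed

text \<open>The orbit of \<open>v\<close> is a submodule, and it contains \<open>v = 1 v\<close>.\<close>

lemma irreducible_cyclic:
  assumes A: "ring A" and V: "irreducible_module A V" and v: "v \<in> carrier V" "v \<noteq> \<zero>\<^bsub>V\<^esub>"
  shows "(\<lambda>a. a \<odot>\<^bsub>V\<^esub> v) ` carrier A = carrier V"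
proof -
  interpret V: lmodule A V using A V by (rule irreducible_lmodule)
  have "submodule ((\<lambda>a. a \<odot>\<^bsub>V\<^esub> v) ` carrier A) A V"
    using v(1) by (intro V.submoduleI)
      (auto simp: V.act_add_left[symmetric] V.act_mult[symmetric])
  moreover have "v \<in> (\<lambda>a. a \<odot>\<^bsub>V\<^esub> v) ` carrier A"
    using v(1) by (intro image_eqI[of _ _ "\<one>\<^bsub>A\<^esub>"]) auto
  ultimately show ?thesis using irreducibleD(1)[OF V] v(2) by blast
qed

text \<open>A cyclic module is determined up to isomorphism by the annihilator of a generator: if \<open>v\<close> and \<open>w\<close> have the same annihilator, \<open>a v \<mapsto> a w\<close> is a
  well-defined bijection.\<close>

lemma irreducible_iso_by_annihilator:
  assumes A: "ring A" and V: "irreducible_module A V" and W: "irreducible_module A W"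
    and v: "v \<in> carrier V" "v \<noteq> \<zero>\<^bsub>V\<^esub>" and w: "w \<in> carrier W" "w \<noteq> \<zero>\<^bsub>W\<^esub>"
    and ann: "\<And>a. a \<in> carrier A \<Longrightarrow> a \<odot>\<^bsub>V\<^esub> v = \<zero>\<^bsub>V\<^esub> \<longleftrightarrow> a \<odot>\<^bsub>W\<^esub> w = \<zero>\<^bsub>W\<^esub>"
  shows "module_iso A V W"
proof -
  interpret V: lmodule A V using A V by (rule irreducible_lmodule)
  interpret W: lmodule A W using A W by (rule irreducible_lmodule)
  interpret ring A by (rule A)
  have eq: "a \<odot>\<^bsub>V\<^esub> v = b \<odot>\<^bsub>V\<^esub> v \<longleftrightarrow> a \<odot>\<^bsub>W\<^esub> w = b \<odot>\<^bsub>W\<^esub> w"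
    if ab: "a \<in> carrier A" "b \<in> carrier A" for a b
  proof -
    have "a \<odot>\<^bsub>V\<^esub> v = b \<odot>\<^bsub>V\<^esub> v \<longleftrightarrow> (a \<ominus>\<^bsub>A\<^esub> b) \<odot>\<^bsub>V\<^esub> v = \<zero>\<^bsub>V\<^esub>"
      using ab v by (simp add: V.act_diff_left V.diff_eq_zero_iff)
    also have "\<dots> \<longleftrightarrow> (a \<ominus>\<^bsub>A\<^esub> b) \<odot>\<^bsub>W\<^esub> w = \<zero>\<^bsub>W\<^esub>" using ab by (intro ann) simp
    also have "\<dots> \<longleftrightarrow> a \<odot>\<^bsub>W\<^esub> w = b \<odot>\<^bsub>W\<^esub> w"
      using ab w by (simp add: W.act_diff_left W.diff_eq_zero_iff)
    finally show ?thesis .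
  qed
  define f where "f x = (SOME a. a \<in> carrier A \<and> a \<odot>\<^bsub>V\<^esub> v = x) \<odot>\<^bsub>W\<^esub> w" for x
  have f: "f (a \<odot>\<^bsub>V\<^esub> v) = a \<odot>\<^bsub>W\<^esub> w" if "a \<in> carrier A" for a
  proof -
    let ?b = "SOME b. b \<in> carrier A \<and> b \<odot>\<^bsub>V\<^esub> v = a \<odot>\<^bsub>V\<^esub> v"
    have "?b \<in> carrier A \<and> ?b \<odot>\<^bsub>V\<^esub> v = a \<odot>\<^bsub>V\<^esub> v" by (rule someI[of _ a]) (use that in auto)
    then show ?thesis using eq[of ?b a] that by (simp add: f_def)
  qed
  note oV = irreducible_cyclic[OF A V v, symmetric] and oW = irreducible_cyclic[OF A W w, symmetric]
  show ?thesis
  proof (rule module_isoI)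
    show "bij_betw f (carrier V) (carrier W)"
      unfolding oV oW bij_betw_def inj_on_def
      by (auto simp: f eq image_image)
    show "f (x \<oplus>\<^bsub>V\<^esub> y) = f x \<oplus>\<^bsub>W\<^esub> f y" if xy: "x \<in> carrier V" "y \<in> carrier V" for x y
    proof -
      obtain a b where "a \<in> carrier A" "b \<in> carrier A" "x = a \<odot>\<^bsub>V\<^esub> v" "y = b \<odot>\<^bsub>V\<^esub> v"
        using xy oV by auto
      then show ?thesis
        using v w f by (simp add: V.act_add_left[symmetric] W.act_add_left[symmetric])
    qed
    show "f (a \<odot>\<^bsub>V\<^esub> x) = a \<odot>\<^bsub>W\<^esub> f x" if ax: "a \<in> carrier A" "x \<in> carrier V" for a x
    proof -
      obtain b where "b \<in> carrier A" "x = b \<odot>\<^bsub>V\<^esub> v" using ax oV by auto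
      then show ?thesis
        using v w f ax by (simp add: V.act_mult[symmetric] W.act_mult[symmetric])
    qed
  qed
qed

lemma equiv_module_iso:
  assumes "ring A"
  shows "equiv {V. irreducible_module A V}
    {(V, W). irreducible_module A V \<and> irreducible_module A W \<and> module_iso A V W}"
  by (rule equivI)
    (auto simp: refl_on_def sym_def trans_def module_iso_refl
      intro: module_iso_trans module_iso_sym irreducible_lmodule assms)

lemma Irr_class_exists:
  assumes "ring A" "irreducible_module A V"
  shows "\<exists>\<nu>\<in>Irr A. V \<in> \<nu>"
proof -
  let ?R = "{(V, W). irreducible_module A V \<and> irreducible_module A W \<and> module_iso A V W}"
  have "?R `` {V} \<in> Irr A" unfolding Irr_def using assms by (intro quotientI) simp
  moreover have "V \<in> ?R `` {V}" using assms by (simp add: module_iso_refl)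
  ultimately show ?thesis by (rule bexI[rotated])
qed

lemma Irr_memD:
  assumes "ring A" "\<nu> \<in> Irr A" "V \<in> \<nu>"
  shows "irreducible_module A V" "irreducible_module A W \<Longrightarrow> module_iso A V W \<Longrightarrow> W \<in> \<nu>"
    "W \<in> \<nu> \<Longrightarrow> module_iso A V W" "\<nu>' \<in> Irr A \<Longrightarrow> V \<in> \<nu>' \<Longrightarrow> \<nu>' = \<nu>"
proof -
  let ?R = "{(V, W). irreducible_module A V \<and> irreducible_module A W \<and> module_iso A V W}"
  note E = equiv_module_iso[OF assms(1)]
  have \<nu>: "\<nu> \<in> {V. irreducible_module A V} // ?R" using assms(2) by (simp add: Irr_def)
  show irr: "irreducible_module A V" using in_quotient_imp_subset[OF E \<nu>] assms(3) by blast
  show "W \<in> \<nu>" if "irreducible_module A W" "module_iso A V W"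
    using in_quotient_imp_closed[OF E \<nu> assms(3), of W] irr that by simp
  show "module_iso A V W" if "W \<in> \<nu>"
    using in_quotient_imp_in_rel[OF E \<nu>, of V W] assms(3) that by simp
  show "\<nu>' = \<nu>" if "\<nu>' \<in> Irr A" "V \<in> \<nu>'"
    using quotient_disj[OF E, of \<nu>' \<nu>] \<nu> that assms(3) unfolding Irr_def by blast
qed

lemma Vrep_mem:
  assumes "ring A" "\<nu> \<in> Irr A"
  shows "Vrep \<nu> \<in> \<nu>"
  using in_quotient_imp_non_empty[OF equiv_module_iso[OF assms(1)], of \<nu>] assms(2)
  unfolding Irr_def Vrep_def by (metis ex_in_conv someI)

section \<open>Matrix units and irreducible modules\<close>

text \<open>\<open>E i p q\<close> is the \<open>(p, q)\<close> matrix unit of the block \<open>i\<close>, which has size \<open>d i\<close>. Instead of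
  an isomorphism onto a sum of matrix algebras, the locale records what the isomorphism says about the
  corners \<open>E i p p \<otimes> x \<otimes> E j q q\<close>: each is a multiple of one matrix unit or zero, and together they
  determine \<open>x\<close>. This way no later argument has to handle functions into matrices.\<close>

locale matrix_units = field_alg A for A :: "('k::field, 'a) module" (structure) +
  fixes r :: nat and d :: "nat \<Rightarrow> nat" and E :: "nat \<Rightarrow> nat \<Rightarrow> nat \<Rightarrow> 'a"
  assumes d_pos: "i < r \<Longrightarrow> 0 < d i"
    and E_closed [simp, intro]: "i < r \<Longrightarrow> p < d i \<Longrightarrow> q < d i \<Longrightarrow> E i p q \<in> carrier A"
    and E_mult: "i < r \<Longrightarrow> p < d i \<Longrightarrow> q < d i \<Longrightarrow> j < r \<Longrightarrow> s < d j \<Longrightarrow> t < d j \<Longrightarrow>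
      E i p q \<otimes> E j s t = (if i = j \<and> q = s then E i p t else \<zero>)"
    and E_nonzero: "i < r \<Longrightarrow> p < d i \<Longrightarrow> E i p p \<noteq> \<zero>"
    and corner: "i < r \<Longrightarrow> p < d i \<Longrightarrow> q < d i \<Longrightarrow> x \<in> carrier A \<Longrightarrow>
      \<exists>c. E i p p \<otimes> x \<otimes> E i q q = c \<odot> E i p q"
    and corner_other: "i < r \<Longrightarrow> p < d i \<Longrightarrow> j < r \<Longrightarrow> q < d j \<Longrightarrow> i \<noteq> j \<Longrightarrow> x \<in> carrier A \<Longrightarrow>
      E i p p \<otimes> x \<otimes> E j q q = \<zero>"
    and corners_zero: "x \<in> carrier A \<Longrightarrow>
      (\<And>i p q. i < r \<Longrightarrow> p < d i \<Longrightarrow> q < d i \<Longrightarrow> E i p p \<otimes> x \<otimes> E i q q = \<zero>) \<Longrightarrow> x = \<zero>"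
begin

text \<open>The identity matrix of the block \<open>i\<close>, zero in all other blocks.\<close>

definition block_unit :: "nat \<Rightarrow> 'a" where
  "block_unit i = (\<Oplus>p\<in>{..<d i}. E i p p)"

lemma block_unit_closed [simp, intro]: "i < r \<Longrightarrow> block_unit i \<in> carrier A"
  unfolding block_unit_def by (rule finsum_closed) auto

lemma E_block_unit:
  assumes "j < r" "p < d j" "q < d j" "i < r"
  shows "E j p q \<otimes> block_unit i = (if i = j then E j p q else \<zero>)"
proof -
  have "E j p q \<otimes> block_unit i = (\<Oplus>s\<in>{..<d i}. E j p q \<otimes> E i s s)"
    unfolding block_unit_def using assms by (intro finsum_rdistr) auto
  also have "\<dots> = (if i = j then E j p q else \<zero>)"
  proof (cases "i = j")
    case True
    then have "(\<Oplus>s\<in>{..<d i}. E j p q \<otimes> E i s s) = E j p q \<otimes> E i q q"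
      using assms by (intro finsum_single_term) (auto simp: E_mult)
    then show ?thesis using True assms by (simp add: E_mult)
  qed (use assms in \<open>auto intro!: finsum_eq_zeroI simp: E_mult\<close>)
  finally show ?thesis .
qed

lemma block_unit_E:
  assumes "j < r" "p < d j" "q < d j" "i < r"
  shows "block_unit i \<otimes> E j p q = (if i = j then E j p q else \<zero>)"
proof -
  have "block_unit i \<otimes> E j p q = (\<Oplus>s\<in>{..<d i}. E i s s \<otimes> E j p q)"
    unfolding block_unit_def using assms by (intro finsum_ldistr) auto
  also have "\<dots> = (if i = j then E j p q else \<zero>)"
  proof (cases "i = j")
    case True
    then have "(\<Oplus>s\<in>{..<d i}. E i s s \<otimes> E j p q) = E i p p \<otimes> E j p q"
      using assms by (intro finsum_single_term) (auto simp: E_mult)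
    then show ?thesis using True assms by (simp add: E_mult)
  qed (use assms in \<open>auto intro!: finsum_eq_zeroI simp: E_mult\<close>)
  finally show ?thesis .
qed

lemma corners_eqI:
  assumes "x \<in> carrier A" "y \<in> carrier A"
    and "\<And>i p q. i < r \<Longrightarrow> p < d i \<Longrightarrow> q < d i \<Longrightarrow>
      E i p p \<otimes> x \<otimes> E i q q = E i p p \<otimes> y \<otimes> E i q q"
  shows "x = y"
proof -
  have "x \<ominus> y = \<zero>"
  proof (rule corners_zero)
    fix i p q assume i: "i < r" "p < d i" "q < d i"
    have "E i p p \<otimes> (x \<ominus> y) \<otimes> E i q q =
        E i p p \<otimes> x \<otimes> E i q q \<ominus> E i p p \<otimes> y \<otimes> E i q q"
      using assms(1,2) i by (simp add: minus_eq r_distr l_distr r_minus l_minus)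
    then show "E i p p \<otimes> (x \<ominus> y) \<otimes> E i q q = \<zero>" using assms i by simp
  qed (use assms in simp)
  then show ?thesis using assms(1,2) by simp
qed

text \<open>On both sides the corner at \<open>E j p p\<close> and \<open>E j q q\<close> is that of \<open>x\<close> if \<open>j = i\<close> and zero
  otherwise.\<close>

lemma block_unit_central:
  assumes "i < r"
  shows "block_unit i \<in> center A"
proof -
  have "block_unit i \<otimes> x = x \<otimes> block_unit i" if x: "x \<in> carrier A" for x
  proof (rule corners_eqI)
    fix j p q assume j: "j < r" "p < d j" "q < d j"
    have "E j p p \<otimes> (block_unit i \<otimes> x) \<otimes> E j q q = (E j p p \<otimes> block_unit i) \<otimes> x \<otimes> E j q q"
      using assms x j by (simp add: m_assoc)
    also have "\<dots> = (E j p p \<otimes> x) \<otimes> (block_unit i \<otimes> E j q q)"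
      using assms x j by (simp add: E_block_unit block_unit_E)
    also have "\<dots> = E j p p \<otimes> (x \<otimes> block_unit i) \<otimes> E j q q"
      using assms x j by (simp add: m_assoc)
    finally show "E j p p \<otimes> (block_unit i \<otimes> x) \<otimes> E j q q =
      E j p p \<otimes> (x \<otimes> block_unit i) \<otimes> E j q q" .
  qed (use assms x in auto)
  then show ?thesis using assms by (simp add: center_def)
qed

lemma block_unit_mult:
  assumes "i < r" "j < r"
  shows "block_unit i \<otimes> block_unit j = (if i = j then block_unit i else \<zero>)"
  by (rule corners_eqI)
    (use assms in \<open>auto simp: m_assoc[symmetric] E_block_unit\<close>)

lemma block_unit_nonzero: "i < r \<Longrightarrow> block_unit i \<noteq> \<zero>"
  using E_block_unit[of i 0 0 i] E_nonzero[of i 0] d_pos[of i] by auto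

lemma block_unit_sum: "(\<Oplus>i\<in>{..<r}. block_unit i) = \<one>"
proof (rule corners_eqI)
  fix j p q assume j: "j < r" "p < d j" "q < d j"
  have "E j p p \<otimes> (\<Oplus>i\<in>{..<r}. block_unit i) = (\<Oplus>i\<in>{..<r}. E j p p \<otimes> block_unit i)"
    using j by (intro finsum_rdistr) auto
  also have "\<dots> = E j p p \<otimes> block_unit j"
    using j by (intro finsum_single_term) (auto simp: E_block_unit)
  also have "\<dots> = E j p p \<otimes> \<one>" using j by (simp add: E_block_unit)
  finally show "E j p p \<otimes> (\<Oplus>i\<in>{..<r}. block_unit i) \<otimes> E j q q = E j p p \<otimes> \<one> \<otimes> E j q q"
    by simp
qed (auto intro!: finsum_closed)

lemma eq_from_blocks:
  assumes "x \<in> carrier A" "y \<in> carrier A"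
    and "\<And>i. i < r \<Longrightarrow> x \<otimes> block_unit i = y \<otimes> block_unit i"
  shows "x = y"
proof (rule corners_eqI)
  fix i p q assume i: "i < r" "p < d i" "q < d i"
  have *: "w \<otimes> E i q q = w \<otimes> block_unit i \<otimes> E i q q" if "w \<in> carrier A" for w
    using i that by (simp add: m_assoc block_unit_E)
  have "x \<otimes> E i q q = y \<otimes> E i q q" using *[OF assms(1)] *[OF assms(2)] assms(3) i(1) by simp
  then show "E i p p \<otimes> x \<otimes> E i q q = E i p p \<otimes> y \<otimes> E i q q" using i assms by (simp add: m_assoc)
qed (use assms in auto)

text \<open>The corner of \<open>z\<close> at \<open>E i 0 0\<close> is a scalar \<open>c\<close>. Because \<open>z\<close> is central, conjugation with
  \<open>E i p 0\<close> and \<open>E i 0 p\<close> carries the same \<open>c\<close> to every other diagonal position.\<close>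

lemma central_scalar_on_block:
  assumes z: "z \<in> center A" and i: "i < r"
  shows "\<exists>c. z \<otimes> block_unit i = c \<odot> block_unit i"
proof -
  note zc = centerD[OF z]
  have 0: "0 < d i" using d_pos i .
  obtain c where "E i 0 0 \<otimes> z \<otimes> E i 0 0 = c \<odot> E i 0 0" using corner[OF i 0 0 zc(1)] by blast
  moreover have "E i 0 0 \<otimes> z \<otimes> E i 0 0 = z \<otimes> E i 0 0"
    using zc(1) zc(2)[of "E i 0 0"] i 0 by (metis E_closed E_mult m_assoc)
  ultimately have c: "z \<otimes> E i 0 0 = c \<odot> E i 0 0" by simp
  have "z \<otimes> E i p p = c \<odot> E i p p" if p: "p < d i" for p
  proof -
    have "z \<otimes> E i p p = z \<otimes> (E i p 0 \<otimes> E i 0 0 \<otimes> E i 0 p)" using i 0 p by (simp add: E_mult)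
    also have "\<dots> = (z \<otimes> E i p 0) \<otimes> E i 0 0 \<otimes> E i 0 p" using zc(1) i 0 p by (simp add: m_assoc)
    also have "\<dots> = E i p 0 \<otimes> (z \<otimes> E i 0 0) \<otimes> E i 0 p"
      using zc(1) i 0 p by (simp add: zc(2)[of "E i p 0"] m_assoc)
    also have "\<dots> = c \<odot> E i p p"
      using i 0 p by (simp add: c scalar_mult_left scalar_mult_right E_mult)
    finally show ?thesis .
  qed
  then have "z \<otimes> block_unit i = c \<odot> block_unit i"
    unfolding block_unit_def
    using module.finsum_smult_ldistr[OF scalar_module, of "{..<d i}" c "\<lambda>p. E i p p"] i zc(1)
    by (subst finsum_rdistr) (auto simp: field_algebra_def intro!: finsum_cong')
  then show ?thesis ..
qed

text \<open>Irreducibility of the column module \<open>A E i 0 0\<close> in terms of elements. A nonzero corner of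
  \<open>x \<otimes> E i 0 0\<close> has the form \<open>c \<odot> E i p 0\<close>, and \<open>(1 / c) \<odot> E i 0 p\<close> takes it to \<open>E i 0 0\<close>.\<close>

lemma column_generator_recovered:
  assumes i: "i < r" and x: "x \<in> carrier A" and nz: "x \<otimes> E i 0 0 \<noteq> \<zero>"
  shows "\<exists>b\<in>carrier A. b \<otimes> (x \<otimes> E i 0 0) = E i 0 0"
proof -
  have 0: "0 < d i" using d_pos i .
  have "\<exists>j p q. j < r \<and> p < d j \<and> q < d j \<and> E j p p \<otimes> (x \<otimes> E i 0 0) \<otimes> E j q q \<noteq> \<zero>"
    using corners_zero[of "x \<otimes> E i 0 0"] nz i 0 x by auto
  then obtain j p q where j: "j < r" "p < d j" "q < d j"
    and n: "E j p p \<otimes> (x \<otimes> E i 0 0) \<otimes> E j q q \<noteq> \<zero>" by blast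
  have "E j p p \<otimes> (x \<otimes> E i 0 0) \<otimes> E j q q = E j p p \<otimes> (x \<otimes> (E i 0 0 \<otimes> E j q q))"
    using j i 0 x by (simp add: m_assoc)
  then have [simp]: "j = i" "q = 0" using n j i 0 x by (auto simp: E_mult split: if_splits)
  obtain c where c: "E i p p \<otimes> x \<otimes> E i 0 0 = c \<odot> E i p 0" using corner[of i p 0 x] j i 0 x by auto
  have "c \<noteq> 0" using n j i 0 x c by (auto simp: m_assoc E_mult)
  have "((1 / c) \<odot> E i 0 p) \<otimes> (x \<otimes> E i 0 0) = (1 / c) \<odot> (E i 0 p \<otimes> E i p p \<otimes> x \<otimes> E i 0 0)"
    using i 0 j x by (simp add: E_mult scalar_mult_left m_assoc)
  also have "\<dots> = (1 / c) \<odot> (E i 0 p \<otimes> (E i p p \<otimes> x \<otimes> E i 0 0))"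
    using i 0 j x by (simp add: m_assoc)
  also have "\<dots> = E i 0 0"
    using i 0 j \<open>c \<noteq> 0\<close> by (simp add: c scalar_mult_right scalar_scalar E_mult)
  finally show ?thesis using i 0 j by (intro bexI[of _ "(1 / c) \<odot> E i 0 p"]) auto
qed

definition in_block :: "nat \<Rightarrow> ('a, 'v) module \<Rightarrow> bool" where
  "in_block i V \<longleftrightarrow> (\<forall>v\<in>carrier V. block_unit i \<odot>\<^bsub>V\<^esub> v = v)"

lemma in_block_iso:
  assumes "in_block i V" "module_iso A V W" "i < r"
  shows "in_block i W"
proof -
  obtain f where f: "bij_betw f (carrier V) (carrier W)"
    "\<And>a v. a \<in> carrier A \<Longrightarrow> v \<in> carrier V \<Longrightarrow> f (a \<odot>\<^bsub>V\<^esub> v) = a \<odot>\<^bsub>W\<^esub> f v"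
    using assms(2) by (rule module_isoE) blast
  have "carrier W = f ` carrier V" using f(1) by (auto simp: bij_betw_def)
  then show ?thesis using assms(1,3) f(2) by (auto simp: in_block_def simp flip: f(2))
qed

text \<open>As \<open>1\<close> is the sum of the block units, some block unit does not annihilate the module. It is
  central, so the vectors that it fixes form a submodule, which is then everything.\<close>

lemma irreducible_in_block:
  assumes V: "irreducible_module A V"
  shows "\<exists>i<r. in_block i V"
proof -
  interpret lmodule A V using ring_axioms V by (rule irreducible_lmodule)
  obtain v where v: "v \<in> carrier V" "v \<noteq> \<zero>\<^bsub>V\<^esub>" using irreducibleD(2)[OF V] by blast
  have "(\<Oplus>i\<in>{..<r}. block_unit i) \<odot>\<^bsub>V\<^esub> v \<noteq> \<zero>\<^bsub>V\<^esub>" using v by (simp add: block_unit_sum)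
  then obtain i where i: "i < r" "block_unit i \<odot>\<^bsub>V\<^esub> v \<noteq> \<zero>\<^bsub>V\<^esub>"
    using act_finsum_eq_zero[of "{..<r}" block_unit v] v by auto
  let ?U = "{v \<in> carrier V. block_unit i \<odot>\<^bsub>V\<^esub> v = v}"
  have "submodule ?U A V"
  proof (rule submoduleI)
    show "a \<odot>\<^bsub>V\<^esub> u \<in> ?U" if "a \<in> carrier A" "u \<in> ?U" for a u
      using that i act_mult[of "block_unit i" a u] act_mult[of a "block_unit i" u]
        centerD(2)[OF block_unit_central[OF i(1)], of a] by auto
    show "?U \<noteq> {}" using i act_zero_right[of "block_unit i"] V.zero_closed by blast
  qed (use i in \<open>auto simp: act_add_right\<close>)
  moreover have "block_unit i \<odot>\<^bsub>V\<^esub> v \<in> ?U"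
    using v i by (simp add: act_mult[symmetric] block_unit_mult)
  ultimately have "?U = carrier V" using irreducibleD(1)[OF V] i(2) by blast
  then show ?thesis using i(1) by (auto simp: in_block_def)
qed

lemma other_block_acts_as_zero:
  assumes V: "lmodule A V" "in_block i V" and ij: "i < r" "j < r" "i \<noteq> j" and v: "v \<in> carrier V"
  shows "block_unit j \<odot>\<^bsub>V\<^esub> v = \<zero>\<^bsub>V\<^esub>"
proof -
  interpret lmodule A V by fact
  have "block_unit j \<odot>\<^bsub>V\<^esub> v = (block_unit j \<otimes> block_unit i) \<odot>\<^bsub>V\<^esub> v"
    using V(2) v ij by (simp add: act_mult in_block_def)
  then show ?thesis using ij v by (simp add: block_unit_mult)
qed

lemma in_block_unique:
  assumes V: "irreducible_module A V" "in_block i V" "in_block j V" and ij: "i < r" "j < r"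
  shows "i = j"
  using other_block_acts_as_zero[OF irreducible_lmodule[OF ring_axioms V(1)] V(2) ij]
    irreducibleD(2)[OF V(1)] V(3) by (auto simp: in_block_def)

text \<open>Some \<open>E i p p\<close> does not kill a given vector, and \<open>E i 0 p\<close> moves what remains of it into the
  first diagonal corner.\<close>

lemma corner_vector:
  assumes V: "irreducible_module A V" "in_block i V" and i: "i < r"
  shows "\<exists>v\<in>carrier V. v \<noteq> \<zero>\<^bsub>V\<^esub> \<and> E i 0 0 \<odot>\<^bsub>V\<^esub> v = v"
proof -
  interpret lmodule A V using ring_axioms V(1) by (rule irreducible_lmodule)
  have 0: "0 < d i" using d_pos i .
  obtain v where v: "v \<in> carrier V" "v \<noteq> \<zero>\<^bsub>V\<^esub>" using irreducibleD(2)[OF V(1)] by blast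
  have "(\<Oplus>p\<in>{..<d i}. E i p p) \<odot>\<^bsub>V\<^esub> v \<noteq> \<zero>\<^bsub>V\<^esub>"
    using v V(2) by (simp add: in_block_def block_unit_def[symmetric])
  then obtain p where p: "p < d i" "E i p p \<odot>\<^bsub>V\<^esub> v \<noteq> \<zero>\<^bsub>V\<^esub>"
    using act_finsum_eq_zero[of "{..<d i}" "\<lambda>p. E i p p" v] v i by auto
  have "E i p 0 \<odot>\<^bsub>V\<^esub> (E i 0 p \<odot>\<^bsub>V\<^esub> v) \<noteq> \<zero>\<^bsub>V\<^esub>"
    using p v i 0 by (simp add: act_mult[symmetric] E_mult)
  then have "E i 0 p \<odot>\<^bsub>V\<^esub> v \<noteq> \<zero>\<^bsub>V\<^esub>" using p v i 0 by auto
  moreover have "E i 0 0 \<odot>\<^bsub>V\<^esub> (E i 0 p \<odot>\<^bsub>V\<^esub> v) = E i 0 p \<odot>\<^bsub>V\<^esub> v"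
    using p v i 0 by (simp add: act_mult[symmetric] E_mult)
  ultimately show ?thesis using p v i 0 by (intro bexI[of _ "E i 0 p \<odot>\<^bsub>V\<^esub> v"]) auto
qed

text \<open>The annihilator of a corner vector can be read off in the algebra alone. It is therefore the
  same in all modules of the block, which makes the irreducible ones among them isomorphic.\<close>

lemma corner_vector_annihilator:
  assumes V: "lmodule A V" and i: "i < r" and a: "a \<in> carrier A"
    and v: "v \<in> carrier V" "v \<noteq> \<zero>\<^bsub>V\<^esub>" "E i 0 0 \<odot>\<^bsub>V\<^esub> v = v"
  shows "a \<odot>\<^bsub>V\<^esub> v = \<zero>\<^bsub>V\<^esub> \<longleftrightarrow> a \<otimes> E i 0 0 = \<zero>"
proof -
  interpret lmodule A V by fact
  have 0: "0 < d i" using d_pos i .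
  have av: "a \<odot>\<^bsub>V\<^esub> v = (a \<otimes> E i 0 0) \<odot>\<^bsub>V\<^esub> v" using a i 0 v by (simp add: act_mult)
  show ?thesis
  proof (rule iffI, rule ccontr)
    assume z: "a \<odot>\<^bsub>V\<^esub> v = \<zero>\<^bsub>V\<^esub>" and "a \<otimes> E i 0 0 \<noteq> \<zero>"
    then obtain b where b: "b \<in> carrier A" "b \<otimes> (a \<otimes> E i 0 0) = E i 0 0"
      using column_generator_recovered[OF i a] by blast
    have "v = (b \<otimes> (a \<otimes> E i 0 0)) \<odot>\<^bsub>V\<^esub> v" using b v by simp
    also have "\<dots> = b \<odot>\<^bsub>V\<^esub> (a \<odot>\<^bsub>V\<^esub> v)" using a b(1) i 0 v av by (simp add: act_mult)
    finally show False using z b(1) v by simp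
  qed (use av v in simp)
qed

lemma same_block_iso:
  assumes "irreducible_module A V" "irreducible_module A W" "in_block i V" "in_block i W" "i < r"
  shows "module_iso A V W"
proof -
  obtain v where v: "v \<in> carrier V" "v \<noteq> \<zero>\<^bsub>V\<^esub>" "E i 0 0 \<odot>\<^bsub>V\<^esub> v = v"
    using corner_vector assms(1,3,5) by blast
  obtain w where w: "w \<in> carrier W" "w \<noteq> \<zero>\<^bsub>W\<^esub>" "E i 0 0 \<odot>\<^bsub>W\<^esub> w = w"
    using corner_vector assms(2,4,5) by blast
  show ?thesis
    by (rule irreducible_iso_by_annihilator[OF ring_axioms assms(1,2) v(1,2) w(1,2)])
      (use corner_vector_annihilator assms(1,2,5) v w irreducible_lmodule[OF ring_axioms]
        in \<open>metis (no_types, lifting)\<close>)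
qed

text \<open>Each \<open>x \<otimes> E i p 0\<close> annihilates a corner vector, so it is zero, and with it every summand
  \<open>x \<otimes> E i p p\<close>. In other words, the block acts faithfully on \<open>V\<close>.\<close>

lemma annihilator_kills_block:
  assumes V: "irreducible_module A V" "in_block i V" and i: "i < r" and x: "x \<in> carrier A"
    and xV: "\<And>v. v \<in> carrier V \<Longrightarrow> x \<odot>\<^bsub>V\<^esub> v = \<zero>\<^bsub>V\<^esub>"
  shows "x \<otimes> block_unit i = \<zero>"
proof -
  interpret lmodule A V using ring_axioms V(1) by (rule irreducible_lmodule)
  have 0: "0 < d i" using d_pos i .
  obtain v where v: "v \<in> carrier V" "v \<noteq> \<zero>\<^bsub>V\<^esub>" "E i 0 0 \<odot>\<^bsub>V\<^esub> v = v"
    using corner_vector V i by blast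
  have "x \<otimes> E i p p = \<zero>" if p: "p < d i" for p
  proof -
    have "(x \<otimes> E i p 0) \<odot>\<^bsub>V\<^esub> v = \<zero>\<^bsub>V\<^esub>" using x p i 0 v xV by (simp add: act_mult)
    then have "(x \<otimes> E i p 0) \<otimes> E i 0 0 = \<zero>"
      using corner_vector_annihilator[OF lmodule_axioms i _ v, of "x \<otimes> E i p 0"] x p i 0 by simp
    then have "x \<otimes> E i p 0 = \<zero>" using x p i 0 by (simp add: m_assoc E_mult)
    moreover have "x \<otimes> E i p p = (x \<otimes> E i p 0) \<otimes> E i 0 p" using x p i 0 by (simp add: m_assoc E_mult)
    ultimately show ?thesis using p i 0 by simp
  qed
  then show ?thesis
    unfolding block_unit_def using x i by (subst finsum_rdistr) (auto intro: finsum_eq_zeroI)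
qed

text \<open>The module is the column \<open>A E i 0 0\<close>, a left ideal. Its elements have type \<open>'a\<close>, so an
  isomorphic copy on sets is taken.\<close>

lemma irreducible_in_block_exists:
  assumes i: "i < r"
  shows "\<exists>V :: ('a, 'a set) module. irreducible_module A V \<and> in_block i V"
proof -
  have 0: "0 < d i" using d_pos i .
  let ?C = "(\<lambda>x. x \<otimes> E i 0 0) ` carrier A"
  define L :: "('a, 'a) module" where
    "L = \<lparr>carrier = ?C, mult = (\<otimes>), one = \<one>, ring.zero = \<zero>, add = (\<oplus>), smult = (\<otimes>)\<rparr>"
  have L: "carrier L = ?C" "\<zero>\<^bsub>L\<^esub> = \<zero>" "\<And>x y. x \<oplus>\<^bsub>L\<^esub> y = x \<oplus> y" "\<And>x y. x \<odot>\<^bsub>L\<^esub> y = x \<otimes> y"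
    by (simp_all add: L_def)
  have E0: "E i 0 0 \<in> carrier A" using i 0 by simp
  have zC: "\<zero> \<in> ?C" using E0 by (intro image_eqI[of _ _ \<zero>]) auto
  have addC: "x \<oplus> y \<in> ?C" if "x \<in> ?C" "y \<in> ?C" for x y
    using that E0 by (auto simp: l_distr[symmetric])
  have smC: "x \<otimes> y \<in> ?C" if "x \<in> carrier A" "y \<in> ?C" for x y
    using that E0 by (auto simp: m_assoc[symmetric])
  have Cc: "x \<in> carrier A" if "x \<in> ?C" for x using that E0 by auto
  have "abelian_group L"
  proof (rule abelian_groupI)
    fix x assume "x \<in> carrier L"
    then show "\<exists>y\<in>carrier L. y \<oplus>\<^bsub>L\<^esub> x = \<zero>\<^bsub>L\<^esub>"
      using smC[of "\<ominus> \<one>" x] Cc[of x] by (intro bexI[of _ "(\<ominus> \<one>) \<otimes> x"]) (auto simp: L l_minus l_neg)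
  qed (simp_all only: L, use zC addC Cc in \<open>auto simp: a_ac\<close>)
  then have "left_module A L"
    unfolding left_module_def L using smC Cc by (simp add: l_distr r_distr m_assoc)
  moreover have "U = {\<zero>\<^bsub>L\<^esub>} \<or> U = carrier L" if U: "submodule U A L" for U
  proof -
    have sub: "subgroup U (add_monoid L)" and sm: "\<And>a x. a \<in> carrier A \<Longrightarrow> x \<in> U \<Longrightarrow> a \<otimes> x \<in> U"
      using U unfolding submodule_def submodule_axioms_def L by blast+
    have UC: "U \<subseteq> ?C" and zU: "\<zero> \<in> U"
      using subgroup.subset[OF sub] subgroup.one_closed[OF sub] by (simp_all add: L)
    show ?thesis
    proof (cases "U = {\<zero>}")
      case False
      then obtain u where u: "u \<in> U" "u \<noteq> \<zero>" using zU by blast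
      then obtain x where x: "x \<in> carrier A" "u = x \<otimes> E i 0 0" using UC by blast
      then obtain b where "b \<in> carrier A" "b \<otimes> u = E i 0 0"
        using column_generator_recovered[OF i x(1)] u(2) by blast
      then have "E i 0 0 \<in> U" using sm u(1) by metis
      then have "?C \<subseteq> U" using sm by blast
      then show ?thesis using UC by (simp add: L)
    qed (simp add: L)
  qed
  moreover have "E i 0 0 \<in> carrier L"
    unfolding L using E0 i 0 by (intro image_eqI[of _ _ "E i 0 0"]) (auto simp: E_mult)
  ultimately have "irreducible_module A L"
    unfolding irreducible_module_def using E_nonzero[OF i 0] by (auto simp: L(2))
  then obtain W :: "('a, 'a set) module" where W: "irreducible_module A W" "module_iso A L W"
    using irreducible_module_on_sets[OF ring_axioms] by blast
  have "in_block i L"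
    unfolding in_block_def L using i 0 E0 centerD(2)[OF block_unit_central[OF i]]
    by (auto simp: m_assoc[symmetric]) (simp add: m_assoc block_unit_E)
  then show ?thesis using W in_block_iso i by blast
qed

definition block_of :: "('a, 'a set) module set \<Rightarrow> nat" where
  "block_of \<nu> = (THE i. i < r \<and> in_block i (Vrep \<nu>))"

lemma block_of:
  assumes \<nu>: "\<nu> \<in> Defs.Irr A"
  shows "block_of \<nu> < r" "V \<in> \<nu> \<Longrightarrow> in_block (block_of \<nu>) V"
proof -
  note V = Vrep_mem[OF ring_axioms \<nu>]
  note irr = Irr_memD(1)[OF ring_axioms \<nu> V]
  have "\<exists>!i. i < r \<and> in_block i (Vrep \<nu>)"
    using irreducible_in_block[OF irr] in_block_unique[OF irr] by blast
  then have *: "block_of \<nu> < r \<and> in_block (block_of \<nu>) (Vrep \<nu>)"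
    unfolding block_of_def by (rule theI')
  then show "block_of \<nu> < r" by simp
  show "in_block (block_of \<nu>) V" if "V \<in> \<nu>"
    using in_block_iso[OF _ Irr_memD(3)[OF ring_axioms \<nu> V that]] * by blast
qed

lemma bij_block_of: "bij_betw block_of (Defs.Irr A) {..<r}"
proof (rule bij_betwI')
  fix \<nu> \<nu>' assume \<nu>: "\<nu> \<in> Defs.Irr A" "\<nu>' \<in> Defs.Irr A"
  note V = Vrep_mem[OF ring_axioms \<nu>(1)] and V' = Vrep_mem[OF ring_axioms \<nu>(2)]
  note irr = Irr_memD(1)[OF ring_axioms \<nu>(1) V] and irr' = Irr_memD(1)[OF ring_axioms \<nu>(2) V']
  show "block_of \<nu> = block_of \<nu>' \<longleftrightarrow> \<nu> = \<nu>'"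
  proof
    assume "block_of \<nu> = block_of \<nu>'"
    then have "module_iso A (Vrep \<nu>) (Vrep \<nu>')"
      using same_block_iso[OF irr irr'] block_of[OF \<nu>(1)] block_of[OF \<nu>(2)] V V' by metis
    then have "Vrep \<nu>' \<in> \<nu>" using Irr_memD(2)[OF ring_axioms \<nu>(1) V irr'] by blast
    then show "\<nu> = \<nu>'" using Irr_memD(4)[OF ring_axioms \<nu>(2) V' \<nu>(1)] by blast
  qed simp
next
  fix i assume "i \<in> {..<r}"
  then obtain V :: "('a, 'a set) module" where V: "irreducible_module A V" "in_block i V" "i < r"
    using irreducible_in_block_exists by blast
  obtain \<nu> where "\<nu> \<in> Defs.Irr A" "V \<in> \<nu>" using Irr_class_exists[OF ring_axioms V(1)] by blast
  then show "\<exists>\<nu>\<in>Defs.Irr A. i = block_of \<nu>" using block_of in_block_unique[OF V(1,2)] V(3) by metis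
qed (use block_of in auto)

text \<open>The block unit meets the requirements that define \<open>eps\<close>. Any other element that meets them acts
  on every irreducible module like the block unit, so their difference kills every block.\<close>

lemma eps_eq_block_unit:
  assumes \<nu>: "\<nu> \<in> Defs.Irr A"
  shows "eps A \<nu> = block_unit (block_of \<nu>)"
proof -
  let ?e = "block_unit (block_of \<nu>)"
  note b = block_of[OF \<nu>]
  have cen: "?e \<in> center A" using b block_unit_central by simp
  have act: "?e \<odot>\<^bsub>Vrep \<nu>'\<^esub> v = (if \<nu>' = \<nu> then v else \<zero>\<^bsub>Vrep \<nu>'\<^esub>)"
    if \<nu>': "\<nu>' \<in> Defs.Irr A" and v: "v \<in> carrier (Vrep \<nu>')" for \<nu>' v
  proof -
    note V = Vrep_mem[OF ring_axioms \<nu>']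
    note b' = block_of[OF \<nu>'] and irr = Irr_memD(1)[OF ring_axioms \<nu>' V]
    have "\<nu>' \<noteq> \<nu> \<Longrightarrow> block_of \<nu>' \<noteq> block_of \<nu>"
      using bij_block_of \<nu> \<nu>' by (auto simp: bij_betw_def inj_on_def)
    then have "\<nu>' \<noteq> \<nu> \<Longrightarrow> ?thesis"
      using other_block_acts_as_zero[OF irreducible_lmodule[OF ring_axioms irr] b'(2)[OF V] b'(1) b(1) _ v]
      by simp
    moreover have "\<nu>' = \<nu> \<Longrightarrow> ?thesis" using b'(2)[OF V] v by (simp add: in_block_def)
    ultimately show ?thesis by blast
  qed
  have prim: "primitive_central_idempotent A ?e"
    unfolding primitive_central_idempotent_def central_idempotent_def
  proof (intro conjI notI)
    show "?e \<in> center A" by (rule cen)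
    show "?e \<otimes> ?e = ?e" using block_unit_mult[OF b(1) b(1)] by simp
    show False if "?e = \<zero>" using block_unit_nonzero[OF b(1)] that by simp
    assume "\<exists>f g. (f \<in> center A \<and> f \<otimes> f = f) \<and> (g \<in> center A \<and> g \<otimes> g = g) \<and>
      f \<noteq> \<zero> \<and> g \<noteq> \<zero> \<and> f \<otimes> g = \<zero> \<and> ?e = f \<oplus> g"
    then obtain f g where f: "f \<in> center A" "f \<otimes> f = f" "f \<noteq> \<zero>" and g: "g \<in> center A" "g \<noteq> \<zero>"
      and fg: "f \<otimes> g = \<zero>" "?e = f \<oplus> g" by blast
    note fc = centerD[OF f(1)] and gc = centerD[OF g(1)]
    \<comment> \<open>a central idempotent summand \<open>f\<close> of the block unit is a scalar \<open>c\<close> times it, and idempotency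
      leaves only \<open>c = 1\<close>\<close>
    obtain c where c: "f \<otimes> ?e = c \<odot> ?e" using central_scalar_on_block[OF f(1) b(1)] by blast
    have fe: "f \<otimes> ?e = f" using fc(1) gc(1) f(2) fg by (simp add: r_distr)
    then have "c \<odot> f = f"
      using c f(2) fc(1) b(1) by (metis scalar_mult_right block_unit_closed)
    then have "c = 1" using scalar_cancel[of c f 1] fc(1) f(3) by simp
    then have "f = ?e" using c fe b(1) by simp
    then show False using fg(2) g(2) fc(1) gc(1) by (metis add.l_cancel_one')
  qed
  show ?thesis
    unfolding eps_def
  proof (rule the_equality)
    fix e assume e: "primitive_central_idempotent A e \<and>
      (\<forall>v\<in>carrier (Vrep \<nu>). e \<odot>\<^bsub>Vrep \<nu>\<^esub> v = v) \<and>
      (\<forall>\<nu>'\<in>Defs.Irr A. \<nu>' \<noteq> \<nu> \<longrightarrow>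
        (\<forall>v\<in>carrier (Vrep \<nu>'). e \<odot>\<^bsub>Vrep \<nu>'\<^esub> v = \<zero>\<^bsub>Vrep \<nu>'\<^esub>))"
    then have ec: "e \<in> carrier A"
      by (simp add: primitive_central_idempotent_def central_idempotent_def centerD)
    show "e = ?e"
    proof (rule eq_from_blocks)
      fix i assume i: "i < r"
      then obtain \<nu>' where \<nu>': "\<nu>' \<in> Defs.Irr A" "i = block_of \<nu>'"
        using bij_block_of by (metis bij_betw_def imageE lessThan_iff)
      note V = Vrep_mem[OF ring_axioms \<nu>'(1)]
      note irr = Irr_memD(1)[OF ring_axioms \<nu>'(1) V]
      interpret lmodule A "Vrep \<nu>'" using ring_axioms irr by (rule irreducible_lmodule)
      have "(e \<ominus> ?e) \<otimes> block_unit i = \<zero>"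
      proof (rule annihilator_kills_block[OF irr _ i])
        show "in_block i (Vrep \<nu>')" using block_of(2)[OF \<nu>'(1) V] \<nu>' by simp
        show "(e \<ominus> ?e) \<odot>\<^bsub>Vrep \<nu>'\<^esub> v = \<zero>\<^bsub>Vrep \<nu>'\<^esub>" if v: "v \<in> carrier (Vrep \<nu>')" for v
        proof -
          have "e \<odot>\<^bsub>Vrep \<nu>'\<^esub> v = ?e \<odot>\<^bsub>Vrep \<nu>'\<^esub> v"
            using act[OF \<nu>'(1) v] e \<nu>'(1) v by (cases "\<nu>' = \<nu>") simp_all
          then show ?thesis using ec b(1) v by (simp add: act_diff_left diff_eq_zero_iff)
        qed
      qed (use ec b in auto)
      then show "e \<otimes> block_unit i = ?e \<otimes> block_unit i"
        using ec b(1) i by (simp add: minus_eq l_distr l_minus) (metis minus_eq r_right_minus_eq m_closed block_unit_closed)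
    qed (use ec b in auto)
  qed (use prim act \<nu> in auto)
qed

end

section \<open>Matrix units of a split semisimple algebra\<close>

lemma matrix_unit_mult_left:
  fixes M :: "'k::field mat"
  assumes "M \<in> carrier_mat n n" "p < n" "q < n"
  shows "mat n n (\<lambda>(s, t). if s = p \<and> t = q then 1 else 0) * M =
    mat n n (\<lambda>(s, t). if s = p then M $$ (q, t) else 0)" (is "?U * M = ?R")
proof (rule eq_matI)
  fix s t assume st: "s < dim_row ?R" "t < dim_col ?R"
  then have "(?U * M) $$ (s, t) =
      (\<Sum>k = 0..<n. (if s = p \<and> k = q then 1 else 0) * M $$ (k, t))"
    using assms by (simp add: scalar_prod_def)
  also have "\<dots> = (\<Sum>k = 0..<n. if k = q then (if s = p then M $$ (k, t) else 0) else 0)"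
    by (rule sum.cong) auto
  finally show "(?U * M) $$ (s, t) = ?R $$ (s, t)" using st assms by simp
qed (use assms in auto)

lemma matrix_unit_mult_right:
  fixes M :: "'k::field mat"
  assumes "M \<in> carrier_mat n n" "p < n" "q < n"
  shows "M * mat n n (\<lambda>(s, t). if s = p \<and> t = q then 1 else 0) =
    mat n n (\<lambda>(s, t). if t = q then M $$ (s, p) else 0)" (is "M * ?U = ?R")
proof (rule eq_matI)
  fix s t assume st: "s < dim_row ?R" "t < dim_col ?R"
  then have "(M * ?U) $$ (s, t) =
      (\<Sum>k = 0..<n. M $$ (s, k) * (if k = p \<and> t = q then 1 else 0))"
    using assms by (simp add: scalar_prod_def)
  also have "\<dots> = (\<Sum>k = 0..<n. if k = p then (if t = q then M $$ (s, k) else 0) else 0)"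
    by (rule sum.cong) auto
  finally show "(M * ?U) $$ (s, t) = ?R $$ (s, t)" using st assms by simp
qed (use assms in auto)

text \<open>The matrix units are pulled back along an isomorphism \<open>h\<close> onto a sum of matrix algebras. Since
  \<open>h\<close> is bijective, each requirement may be checked on the matrix entries of the images.\<close>

lemma split_semisimple_matrix_units:
  fixes A :: "('k::field, 'a) module"
  assumes "split_semisimple A"
  shows "\<exists>r d E. matrix_units A r d E"
proof -
  obtain r d where fd: "fd_algebra A" and d: "\<And>i. i < r \<Longrightarrow> 0 < d i"
    and iso: "algebra_iso A (direct_sum r (\<lambda>i. module_mat TYPE('k) (d i) (d i)))"
    using assms unfolding split_semisimple_def by blast
  let ?D = "direct_sum r (\<lambda>i. module_mat TYPE('k) (d i) (d i))"
  obtain h where hom: "h \<in> algebra_hom A ?D" and bij: "bij_betw h (carrier A) (carrier ?D)"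
    using iso unfolding algebra_iso_def by blast
  interpret field_alg A by unfold_locales (rule fd)
  have cD: "carrier ?D = (\<Pi>\<^sub>E i\<in>{..<r}. carrier_mat (d i) (d i))"
    by (simp add: direct_sum_def module_mat_simps)
  have hc: "h x j \<in> carrier_mat (d j) (d j)" if "x \<in> carrier A" "j < r" for x j
    using bij that by (auto simp: bij_betw_def cD)
  have h_mult: "h (x \<otimes>\<^bsub>A\<^esub> y) j = h x j * h y j"
    if "x \<in> carrier A" "y \<in> carrier A" "j < r" for x y j
    using hom that by (simp add: algebra_hom_def ring_hom_def direct_sum_def module_mat_simps)
  have h_scalar: "h (c \<odot>\<^bsub>A\<^esub> x) j = c \<cdot>\<^sub>m h x j" if "x \<in> carrier A" "j < r" for c x j
    using hom that by (simp add: algebra_hom_def direct_sum_def module_mat_simps)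
  have h_zero: "h \<zero>\<^bsub>A\<^esub> j = 0\<^sub>m (d j) (d j)" if "j < r" for j
  proof -
    have "0 \<cdot>\<^sub>m h \<zero>\<^bsub>A\<^esub> j = 0\<^sub>m (d j) (d j)" using hc[OF zero_closed that] by (auto intro!: eq_matI)
    then show ?thesis using h_scalar[OF zero_closed that, of 0] by simp
  qed
  have h_eqI: "x = y" if "x \<in> carrier A" "y \<in> carrier A" "\<And>j. j < r \<Longrightarrow> h x j = h y j" for x y
  proof -
    have "h x \<in> carrier ?D" "h y \<in> carrier ?D" using bij that(1,2) by (auto simp: bij_betw_def)
    then have "h x = h y" unfolding cD by (rule PiE_ext) (use that(3) in auto)
    then show ?thesis using bij that(1,2) by (auto simp: bij_betw_def inj_on_def)
  qed
  define U :: "nat \<Rightarrow> nat \<Rightarrow> nat \<Rightarrow> nat \<Rightarrow> 'k mat" where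
    "U j i p q = mat (d j) (d j) (\<lambda>(s, t). if j = i \<and> s = p \<and> t = q then 1 else 0)" for j i p q
  define E where "E i p q = inv_into (carrier A) h (\<lambda>j\<in>{..<r}. U j i p q)" for i p q
  have UD: "(\<lambda>j\<in>{..<r}. U j i p q) \<in> h ` carrier A" for i p q
    using bij by (auto simp: bij_betw_def cD U_def)
  have E: "E i p q \<in> carrier A" for i p q unfolding E_def by (rule inv_into_into[OF UD])
  have hE: "h (E i p q) j = U j i p q" if "j < r" for i p q j
    using f_inv_into_f[OF UD, of i p q] that by (simp add: E_def)
  \<comment> \<open>multiplication by a matrix unit on the left moves row \<open>q\<close> to row \<open>p\<close> and deletes the other rows;
    on the right it does the same with columns\<close>
  have hE_left: "h (E i p q \<otimes>\<^bsub>A\<^esub> x) j =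
      mat (d j) (d j) (\<lambda>(s, t). if j = i \<and> s = p then h x j $$ (q, t) else 0)"
    if "x \<in> carrier A" "j < r" "p < d i" "q < d i" for i p q x j
  proof (cases "j = i")
    case True
    show ?thesis using that E unfolding True
      by (simp add: h_mult hE U_def matrix_unit_mult_left hc)
  next
    case False
    then have "U j i p q = 0\<^sub>m (d j) (d j)" by (auto simp: U_def)
    then show ?thesis using that E False hc[OF that(1,2)] by (auto simp: h_mult hE)
  qed
  have hE_right: "h (x \<otimes>\<^bsub>A\<^esub> E i p q) j =
      mat (d j) (d j) (\<lambda>(s, t). if j = i \<and> t = q then h x j $$ (s, p) else 0)"
    if "x \<in> carrier A" "j < r" "p < d i" "q < d i" for i p q x j
  proof (cases "j = i")
    case True
    show ?thesis using that E unfolding True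
      by (simp add: h_mult hE U_def matrix_unit_mult_right hc)
  next
    case False
    then have "U j i p q = 0\<^sub>m (d j) (d j)" by (auto simp: U_def)
    then show ?thesis using that E False hc[OF that(1,2)] by (auto simp: h_mult hE)
  qed
  have h_corner: "h (E i p p \<otimes>\<^bsub>A\<^esub> x \<otimes>\<^bsub>A\<^esub> E l q q) j =
      mat (d j) (d j) (\<lambda>(s, t). if j = i \<and> j = l \<and> s = p \<and> t = q then h x j $$ (p, q) else 0)"
    if "x \<in> carrier A" "j < r" "p < d i" "q < d l" for i p q x j l
    using that E by (auto simp: hE_right hE_left intro!: eq_matI)
  have "matrix_units A r d E"
  proof unfold_locales
    fix i p assume i: "i < r" "p < d i"
    show "E i p p \<noteq> \<zero>\<^bsub>A\<^esub>"
    proof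
      assume "E i p p = \<zero>\<^bsub>A\<^esub>"
      then have "U i i p p $$ (p, p) = 0\<^sub>m (d i) (d i) $$ (p, p)" using hE[of i i p p] h_zero i by simp
      then show False using i by (simp add: U_def)
    qed
  next
    fix i p q j s t assume i: "i < r" "p < d i" "q < d i" "j < r" "s < d j" "t < d j"
    show "E i p q \<otimes>\<^bsub>A\<^esub> E j s t = (if i = j \<and> q = s then E i p t else \<zero>\<^bsub>A\<^esub>)"
    proof (rule h_eqI)
      fix l assume "l < r"
      then show "h (E i p q \<otimes>\<^bsub>A\<^esub> E j s t) l = h (if i = j \<and> q = s then E i p t else \<zero>\<^bsub>A\<^esub>) l"
        using i E by (auto simp: hE_left hE h_zero U_def intro!: eq_matI)
    qed (use E in auto)
  next
    fix i p q x assume i: "i < r" "p < d i" "q < d i" "x \<in> carrier A"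
    have "E i p p \<otimes>\<^bsub>A\<^esub> x \<otimes>\<^bsub>A\<^esub> E i q q = (h x i $$ (p, q)) \<odot>\<^bsub>A\<^esub> E i p q"
    proof (rule h_eqI)
      fix l assume "l < r"
      then show "h (E i p p \<otimes>\<^bsub>A\<^esub> x \<otimes>\<^bsub>A\<^esub> E i q q) l = h ((h x i $$ (p, q)) \<odot>\<^bsub>A\<^esub> E i p q) l"
        using i E by (auto simp: h_corner hE h_scalar U_def intro!: eq_matI)
    qed (use E i in auto)
    then show "\<exists>c. E i p p \<otimes>\<^bsub>A\<^esub> x \<otimes>\<^bsub>A\<^esub> E i q q = c \<odot>\<^bsub>A\<^esub> E i p q" ..
  next
    fix i p j q x assume i: "i < r" "p < d i" "j < r" "q < d j" "i \<noteq> j" "x \<in> carrier A"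
    show "E i p p \<otimes>\<^bsub>A\<^esub> x \<otimes>\<^bsub>A\<^esub> E j q q = \<zero>\<^bsub>A\<^esub>"
      by (rule h_eqI) (use i E in \<open>auto simp: h_corner h_zero intro!: eq_matI\<close>)
  next
    fix x assume x: "x \<in> carrier A"
      and c: "\<And>i p q. i < r \<Longrightarrow> p < d i \<Longrightarrow> q < d i \<Longrightarrow> E i p p \<otimes>\<^bsub>A\<^esub> x \<otimes>\<^bsub>A\<^esub> E i q q = \<zero>\<^bsub>A\<^esub>"
    show "x = \<zero>\<^bsub>A\<^esub>"
    proof (rule h_eqI)
      fix j assume j: "j < r"
      have entry: "h x j $$ (p, q) = 0" if "p < d j" "q < d j" for p q
      proof -
        have "0\<^sub>m (d j) (d j) = mat (d j) (d j)
            (\<lambda>(s, t). if j = j \<and> j = j \<and> s = p \<and> t = q then h x j $$ (p, q) else 0)"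
          using h_corner[OF x j that] c[OF j that] h_zero[OF j] by simp
        then have "0\<^sub>m (d j) (d j) $$ (p, q) = mat (d j) (d j)
            (\<lambda>(s, t). if j = j \<and> j = j \<and> s = p \<and> t = q then h x j $$ (p, q) else 0) $$ (p, q)"
          by (rule arg_cong)
        then show ?thesis using that by simp
      qed
      have "h x j = 0\<^sub>m (d j) (d j)" using hc[OF x j] entry by (intro eq_matI) auto
      then show "h x j = h \<zero>\<^bsub>A\<^esub> j" using h_zero[OF j] by simp
    qed (use x in auto)
  qed (use d E in auto)
  then show ?thesis by blast
qed

section \<open>Primitive central idempotents of a split semisimple algebra\<close>

text \<open>The matrix units serve only as a tool here: each fact is proved by choosing some, but none of
  the statements depends on the choice.\<close>

locale split_alg =
  fixes A :: "('k::field, 'a) module" (structure)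
  assumes split: "split_semisimple A"
begin

sublocale field_alg A using split by unfold_locales (simp add: split_semisimple_def)

lemma finite_Irr: "finite (Defs.Irr A)"
proof -
  obtain r d E where "matrix_units A r d E" using split_semisimple_matrix_units[OF split] by blast
  then interpret matrix_units A r d E .
  show ?thesis using bij_betw_finite[OF bij_block_of] by simp
qed

lemma eps_central: "\<nu> \<in> Defs.Irr A \<Longrightarrow> eps A \<nu> \<in> center A"
proof -
  obtain r d E where "matrix_units A r d E" using split_semisimple_matrix_units[OF split] by blast
  then interpret matrix_units A r d E .
  show "\<nu> \<in> Defs.Irr A \<Longrightarrow> eps A \<nu> \<in> center A"
    by (simp add: eps_eq_block_unit block_unit_central block_of)
qed

lemma eps_closed [simp, intro]: "\<nu> \<in> Defs.Irr A \<Longrightarrow> eps A \<nu> \<in> carrier A"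
  using eps_central centerD by blast

lemma eps_mult:
  assumes "\<nu> \<in> Defs.Irr A" "\<nu>' \<in> Defs.Irr A"
  shows "eps A \<nu> \<otimes> eps A \<nu>' = (if \<nu> = \<nu>' then eps A \<nu> else \<zero>)"
proof -
  obtain r d E where "matrix_units A r d E" using split_semisimple_matrix_units[OF split] by blast
  then interpret matrix_units A r d E .
  have "block_of \<nu> = block_of \<nu>' \<longleftrightarrow> \<nu> = \<nu>'"
    using bij_block_of assms by (auto simp: bij_betw_def inj_on_def)
  then show ?thesis using assms by (simp add: eps_eq_block_unit block_unit_mult block_of)
qed

lemma eps_sum: "(\<Oplus>\<nu>\<in>Defs.Irr A. eps A \<nu>) = \<one>"
proof -
  obtain r d E where "matrix_units A r d E" using split_semisimple_matrix_units[OF split] by blast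
  then interpret matrix_units A r d E .
  have "(\<Oplus>\<nu>\<in>Defs.Irr A. eps A \<nu>) = (\<Oplus>\<nu>\<in>Defs.Irr A. block_unit (block_of \<nu>))"
    by (rule finsum_cong') (auto simp: eps_eq_block_unit block_of)
  also have "\<dots> = (\<Oplus>i\<in>block_of ` Defs.Irr A. block_unit i)"
    using bij_block_of by (intro finsum_reindex[symmetric]) (auto simp: bij_betw_def)
  also have "\<dots> = \<one>" using bij_block_of block_unit_sum by (simp add: bij_betw_def)
  finally show ?thesis .
qed

lemma central_scalar_on_eps:
  assumes "z \<in> center A" "\<nu> \<in> Defs.Irr A"
  shows "\<exists>c. z \<otimes> eps A \<nu> = c \<odot> eps A \<nu>"
proof -
  obtain r d E where "matrix_units A r d E" using split_semisimple_matrix_units[OF split] by blast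
  then interpret matrix_units A r d E .
  show ?thesis using central_scalar_on_block assms by (simp add: eps_eq_block_unit block_of)
qed

lemma eps_acts:
  assumes "\<nu> \<in> Defs.Irr A" "\<nu>' \<in> Defs.Irr A" "V \<in> \<nu>'" "v \<in> carrier V"
  shows "eps A \<nu> \<odot>\<^bsub>V\<^esub> v = (if \<nu> = \<nu>' then v else \<zero>\<^bsub>V\<^esub>)"
proof -
  obtain r d E where "matrix_units A r d E" using split_semisimple_matrix_units[OF split] by blast
  then interpret matrix_units A r d E .
  note irr = Irr_memD(1)[OF ring_axioms assms(2,3)]
  show ?thesis
  proof (cases "\<nu> = \<nu>'")
    case True
    then show ?thesis using block_of(2)[OF assms(2,3)] assms by (simp add: eps_eq_block_unit in_block_def)
  next
    case False
    then have "block_of \<nu>' \<noteq> block_of \<nu>" using bij_block_of assms(1,2) by (auto simp: bij_betw_def inj_on_def)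
    then show ?thesis
      using other_block_acts_as_zero[OF irreducible_lmodule[OF ring_axioms irr] block_of(2)[OF assms(2,3)]]
        block_of(1) assms False by (simp add: eps_eq_block_unit)
  qed
qed

lemma eps_faithful:
  assumes "\<nu> \<in> Defs.Irr A" "x \<in> carrier A" "x \<otimes> eps A \<nu> \<noteq> \<zero>"
  shows "\<exists>v\<in>carrier (Vrep \<nu>). x \<odot>\<^bsub>Vrep \<nu>\<^esub> v \<noteq> \<zero>\<^bsub>Vrep \<nu>\<^esub>"
proof -
  obtain r d E where "matrix_units A r d E" using split_semisimple_matrix_units[OF split] by blast
  then interpret matrix_units A r d E .
  note V = Vrep_mem[OF ring_axioms assms(1)]
  note irr = Irr_memD(1)[OF ring_axioms assms(1) V]
  show ?thesis
    using annihilator_kills_block[OF irr block_of(2)[OF assms(1) V] block_of(1)[OF assms(1)] assms(2)]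
      assms by (auto simp: eps_eq_block_unit)
qed

lemma Vrep_irreducible: "\<nu> \<in> Defs.Irr A \<Longrightarrow> irreducible_module A (Vrep \<nu>)"
  using Irr_memD(1) Vrep_mem ring_axioms by blast

lemma Vrep_lmodule: "\<nu> \<in> Defs.Irr A \<Longrightarrow> lmodule A (Vrep \<nu>)"
  using Vrep_irreducible irreducible_lmodule ring_axioms by blast

end

section \<open>Branching\<close>

lemma (in lmodule) submodule_lmodule:
  assumes U: "submodule U A V"
  shows "lmodule A (V\<lparr>carrier := U\<rparr>)" "U \<subseteq> carrier V"
proof -
  have sub: "subgroup U (add_monoid V)" and sm: "\<And>a x. a \<in> carrier A \<Longrightarrow> x \<in> U \<Longrightarrow> a \<odot>\<^bsub>V\<^esub> x \<in> U"
    using U unfolding submodule_def submodule_axioms_def by blast+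
  show UV: "U \<subseteq> carrier V" using subgroup.subset[OF sub] by simp
  have "abelian_group (V\<lparr>carrier := U\<rparr>)"
  proof (rule abelian_groupI)
    fix x assume x: "x \<in> carrier (V\<lparr>carrier := U\<rparr>)"
    then have "\<ominus>\<^bsub>V\<^esub> x \<in> U" using subgroup.m_inv_closed[OF sub, of x] by (simp add: a_inv_def)
    then show "\<exists>y\<in>carrier (V\<lparr>carrier := U\<rparr>). y \<oplus>\<^bsub>V\<lparr>carrier := U\<rparr>\<^esub> x = \<zero>\<^bsub>V\<lparr>carrier := U\<rparr>\<^esub>"
      using x UV by (intro bexI[of _ "\<ominus>\<^bsub>V\<^esub> x"]) (auto simp: V.l_neg)
  qed (use UV subgroup.m_closed[OF sub] subgroup.one_closed[OF sub] in
      \<open>auto simp: V.a_ac subsetD\<close>)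
  then have "left_module A (V\<lparr>carrier := U\<rparr>)"
    unfolding left_module_def
    using UV sm by (auto simp: act_add_left act_add_right act_mult subsetD)
  then show "lmodule A (V\<lparr>carrier := U\<rparr>)" by (rule lmoduleI[OF A.ring_axioms])
qed

text \<open>The complement consists of the vectors killed by \<open>e\<close>, since \<open>v = e v + (v - e v)\<close>. Both sets are
  submodules because \<open>e\<close> is central.\<close>

lemma (in lmodule) central_idempotent_summand:
  assumes e: "e \<in> center A" "e \<otimes>\<^bsub>A\<^esub> e = e"
  shows "direct_summand A {u \<in> carrier V. e \<odot>\<^bsub>V\<^esub> u = u} V"
proof -
  have eA: "e \<in> carrier A" and ea: "\<And>a. a \<in> carrier A \<Longrightarrow> e \<otimes>\<^bsub>A\<^esub> a = a \<otimes>\<^bsub>A\<^esub> e"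
    using e(1) unfolding center_def by blast+
  have comm: "e \<odot>\<^bsub>V\<^esub> (a \<odot>\<^bsub>V\<^esub> u) = a \<odot>\<^bsub>V\<^esub> (e \<odot>\<^bsub>V\<^esub> u)"
    if "a \<in> carrier A" "u \<in> carrier V" for a u
    using act_mult[OF eA that] act_mult[OF that(1) eA that(2)] ea[OF that(1)] by simp
  have ee: "e \<odot>\<^bsub>V\<^esub> (e \<odot>\<^bsub>V\<^esub> u) = e \<odot>\<^bsub>V\<^esub> u" if "u \<in> carrier V" for u
    using act_mult[OF eA eA that] e(2) by simp
  let ?U = "{u \<in> carrier V. e \<odot>\<^bsub>V\<^esub> u = u}" and ?W = "{u \<in> carrier V. e \<odot>\<^bsub>V\<^esub> u = \<zero>\<^bsub>V\<^esub>}"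
  show ?thesis
    unfolding direct_summand_def
  proof (intro conjI exI[of _ ?W])
    show "submodule ?U A V"
      by (rule submoduleI) (use act_zero_right[OF eA] comm eA in \<open>auto simp: act_add_right\<close>)
    show "submodule ?W A V"
      by (rule submoduleI) (use act_zero_right[OF eA] comm eA in \<open>auto simp: act_add_right\<close>)
    show "?U \<inter> ?W = {\<zero>\<^bsub>V\<^esub>}" using act_zero_right[OF eA] by auto
    show "?U <+>\<^bsub>V\<^esub> ?W = carrier V"
    proof
      show "?U <+>\<^bsub>V\<^esub> ?W \<subseteq> carrier V" by (auto simp: set_add_def')
      show "carrier V \<subseteq> ?U <+>\<^bsub>V\<^esub> ?W"
      proof
        fix v assume v: "v \<in> carrier V"
        have u: "e \<odot>\<^bsub>V\<^esub> v \<in> carrier V" using v eA by simp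
        have 1: "e \<odot>\<^bsub>V\<^esub> v \<in> ?U" using u v ee by simp
        have 2: "v \<ominus>\<^bsub>V\<^esub> e \<odot>\<^bsub>V\<^esub> v \<in> ?W"
          using u v eA ee by (simp add: V.minus_eq act_add_right act_uminus_right V.r_neg)
        have 3: "v = e \<odot>\<^bsub>V\<^esub> v \<oplus>\<^bsub>V\<^esub> (v \<ominus>\<^bsub>V\<^esub> e \<odot>\<^bsub>V\<^esub> v)"
          using u v by (simp add: V.minus_eq V.a_lcomm[of "e \<odot>\<^bsub>V\<^esub> v" v] V.r_neg)
        show "v \<in> ?U <+>\<^bsub>V\<^esub> ?W" unfolding set_add_def' using 1 2 3 by blast
      qed
    qed
  qed
qed

lemma restrict_scalars_simps [simp]:
  "carrier (restrict_scalars h V) = carrier V" "add (restrict_scalars h V) = add V"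
  "\<zero>\<^bsub>restrict_scalars h V\<^esub> = \<zero>\<^bsub>V\<^esub>" "a \<odot>\<^bsub>restrict_scalars h V\<^esub> v = h a \<odot>\<^bsub>V\<^esub> v"
  by (simp_all add: restrict_scalars_def)

lemma restrict_scalars_lmodule:
  assumes A: "ring A" and h: "h \<in> ring_hom A B" and V: "lmodule B V"
  shows "lmodule A (restrict_scalars h V)"
proof -
  interpret V: lmodule B V by (rule V)
  have "abelian_group (restrict_scalars h V)"
    by (rule abelian_groupI) (auto simp: V.V.a_ac intro: V.V.l_neg V.V.a_inv_closed)
  then have "left_module A (restrict_scalars h V)"
    unfolding left_module_def
    by (auto simp: ring_hom_closed[OF h] ring_hom_add[OF h] ring_hom_mult[OF h] ring_hom_one[OF h]
        V.act_add_left V.act_add_right V.act_mult)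
  then show ?thesis by (rule lmoduleI[OF A])
qed

text \<open>The condition in \<open>edge\<close>, stated for a single embedding \<open>h\<close> so that branching can be studied
  without the whole family.\<close>

definition constituent :: "('k, 'a) module \<Rightarrow> ('a \<Rightarrow> 'a) \<Rightarrow> ('a, 'a set) module set \<Rightarrow>
    ('a, 'a set) module set \<Rightarrow> bool" where
  "constituent A h \<mu> \<nu> \<longleftrightarrow>
     (\<exists>U. direct_summand A U (restrict_scalars h (Vrep \<nu>)) \<and>
        module_iso A (Vrep \<mu>) ((restrict_scalars h (Vrep \<nu>))\<lparr>carrier := U\<rparr>))"

locale branching = A: split_alg A + B: split_alg B
  for A :: "('k::field, 'a) module" and B :: "('k, 'a) module" +
  fixes h :: "'a \<Rightarrow> 'a"
  assumes hom: "h \<in> algebra_hom A B"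
    and multiplicity_free: "multiplicity_free_restriction A B h"
begin

lemma h_ring_hom: "h \<in> ring_hom A B"
  using hom by (simp add: algebra_hom_def)

text \<open>The module \<open>Vrep \<nu>\<close> contains a copy of \<open>Vrep \<mu>\<close>, on which \<open>x\<close> acts as before. Along a path,
  this keeps the product of the \<open>eps\<close> from vanishing.\<close>

lemma nonzero_action_lifts:
  assumes \<mu>: "\<mu> \<in> Irr A" and \<nu>: "\<nu> \<in> Irr B" and c: "constituent A h \<mu> \<nu>"
    and x: "x \<in> carrier A" and v: "v \<in> carrier (Vrep \<mu>)" "x \<odot>\<^bsub>Vrep \<mu>\<^esub> v \<noteq> \<zero>\<^bsub>Vrep \<mu>\<^esub>"
  shows "\<exists>w\<in>carrier (Vrep \<nu>). h x \<odot>\<^bsub>Vrep \<nu>\<^esub> w \<noteq> \<zero>\<^bsub>Vrep \<nu>\<^esub>"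
proof -
  let ?R = "restrict_scalars h (Vrep \<nu>)"
  interpret V: lmodule A "Vrep \<mu>" using \<mu> by (rule A.Vrep_lmodule)
  interpret R: lmodule A ?R
    using A.ring_axioms h_ring_hom B.Vrep_lmodule[OF \<nu>] by (rule restrict_scalars_lmodule)
  obtain U f where U: "submodule U A ?R" and f: "bij_betw f (carrier (Vrep \<mu>)) U"
    "\<And>a v. a \<in> carrier A \<Longrightarrow> v \<in> carrier (Vrep \<mu>) \<Longrightarrow> f (a \<odot>\<^bsub>Vrep \<mu>\<^esub> v) = h a \<odot>\<^bsub>Vrep \<nu>\<^esub> f v"
    using c unfolding constituent_def direct_summand_def by (auto elim!: module_isoE)
  have fU: "f w \<in> carrier (Vrep \<nu>)" if "w \<in> carrier (Vrep \<mu>)" for w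
    using f(1) that R.submodule_lmodule(2)[OF U] by (auto simp: bij_betw_def)
  have "f \<zero>\<^bsub>Vrep \<mu>\<^esub> = h \<zero>\<^bsub>A\<^esub> \<odot>\<^bsub>Vrep \<nu>\<^esub> f \<zero>\<^bsub>Vrep \<mu>\<^esub>"
    using f(2)[of "\<zero>\<^bsub>A\<^esub>" "\<zero>\<^bsub>Vrep \<mu>\<^esub>"] by simp
  then have "f \<zero>\<^bsub>Vrep \<mu>\<^esub> = \<zero>\<^bsub>Vrep \<nu>\<^esub>" using R.act_zero_left[of "f \<zero>\<^bsub>Vrep \<mu>\<^esub>"] fU by simp
  moreover have "f (x \<odot>\<^bsub>Vrep \<mu>\<^esub> v) \<noteq> f \<zero>\<^bsub>Vrep \<mu>\<^esub>"
    using f(1) v x by (auto simp: bij_betw_def inj_on_def)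
  ultimately have "h x \<odot>\<^bsub>Vrep \<nu>\<^esub> f v \<noteq> \<zero>\<^bsub>Vrep \<nu>\<^esub>" using f(2) x v by simp
  then show ?thesis using fU v by blast
qed

text \<open>The summand is the image \<open>U\<close> of \<open>eps A \<mu>\<close> on \<open>Vrep \<nu>\<close>, the isotypic component of \<open>\<mu>\<close>. By
  faithfulness it is not zero, so some factor \<open>M i\<close> of the decomposition of \<open>Vrep \<nu>\<close> belongs to \<open>\<mu>\<close>.
  As the factors are pairwise non-isomorphic, \<open>eps A \<mu>\<close> kills all the others; hence projection to the
  coordinate \<open>i\<close> maps \<open>U\<close> isomorphically onto \<open>M i\<close>.\<close>

lemma constituent_if_eps_mult_nonzero:
  assumes \<mu>: "\<mu> \<in> Irr A" and \<nu>: "\<nu> \<in> Irr B" and nz: "h (eps A \<mu>) \<otimes>\<^bsub>B\<^esub> eps B \<nu> \<noteq> \<zero>\<^bsub>B\<^esub>"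
  shows "constituent A h \<mu> \<nu>"
proof -
  let ?R = "restrict_scalars h (Vrep \<nu>)" and ?e = "eps A \<mu>"
  interpret R: lmodule A ?R
    using A.ring_axioms h_ring_hom B.Vrep_lmodule[OF \<nu>] by (rule restrict_scalars_lmodule)
  have e: "?e \<in> carrier A" using \<mu> by simp
  define U where "U = {u \<in> carrier ?R. ?e \<odot>\<^bsub>?R\<^esub> u = u}"
  have summand: "direct_summand A U ?R"
    unfolding U_def using A.eps_central[OF \<mu>] A.eps_mult[OF \<mu> \<mu>]
    by (intro R.central_idempotent_summand) simp_all
  then have sU: "submodule U A ?R" by (simp add: direct_summand_def)
  have irr: "irreducible_module B (Vrep \<nu>)" using \<nu> by (rule B.Vrep_irreducible)
  have "\<exists>r (M :: nat \<Rightarrow> ('a, 'a set) module). (\<forall>i<r. irreducible_module A (M i)) \<and>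
      (\<forall>i<r. \<forall>j<r. i \<noteq> j \<longrightarrow> \<not> module_iso A (M i) (M j)) \<and> module_iso A ?R (direct_sum r M)"
    using multiplicity_free[unfolded multiplicity_free_restriction_def] irr by (elim allE impE)
  then obtain r and M :: "nat \<Rightarrow> ('a, 'a set) module"
    where M: "\<forall>i<r. irreducible_module A (M i)"
      and noniso: "\<forall>i<r. \<forall>j<r. i \<noteq> j \<longrightarrow> \<not> module_iso A (M i) (M j)"
      and iso: "module_iso A ?R (direct_sum r M)"
    by (elim exE conjE)
  note M = M[rule_format] and noniso = noniso[rule_format]
  have lM: "lmodule A (M i)" if "i < r" for i
    using A.ring_axioms M[OF that] by (rule irreducible_lmodule)
  have cD: "carrier (direct_sum r M) = (\<Pi>\<^sub>E i\<in>{..<r}. carrier (M i))"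
    by (simp add: direct_sum_def)
  obtain f where f: "bij_betw f (carrier ?R) (carrier (direct_sum r M))"
    and f_add: "\<And>u v. u \<in> carrier ?R \<Longrightarrow> v \<in> carrier ?R \<Longrightarrow>
      f (u \<oplus>\<^bsub>?R\<^esub> v) = f u \<oplus>\<^bsub>direct_sum r M\<^esub> f v"
    and f_act: "\<And>a v. a \<in> carrier A \<Longrightarrow> v \<in> carrier ?R \<Longrightarrow>
      f (a \<odot>\<^bsub>?R\<^esub> v) = a \<odot>\<^bsub>direct_sum r M\<^esub> f v"
    using iso by (rule module_isoE) blast
  have fc: "f v i \<in> carrier (M i)" if "v \<in> carrier ?R" "i < r" for v i
    using f that by (auto simp: bij_betw_def cD)
  have f_add_i: "f (u \<oplus>\<^bsub>?R\<^esub> v) i = f u i \<oplus>\<^bsub>M i\<^esub> f v i"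
    if "u \<in> carrier ?R" "v \<in> carrier ?R" "i < r" for u v i
    using f_add[OF that(1,2)] that(3) by (simp add: direct_sum_def)
  have f_act_i: "f (a \<odot>\<^bsub>?R\<^esub> v) i = a \<odot>\<^bsub>M i\<^esub> f v i"
    if "a \<in> carrier A" "v \<in> carrier ?R" "i < r" for a v i
    using f_act[OF that(1,2)] that(3) by (simp add: direct_sum_def)
  have f_eqI: "u = v" if "u \<in> carrier ?R" "v \<in> carrier ?R" "\<And>i. i < r \<Longrightarrow> f u i = f v i" for u v
  proof -
    have "f u \<in> carrier (direct_sum r M)" "f v \<in> carrier (direct_sum r M)"
      using f that(1,2) by (auto simp: bij_betw_def)
    then have "f u = f v" unfolding cD by (rule PiE_ext) (use that(3) in auto)
    then show ?thesis using f that(1,2) by (auto simp: bij_betw_def inj_on_def)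
  qed
  have f_zero: "f \<zero>\<^bsub>?R\<^esub> i = \<zero>\<^bsub>M i\<^esub>" if i: "i < r" for i
  proof -
    interpret Mi: lmodule A "M i" using i by (rule lM)
    show ?thesis
      using f_act_i[OF A.zero_closed R.V.zero_closed i] R.act_zero_left[OF R.V.zero_closed]
        Mi.act_zero_left[OF fc[OF R.V.zero_closed i]] by simp
  qed
  obtain v where v: "v \<in> carrier ?R" "?e \<odot>\<^bsub>?R\<^esub> v \<noteq> \<zero>\<^bsub>?R\<^esub>"
    using B.eps_faithful[OF \<nu> _ nz] ring_hom_closed[OF h_ring_hom e] by auto
  obtain i where i: "i < r" and ei: "?e \<odot>\<^bsub>M i\<^esub> f v i \<noteq> \<zero>\<^bsub>M i\<^esub>"
    using f_eqI[OF R.act_closed[OF e v(1)] R.V.zero_closed] v f_zero f_act_i[OF e v(1)] by metis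
  \<comment> \<open>\<open>eps A \<mu>\<close> would kill \<open>M i\<close> if it belonged to another class\<close>
  have Mi: "M i \<in> \<mu>"
  proof -
    obtain \<mu>' where \<mu>': "\<mu>' \<in> Irr A" "M i \<in> \<mu>'"
      using Irr_class_exists[OF A.ring_axioms M[OF i]] by blast
    then show ?thesis using A.eps_acts[OF \<mu> \<mu>' fc[OF v(1) i]] ei by (auto split: if_splits)
  qed
  have e_Mi: "?e \<odot>\<^bsub>M i\<^esub> m = m" if "m \<in> carrier (M i)" for m
    using A.eps_acts[OF \<mu> \<mu> Mi that] by simp
  have e_Mj: "?e \<odot>\<^bsub>M j\<^esub> m = \<zero>\<^bsub>M j\<^esub>" if j: "j < r" "j \<noteq> i" and m: "m \<in> carrier (M j)" for j m
  proof -
    obtain \<mu>' where \<mu>': "\<mu>' \<in> Irr A" "M j \<in> \<mu>'"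
      using Irr_class_exists[OF A.ring_axioms M[OF j(1)]] by blast
    have "\<mu> \<noteq> \<mu>'" using Irr_memD(3)[OF A.ring_axioms \<mu> Mi, of "M j"] \<mu>' noniso[OF i j(1)] j by blast
    then show ?thesis using A.eps_acts[OF \<mu> \<mu>' m] by simp
  qed
  have fU: "f u j = \<zero>\<^bsub>M j\<^esub>" if "u \<in> U" "j < r" "j \<noteq> i" for u j
    using f_act_i[OF e _ that(2), of u] e_Mj[OF that(2,3) fc[OF _ that(2)], of u] that(1)
    by (auto simp: U_def)
  have UR: "U \<subseteq> carrier ?R" by (auto simp: U_def)
  have iso_i: "module_iso A (?R\<lparr>carrier := U\<rparr>) (M i)"
  proof (rule module_isoI)
    show "bij_betw (\<lambda>u. f u i) (carrier (?R\<lparr>carrier := U\<rparr>)) (carrier (M i))"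
    proof (rule bij_betwI')
      fix u w assume uw: "u \<in> carrier (?R\<lparr>carrier := U\<rparr>)" "w \<in> carrier (?R\<lparr>carrier := U\<rparr>)"
      have "u = w" if "f u i = f w i"
      proof (rule f_eqI)
        fix j assume "j < r" then show "f u j = f w j"
          using that uw fU by (cases "j = i") auto
      qed (use uw UR in auto)
      then show "f u i = f w i \<longleftrightarrow> u = w" by blast
    next
      fix u assume "u \<in> carrier (?R\<lparr>carrier := U\<rparr>)"
      then show "f u i \<in> carrier (M i)" using fc i UR by auto
    next
      fix m assume m: "m \<in> carrier (M i)"
      \<comment> \<open>the vector that is \<open>m\<close> in coordinate \<open>i\<close> and zero elsewhere is fixed by \<open>eps A \<mu>\<close>, so its
        preimage lies in \<open>U\<close>\<close>
      define x where "x = (\<lambda>j\<in>{..<r}. if j = i then m else \<zero>\<^bsub>M j\<^esub>)"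
      have zM: "\<zero>\<^bsub>M j\<^esub> \<in> carrier (M j)" if "j < r" for j
      proof -
        interpret Mj: lmodule A "M j" using that by (rule lM)
        show ?thesis by (rule Mj.V.zero_closed)
      qed
      have "x \<in> carrier (direct_sum r M)" using m zM by (auto simp: cD x_def)
      then obtain u where u: "u \<in> carrier ?R" "f u = x"
        using f by (metis bij_betw_imp_surj_on imageE)
      have "?e \<odot>\<^bsub>?R\<^esub> u = u"
      proof (rule f_eqI)
        fix j assume j: "j < r"
        then show "f (?e \<odot>\<^bsub>?R\<^esub> u) j = f u j"
          using f_act_i[OF e u(1) j] e_Mi[OF m] e_Mj[OF j _ zM[OF j]] u(2) by (simp add: x_def)
      qed (use u R.act_closed[OF e] in auto)
      then show "\<exists>u\<in>carrier (?R\<lparr>carrier := U\<rparr>). m = f u i"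
        using u i by (intro bexI[of _ u]) (auto simp: U_def x_def)
    qed
  qed (use UR f_add_i f_act_i i in \<open>auto simp: subsetD\<close>)
  have "module_iso A (Vrep \<mu>) (M i)"
    using Irr_memD(3)[OF A.ring_axioms \<mu> Vrep_mem[OF A.ring_axioms \<mu>] Mi] .
  moreover have "module_iso A (M i) (?R\<lparr>carrier := U\<rparr>)"
    using R.submodule_lmodule(1)[OF sU] iso_i by (rule module_iso_sym)
  ultimately show ?thesis unfolding constituent_def using summand module_iso_trans by blast
qed

end

section \<open>Path idempotents\<close>

lemma (in split_alg) eps_acts_nonzero:
  assumes \<nu>: "\<nu> \<in> Defs.Irr A"
  shows "\<exists>v\<in>carrier (Vrep \<nu>). eps A \<nu> \<odot>\<^bsub>Vrep \<nu>\<^esub> v \<noteq> \<zero>\<^bsub>Vrep \<nu>\<^esub>"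
  using irreducibleD(2)[OF Vrep_irreducible[OF \<nu>]] eps_acts[OF \<nu> \<nu> Vrep_mem[OF ring_axioms \<nu>]]
  by auto

lemma (in split_alg) eps_nonzero:
  assumes \<nu>: "\<nu> \<in> Defs.Irr A"
  shows "eps A \<nu> \<noteq> \<zero>"
proof -
  interpret V: lmodule A "Vrep \<nu>" using \<nu> by (rule Vrep_lmodule)
  show ?thesis using eps_acts_nonzero[OF \<nu>] by auto
qed

lemma (in ring) foldr_mult_start:
  assumes "\<And>k. k \<in> set ks \<Longrightarrow> f k \<in> carrier R" "y \<in> carrier R"
  shows "foldr (\<lambda>k x. f k \<otimes> x) ks \<one> \<in> carrier R \<and>
    foldr (\<lambda>k x. f k \<otimes> x) ks y = foldr (\<lambda>k x. f k \<otimes> x) ks \<one> \<otimes> y"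
  using assms by (induction ks) (auto simp: m_assoc)

lemma ring_hom_foldr_mult:
  assumes "ring R" "h \<in> ring_hom R S" "\<And>k. k \<in> set ks \<Longrightarrow> f k \<in> carrier R"
  shows "h (foldr (\<lambda>k x. f k \<otimes>\<^bsub>R\<^esub> x) ks \<one>\<^bsub>R\<^esub>) = foldr (\<lambda>k x. h (f k) \<otimes>\<^bsub>S\<^esub> x) ks \<one>\<^bsub>S\<^esub>"
  using assms(3)
proof (induction ks)
  case Nil
  then show ?case using ring_hom_one[OF assms(2)] by simp
next
  case (Cons k ks)
  then have "foldr (\<lambda>k x. f k \<otimes>\<^bsub>R\<^esub> x) ks \<one>\<^bsub>R\<^esub> \<in> carrier R"
    using ring.foldr_mult_start[OF assms(1), of ks f "\<one>\<^bsub>R\<^esub>"] ring.ring_simprules(6)[OF assms(1)] by simp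
  then show ?case using Cons ring_hom_mult[OF assms(2)] by simp
qed

lemma incl_self [simp]: "incl \<iota> n n x = x"
  by (cases n) auto

lemma incl_Suc: "k \<le> n \<Longrightarrow> incl \<iota> k (Suc n) x = \<iota> n (incl \<iota> k n x)"
  by simp

text \<open>As a rewrite rule the recursion equation would split every goal on \<open>k \<le> n\<close>.\<close>

declare incl.simps(2) [simp del]

locale mf_family =
  fixes A :: "nat \<Rightarrow> ('k::field, 'a) module" and \<iota> :: "nat \<Rightarrow> 'a \<Rightarrow> 'a"
  assumes family: "multiplicity_free_family A \<iota>"
begin

sublocale alg: split_alg "A n" for n
  using family by unfold_locales (simp add: multiplicity_free_family_def)

lemma branching: "branching (A n) (A (Suc n)) (\<iota> n)"
  using family by unfold_locales (simp_all add: multiplicity_free_family_def)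

lemma \<iota>_ring_hom: "\<iota> n \<in> ring_hom (A n) (A (Suc n))"
  using branching branching.h_ring_hom by blast

lemma \<iota>_closed [simp, intro]: "x \<in> carrier (A n) \<Longrightarrow> \<iota> n x \<in> carrier (A (Suc n))"
  using ring_hom_closed[OF \<iota>_ring_hom] .

lemma \<iota>_mult: "x \<in> carrier (A n) \<Longrightarrow> y \<in> carrier (A n) \<Longrightarrow>
    \<iota> n (x \<otimes>\<^bsub>A n\<^esub> y) = \<iota> n x \<otimes>\<^bsub>A (Suc n)\<^esub> \<iota> n y"
  using ring_hom_mult[OF \<iota>_ring_hom] .

lemma \<iota>_one [simp]: "\<iota> n \<one>\<^bsub>A n\<^esub> = \<one>\<^bsub>A (Suc n)\<^esub>"
  using ring_hom_one[OF \<iota>_ring_hom] .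

lemma \<iota>_scalar: "x \<in> carrier (A n) \<Longrightarrow> \<iota> n (c \<odot>\<^bsub>A n\<^esub> x) = c \<odot>\<^bsub>A (Suc n)\<^esub> \<iota> n x"
  using family by (simp add: multiplicity_free_family_def algebra_hom_def)

lemma \<iota>_zero [simp]: "\<iota> n \<zero>\<^bsub>A n\<^esub> = \<zero>\<^bsub>A (Suc n)\<^esub>"
  using \<iota>_scalar[of "\<zero>\<^bsub>A n\<^esub>" n 0] by simp

lemma \<iota>_finsum: "(\<And>i. i \<in> I \<Longrightarrow> f i \<in> carrier (A n)) \<Longrightarrow>
    \<iota> n (finsum (A n) f I) = (\<Oplus>\<^bsub>A (Suc n)\<^esub>i\<in>I. \<iota> n (f i))"
  by (rule ring_hom_finsum[OF alg.ring_axioms alg.ring_axioms \<iota>_ring_hom])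

lemma incl_closed: "k \<le> n \<Longrightarrow> x \<in> carrier (A k) \<Longrightarrow> incl \<iota> k n x \<in> carrier (A n)"
proof (induction n)
  case (Suc n)
  then show ?case by (cases "k = Suc n") (simp_all add: incl_Suc)
qed simp

lemma incl_central_commute:
  assumes "k \<le> n" "l \<le> n" "z \<in> center (A k)" "w \<in> center (A l)"
  shows "incl \<iota> k n z \<otimes>\<^bsub>A n\<^esub> incl \<iota> l n w = incl \<iota> l n w \<otimes>\<^bsub>A n\<^esub> incl \<iota> k n z"
  using assms(1,2)
proof (induction n)
  case 0
  then show ?case using assms(3,4) alg.centerD by simp
next
  case (Suc n)
  note zw = alg.centerD(1)[OF assms(3)] alg.centerD(1)[OF assms(4)]
  consider "k = Suc n" | "l = Suc n" | "k \<le> n" "l \<le> n" using Suc.prems by linarith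
  then show ?case
  proof cases
    case 1
    then show ?thesis using alg.centerD(2)[OF assms(3)] incl_closed[OF Suc.prems(2) zw(2)] by simp
  next
    case 2
    then show ?thesis using alg.centerD(2)[OF assms(4)] incl_closed[OF Suc.prems(1) zw(1)] by simp
  next
    case 3
    then show ?thesis using Suc.IH zw by (simp add: incl_Suc \<iota>_mult[symmetric] incl_closed)
  qed
qed

lemma edge_iff:
  "edge A \<iota> n \<mu> \<nu> \<longleftrightarrow> \<mu> \<in> Irr (A n) \<and> \<nu> \<in> Irr (A (Suc n)) \<and> constituent (A n) (\<iota> n) \<mu> \<nu>"
  by (simp add: edge_def constituent_def Let_def)

lemma eps_mult_not_edge:
  assumes "\<mu> \<in> Irr (A n)" "\<nu> \<in> Irr (A (Suc n))" "\<not> edge A \<iota> n \<mu> \<nu>"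
  shows "\<iota> n (eps (A n) \<mu>) \<otimes>\<^bsub>A (Suc n)\<^esub> eps (A (Suc n)) \<nu> = \<zero>\<^bsub>A (Suc n)\<^esub>"
  using branching.constituent_if_eps_mult_nonzero[OF branching assms(1,2)] assms by (auto simp: edge_iff)

text \<open>Multiply \<open>eps (A (Suc n)) \<nu>\<close> by \<open>1\<close>, written as the sum of all \<open>\<iota> n (eps (A n) \<mu>)\<close>. The terms
  without an edge vanish.\<close>

lemma eps_sum_over_predecessors:
  assumes \<nu>: "\<nu> \<in> Irr (A (Suc n))"
  shows "(\<Oplus>\<^bsub>A (Suc n)\<^esub>\<mu>\<in>{\<mu> \<in> Irr (A n). edge A \<iota> n \<mu> \<nu>}.
      \<iota> n (eps (A n) \<mu>) \<otimes>\<^bsub>A (Suc n)\<^esub> eps (A (Suc n)) \<nu>) = eps (A (Suc n)) \<nu>"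
proof -
  have "(\<Oplus>\<^bsub>A (Suc n)\<^esub>\<mu>\<in>{\<mu> \<in> Irr (A n). edge A \<iota> n \<mu> \<nu>}.
      \<iota> n (eps (A n) \<mu>) \<otimes>\<^bsub>A (Suc n)\<^esub> eps (A (Suc n)) \<nu>) =
    (\<Oplus>\<^bsub>A (Suc n)\<^esub>\<mu>\<in>Irr (A n). \<iota> n (eps (A n) \<mu>) \<otimes>\<^bsub>A (Suc n)\<^esub> eps (A (Suc n)) \<nu>)"
    using eps_mult_not_edge \<nu> by (intro alg.add.finprod_mono_neutral_cong_left alg.finite_Irr) auto
  also have "\<dots> = (\<Oplus>\<^bsub>A (Suc n)\<^esub>\<mu>\<in>Irr (A n). \<iota> n (eps (A n) \<mu>)) \<otimes>\<^bsub>A (Suc n)\<^esub> eps (A (Suc n)) \<nu>"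
    using \<nu> by (intro alg.finsum_ldistr[symmetric] alg.finite_Irr) auto
  also have "(\<Oplus>\<^bsub>A (Suc n)\<^esub>\<mu>\<in>Irr (A n). \<iota> n (eps (A n) \<mu>)) = \<one>\<^bsub>A (Suc n)\<^esub>"
    by (subst \<iota>_finsum[symmetric]) (auto simp: alg.eps_sum)
  finally show ?thesis using \<nu> by simp
qed

text \<open>In the field \<open>A 0\<close> two nonzero elements are never orthogonal, and the sum of the \<open>eps\<close> is
  \<open>1 \<noteq> 0\<close>.\<close>

lemma Irr_0: "\<exists>\<nu>. Irr (A 0) = {\<nu>}"
proof -
  obtain h where h: "h \<in> algebra_hom (A 0) (field_algebra :: ('k, 'k) module)"
    "bij_betw h (carrier (A 0)) (carrier (field_algebra :: ('k, 'k) module))"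
    using family by (auto simp: multiplicity_free_family_def algebra_iso_def)
  have h1: "h \<one>\<^bsub>A 0\<^esub> = 1" and hm: "\<And>x y. x \<in> carrier (A 0) \<Longrightarrow> y \<in> carrier (A 0) \<Longrightarrow>
      h (x \<otimes>\<^bsub>A 0\<^esub> y) = h x * h y" and hs: "\<And>c x. x \<in> carrier (A 0) \<Longrightarrow> h (c \<odot>\<^bsub>A 0\<^esub> x) = c * h x"
    using h(1) by (auto simp: algebra_hom_def ring_hom_def field_algebra_def)
  have h0: "h \<zero>\<^bsub>A 0\<^esub> = 0" using hs[of "\<zero>\<^bsub>A 0\<^esub>" 0] by simp
  have inj: "x = \<zero>\<^bsub>A 0\<^esub>" if "x \<in> carrier (A 0)" "h x = 0" for x
    using h(2) that h0 by (auto simp: bij_betw_def inj_on_def)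
  have "\<nu> = \<nu>'" if \<nu>: "\<nu> \<in> Irr (A 0)" "\<nu>' \<in> Irr (A 0)" for \<nu> \<nu>'
  proof (rule ccontr)
    assume "\<nu> \<noteq> \<nu>'"
    then have "eps (A 0) \<nu> \<otimes>\<^bsub>A 0\<^esub> eps (A 0) \<nu>' = \<zero>\<^bsub>A 0\<^esub>" using alg.eps_mult[OF \<nu>] by simp
    then have "h (eps (A 0) \<nu>) * h (eps (A 0) \<nu>') = 0" using hm \<nu> h0 by (metis alg.eps_closed)
    then show False using inj \<nu> alg.eps_nonzero by (metis alg.eps_closed mult_eq_0_iff)
  qed
  moreover have "Irr (A 0) \<noteq> {}"
  proof
    assume "Irr (A 0) = {}"
    then have "\<one>\<^bsub>A 0\<^esub> = \<zero>\<^bsub>A 0\<^esub>" using alg.eps_sum[of 0] by simp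
    then show False using h1 h0 by simp
  qed
  ultimately show ?thesis by blast
qed

lemma eps_0: "\<nu> \<in> Irr (A 0) \<Longrightarrow> eps (A 0) \<nu> = \<one>\<^bsub>A 0\<^esub>"
  using Irr_0 alg.eps_sum[of 0] by auto

lemma Tab_0: "Tab A \<iota> 0 = (\<lambda>\<nu>. [\<nu>]) ` Irr (A 0)"
  by (auto simp: Tab_def length_Suc_conv)

lemma Tab_nth: "T \<in> Tab A \<iota> n \<Longrightarrow> k \<le> n \<Longrightarrow> T ! k \<in> Irr (A k)"
  by (cases k) (auto simp: Tab_def edge_def)

lemma Tab_last:
  assumes T: "T \<in> Tab A \<iota> n"
  shows "last T \<in> Irr (A n)"
proof -
  have "length T = Suc n" using T by (simp add: Tab_def)
  then have "last T = T ! n" by (cases T) (auto simp: last_conv_nth)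
  then show ?thesis using Tab_nth[OF T, of n] by simp
qed

lemma Tab_snoc:
  assumes "length S = Suc n"
  shows "S @ [\<nu>] \<in> Tab A \<iota> (Suc n) \<longleftrightarrow> S \<in> Tab A \<iota> n \<and> edge A \<iota> n (last S) \<nu>"
proof -
  have "last S = S ! n" using assms by (cases S) (auto simp: last_conv_nth)
  moreover have "(\<forall>k<n. edge A \<iota> k ((S @ [\<nu>]) ! k) ((S @ [\<nu>]) ! Suc k)) \<longleftrightarrow>
      (\<forall>k<n. edge A \<iota> k (S ! k) (S ! Suc k))"
    using assms by (simp add: nth_append)
  ultimately show ?thesis
    using assms unfolding Tab_def by (simp add: All_less_Suc nth_append conj_ac)
qed

lemma Tab_Suc: "Tab A \<iota> (Suc n) = {S @ [\<nu>] | S \<nu>. S \<in> Tab A \<iota> n \<and> edge A \<iota> n (last S) \<nu>}"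
proof (intro equalityI subsetI)
  fix T assume T: "T \<in> Tab A \<iota> (Suc n)"
  then have "length (butlast T) = Suc n" "T = butlast T @ [last T]"
    by (auto simp: Tab_def) (metis append_butlast_last_id list.size(3) nat.distinct(1))
  then show "T \<in> {S @ [\<nu>] | S \<nu>. S \<in> Tab A \<iota> n \<and> edge A \<iota> n (last S) \<nu>}"
    using Tab_snoc T by (metis (mono_tags, lifting) mem_Collect_eq)
next
  fix T assume "T \<in> {S @ [\<nu>] | S \<nu>. S \<in> Tab A \<iota> n \<and> edge A \<iota> n (last S) \<nu>}"
  then obtain S \<nu> where S: "T = S @ [\<nu>]" "S \<in> Tab A \<iota> n" "edge A \<iota> n (last S) \<nu>" by blast
  then have "length S = Suc n" by (simp add: Tab_def)
  then show "T \<in> Tab A \<iota> (Suc n)" using Tab_snoc S by simp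
qed

lemma Tab_SucE:
  assumes "T \<in> Tab A \<iota> (Suc n)"
  obtains S \<nu> where "T = S @ [\<nu>]" "S \<in> Tab A \<iota> n" "edge A \<iota> n (last S) \<nu>"
    "last S \<in> Irr (A n)" "\<nu> \<in> Irr (A (Suc n))"
  using assms unfolding Tab_Suc by (auto simp: edge_def)

lemma finite_Tab: "finite (Tab A \<iota> n)"
proof (induction n)
  case (Suc n)
  have "Tab A \<iota> (Suc n) \<subseteq> (\<lambda>(S, \<nu>). S @ [\<nu>]) ` (Tab A \<iota> n \<times> Irr (A (Suc n)))"
    by (auto elim!: Tab_SucE)
  then show ?case using Suc alg.finite_Irr by (meson finite_SigmaI finite_imageI finite_subset)
qed (simp add: Tab_0 alg.finite_Irr)

lemma eps_path_0: "eps_path A \<iota> 0 T = \<one>\<^bsub>A 0\<^esub>"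
  by (simp add: eps_path_def)

lemma eps_path_snoc:
  assumes T: "T \<in> Tab A \<iota> n" and \<nu>: "\<nu> \<in> Irr (A (Suc n))"
  shows "eps_path A \<iota> (Suc n) (T @ [\<nu>]) =
    \<iota> n (eps_path A \<iota> n T) \<otimes>\<^bsub>A (Suc n)\<^esub> eps (A (Suc n)) \<nu>"
proof -
  have len: "length T = Suc n" using T by (simp add: Tab_def)
  let ?f = "\<lambda>k. incl \<iota> k n (eps (A k) (T ! k))"
  have f: "?f k \<in> carrier (A n)" if "k \<in> set [1..<Suc n]" for k
    using that Tab_nth[OF T, of k] by (auto intro: incl_closed)
  have "eps_path A \<iota> (Suc n) (T @ [\<nu>]) =
      foldr (\<lambda>k x. incl \<iota> k (Suc n) (eps (A k) ((T @ [\<nu>]) ! k)) \<otimes>\<^bsub>A (Suc n)\<^esub> x) [1..<Suc n]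
        (eps (A (Suc n)) \<nu>)"
    unfolding eps_path_def using len \<nu> by (simp add: nth_append)
  also have "\<dots> = foldr (\<lambda>k x. \<iota> n (?f k) \<otimes>\<^bsub>A (Suc n)\<^esub> x) [1..<Suc n] (eps (A (Suc n)) \<nu>)"
    by (rule foldr_cong) (use len in \<open>auto simp: nth_append incl_Suc\<close>)
  also have "\<dots> = foldr (\<lambda>k x. \<iota> n (?f k) \<otimes>\<^bsub>A (Suc n)\<^esub> x) [1..<Suc n] \<one>\<^bsub>A (Suc n)\<^esub> \<otimes>\<^bsub>A (Suc n)\<^esub>
      eps (A (Suc n)) \<nu>"
    using alg.foldr_mult_start[of "[1..<Suc n]" "\<lambda>k. \<iota> n (?f k)" "Suc n"] f \<nu> by blast
  also have "foldr (\<lambda>k x. \<iota> n (?f k) \<otimes>\<^bsub>A (Suc n)\<^esub> x) [1..<Suc n] \<one>\<^bsub>A (Suc n)\<^esub> =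
      \<iota> n (eps_path A \<iota> n T)"
    unfolding eps_path_def using f
    by (intro ring_hom_foldr_mult[OF alg.ring_axioms \<iota>_ring_hom, symmetric]) blast
  finally show ?thesis .
qed

lemma eps_path_closed [simp, intro]: "T \<in> Tab A \<iota> n \<Longrightarrow> eps_path A \<iota> n T \<in> carrier (A n)"
  by (induction n arbitrary: T) (auto simp: eps_path_0 eps_path_snoc elim!: Tab_SucE)

text \<open>For \<open>n = 0\<close> the product is empty, and the claim holds because \<open>eps (A 0) (last T) = 1\<close>. Otherwise
  \<open>eps (A n) (last T)\<close> is a central idempotent and already occurs as the last factor.\<close>

lemma eps_path_last:
  assumes T: "T \<in> Tab A \<iota> n"
  shows "eps (A n) (last T) \<otimes>\<^bsub>A n\<^esub> eps_path A \<iota> n T = eps_path A \<iota> n T"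
proof (cases n)
  case 0
  then show ?thesis using T Tab_last[OF T] by (simp add: eps_path_0 eps_0)
next
  case (Suc m)
  then obtain S \<nu> where S: "T = S @ [\<nu>]" "S \<in> Tab A \<iota> m" "\<nu> \<in> Irr (A (Suc m))"
    using T by (auto elim!: Tab_SucE)
  have e: "\<iota> m (eps_path A \<iota> m S) \<in> carrier (A (Suc m))" using S by simp
  have "eps (A n) (last T) \<otimes>\<^bsub>A n\<^esub> eps_path A \<iota> n T =
      (eps (A n) \<nu> \<otimes>\<^bsub>A n\<^esub> \<iota> m (eps_path A \<iota> m S)) \<otimes>\<^bsub>A n\<^esub> eps (A n) \<nu>"
    using S e Suc by (simp add: eps_path_snoc alg.m_assoc)
  also have "\<dots> = \<iota> m (eps_path A \<iota> m S) \<otimes>\<^bsub>A n\<^esub> (eps (A n) \<nu> \<otimes>\<^bsub>A n\<^esub> eps (A n) \<nu>)"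
    using S e Suc alg.centerD(2)[OF alg.eps_central[OF S(3)] e] by (simp add: alg.m_assoc)
  also have "\<dots> = eps_path A \<iota> n T" using S Suc by (simp add: eps_path_snoc alg.eps_mult)
  finally show ?thesis .
qed

text \<open>As \<open>eps\<close> of the last vertex is central, the product splits into a product at the last vertices
  and one of the truncated paths.\<close>

lemma eps_path_mult:
  assumes "S \<in> Tab A \<iota> n" "T \<in> Tab A \<iota> n"
  shows "eps_path A \<iota> n S \<otimes>\<^bsub>A n\<^esub> eps_path A \<iota> n T =
    (if S = T then eps_path A \<iota> n S else \<zero>\<^bsub>A n\<^esub>)"
  using assms
proof (induction n arbitrary: S T)
  case 0
  then show ?case using Irr_0 by (auto simp: eps_path_0 Tab_0)
next
  case (Suc n)
  obtain S' \<mu> where S: "S = S' @ [\<mu>]" "S' \<in> Tab A \<iota> n" "\<mu> \<in> Irr (A (Suc n))"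
    using Suc.prems(1) by (auto elim!: Tab_SucE)
  obtain T' \<nu> where T: "T = T' @ [\<nu>]" "T' \<in> Tab A \<iota> n" "\<nu> \<in> Irr (A (Suc n))"
    using Suc.prems(2) by (auto elim!: Tab_SucE)
  let ?s = "\<iota> n (eps_path A \<iota> n S')" and ?t = "\<iota> n (eps_path A \<iota> n T')"
  have c: "?s \<in> carrier (A (Suc n))" "?t \<in> carrier (A (Suc n))" using S T by auto
  have "eps_path A \<iota> (Suc n) S \<otimes>\<^bsub>A (Suc n)\<^esub> eps_path A \<iota> (Suc n) T =
      ?s \<otimes>\<^bsub>A (Suc n)\<^esub> (eps (A (Suc n)) \<mu> \<otimes>\<^bsub>A (Suc n)\<^esub> ?t) \<otimes>\<^bsub>A (Suc n)\<^esub> eps (A (Suc n)) \<nu>"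
    using S T c by (simp add: eps_path_snoc alg.m_assoc)
  also have "\<dots> = (?s \<otimes>\<^bsub>A (Suc n)\<^esub> ?t) \<otimes>\<^bsub>A (Suc n)\<^esub> (eps (A (Suc n)) \<mu> \<otimes>\<^bsub>A (Suc n)\<^esub> eps (A (Suc n)) \<nu>)"
    using S T c alg.centerD(2)[OF alg.eps_central[OF S(3)] c(2)] by (simp add: alg.m_assoc)
  also have "?s \<otimes>\<^bsub>A (Suc n)\<^esub> ?t = (if S' = T' then ?s else \<zero>\<^bsub>A (Suc n)\<^esub>)"
    using Suc.IH[OF S(2) T(2)] S T by (simp add: \<iota>_mult[symmetric])
  finally show ?case using S T c by (simp add: eps_path_snoc alg.eps_mult)
qed

text \<open>On the representative of the last vertex, the last factor is the identity; the remaining product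
  is nonzero there because it is nonzero on the constituent given by the previous vertex.\<close>

lemma eps_path_acts_nonzero:
  assumes "T \<in> Tab A \<iota> n"
  shows "\<exists>v\<in>carrier (Vrep (last T)). eps_path A \<iota> n T \<odot>\<^bsub>Vrep (last T)\<^esub> v \<noteq> \<zero>\<^bsub>Vrep (last T)\<^esub>"
  using assms
proof (induction n arbitrary: T)
  case 0
  then show ?case using alg.eps_acts_nonzero[of "last T" 0] Tab_last[OF 0] by (simp add: eps_path_0 eps_0)
next
  case (Suc n)
  obtain S \<nu> where S: "T = S @ [\<nu>]" "S \<in> Tab A \<iota> n" "edge A \<iota> n (last S) \<nu>" "\<nu> \<in> Irr (A (Suc n))"
    using Suc.prems by (auto elim!: Tab_SucE)
  interpret V: lmodule "A (Suc n)" "Vrep \<nu>" using S(4) by (rule alg.Vrep_lmodule)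
  obtain v where v: "v \<in> carrier (Vrep (last S))"
    "eps_path A \<iota> n S \<odot>\<^bsub>Vrep (last S)\<^esub> v \<noteq> \<zero>\<^bsub>Vrep (last S)\<^esub>"
    using Suc.IH[OF S(2)] by blast
  obtain w where w: "w \<in> carrier (Vrep \<nu>)" "\<iota> n (eps_path A \<iota> n S) \<odot>\<^bsub>Vrep \<nu>\<^esub> w \<noteq> \<zero>\<^bsub>Vrep \<nu>\<^esub>"
    using branching.nonzero_action_lifts[OF branching _ S(4) _ eps_path_closed[OF S(2)] v] S(3)
    unfolding edge_iff by blast
  have "eps_path A \<iota> (Suc n) T \<odot>\<^bsub>Vrep \<nu>\<^esub> w = \<iota> n (eps_path A \<iota> n S) \<odot>\<^bsub>Vrep \<nu>\<^esub> w"
    using S w(1) alg.eps_acts[OF S(4) S(4) Vrep_mem[OF alg.ring_axioms S(4)] w(1)]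
    by (simp add: eps_path_snoc V.act_mult)
  then show ?case using w S(1) by auto
qed

lemma eps_path_nonzero:
  assumes T: "T \<in> Tab A \<iota> n"
  shows "eps_path A \<iota> n T \<noteq> \<zero>\<^bsub>A n\<^esub>"
proof -
  interpret V: lmodule "A n" "Vrep (last T)" using Tab_last[OF T] by (rule alg.Vrep_lmodule)
  show ?thesis using eps_path_acts_nonzero[OF T] by auto
qed

text \<open>Group the paths by their second to last vertex \<open>\<mu>\<close>. By induction each group contributes
  \<open>eps (A n) \<mu>\<close> times \<open>eps (A (Suc n)) \<nu>\<close>.\<close>

lemma eps_path_sum_type:
  assumes "\<nu> \<in> Irr (A n)"
  shows "(\<Oplus>\<^bsub>A n\<^esub>T\<in>{T \<in> Tab A \<iota> n. last T = \<nu>}. eps_path A \<iota> n T) = eps (A n) \<nu>"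
  using assms
proof (induction n arbitrary: \<nu>)
  case 0
  then have "{T \<in> Tab A \<iota> 0. last T = \<nu>} = {[\<nu>]}" by (auto simp: Tab_0)
  then show ?case using 0 by (simp add: eps_path_0 eps_0)
next
  case (Suc n)
  note \<nu> = Suc.prems
  let ?P = "{\<mu> \<in> Irr (A n). edge A \<iota> n \<mu> \<nu>}"
  let ?S = "\<lambda>\<mu>. {S \<in> Tab A \<iota> n. last S = \<mu>}"
  have "{T \<in> Tab A \<iota> (Suc n). last T = \<nu>} = (\<Union>\<mu>\<in>?P. (\<lambda>S. S @ [\<nu>]) ` ?S \<mu>)"
    unfolding Tab_Suc by (auto simp: edge_def)
  then have "(\<Oplus>\<^bsub>A (Suc n)\<^esub>T\<in>{T \<in> Tab A \<iota> (Suc n). last T = \<nu>}. eps_path A \<iota> (Suc n) T) =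
      (\<Oplus>\<^bsub>A (Suc n)\<^esub>T\<in>(\<Union>\<mu>\<in>?P. (\<lambda>S. S @ [\<nu>]) ` ?S \<mu>). eps_path A \<iota> (Suc n) T)" by simp
  also have "\<dots> = (\<Oplus>\<^bsub>A (Suc n)\<^esub>\<mu>\<in>?P. \<Oplus>\<^bsub>A (Suc n)\<^esub>T\<in>(\<lambda>S. S @ [\<nu>]) ` ?S \<mu>. eps_path A \<iota> (Suc n) T)"
    using finite_Tab[of n] alg.finite_Irr[of n]
    by (intro alg.finsum_nested) (auto simp: Tab_Suc)
  also have "\<dots> = (\<Oplus>\<^bsub>A (Suc n)\<^esub>\<mu>\<in>?P. \<iota> n (eps (A n) \<mu>) \<otimes>\<^bsub>A (Suc n)\<^esub> eps (A (Suc n)) \<nu>)"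
  proof (rule alg.finsum_cong')
    fix \<mu> assume \<mu>: "\<mu> \<in> ?P"
    have "(\<Oplus>\<^bsub>A (Suc n)\<^esub>T\<in>(\<lambda>S. S @ [\<nu>]) ` ?S \<mu>. eps_path A \<iota> (Suc n) T) =
        (\<Oplus>\<^bsub>A (Suc n)\<^esub>S\<in>?S \<mu>. eps_path A \<iota> (Suc n) (S @ [\<nu>]))"
      by (rule alg.finsum_reindex) (use \<mu> in \<open>auto simp: Tab_Suc inj_on_def\<close>)
    also have "\<dots> = (\<Oplus>\<^bsub>A (Suc n)\<^esub>S\<in>?S \<mu>. \<iota> n (eps_path A \<iota> n S) \<otimes>\<^bsub>A (Suc n)\<^esub> eps (A (Suc n)) \<nu>)"
      by (rule alg.finsum_cong') (use \<nu> in \<open>auto simp: eps_path_snoc\<close>)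
    also have "\<dots> = (\<Oplus>\<^bsub>A (Suc n)\<^esub>S\<in>?S \<mu>. \<iota> n (eps_path A \<iota> n S)) \<otimes>\<^bsub>A (Suc n)\<^esub> eps (A (Suc n)) \<nu>"
      using \<nu> finite_Tab[of n] by (intro alg.finsum_ldistr[symmetric]) auto
    also have "(\<Oplus>\<^bsub>A (Suc n)\<^esub>S\<in>?S \<mu>. \<iota> n (eps_path A \<iota> n S)) = \<iota> n (eps (A n) \<mu>)"
      using Suc.IH[of \<mu>] \<mu> by (subst \<iota>_finsum[symmetric]) auto
    finally show "(\<Oplus>\<^bsub>A (Suc n)\<^esub>T\<in>(\<lambda>S. S @ [\<nu>]) ` ?S \<mu>. eps_path A \<iota> (Suc n) T) =
        \<iota> n (eps (A n) \<mu>) \<otimes>\<^bsub>A (Suc n)\<^esub> eps (A (Suc n)) \<nu>" .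
  qed (use \<nu> in auto)
  also have "\<dots> = eps (A (Suc n)) \<nu>" using \<nu> by (rule eps_sum_over_predecessors)
  finally show ?case .
qed

lemma eps_path_sum: "(\<Oplus>\<^bsub>A n\<^esub>T\<in>Tab A \<iota> n. eps_path A \<iota> n T) = \<one>\<^bsub>A n\<^esub>"
proof -
  have "Tab A \<iota> n = (\<Union>\<nu>\<in>Irr (A n). {T \<in> Tab A \<iota> n. last T = \<nu>})" using Tab_last by auto
  then have "(\<Oplus>\<^bsub>A n\<^esub>T\<in>Tab A \<iota> n. eps_path A \<iota> n T) =
      (\<Oplus>\<^bsub>A n\<^esub>T\<in>(\<Union>\<nu>\<in>Irr (A n). {T \<in> Tab A \<iota> n. last T = \<nu>}). eps_path A \<iota> n T)" by simp
  also have "\<dots> = (\<Oplus>\<^bsub>A n\<^esub>\<nu>\<in>Irr (A n). \<Oplus>\<^bsub>A n\<^esub>T\<in>{T \<in> Tab A \<iota> n. last T = \<nu>}. eps_path A \<iota> n T)"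
    using finite_Tab[of n] alg.finite_Irr[of n] by (intro alg.finsum_nested) auto
  also have "\<dots> = (\<Oplus>\<^bsub>A n\<^esub>\<nu>\<in>Irr (A n). eps (A n) \<nu>)"
    by (rule alg.finsum_cong') (auto simp: eps_path_sum_type)
  finally show ?thesis by (simp add: alg.eps_sum)
qed

text \<open>Multiply by \<open>1\<close>, the sum of the \<open>eps (A (Suc n)) \<nu>\<close>. If there is no edge from the last vertex of
  \<open>S\<close> to \<open>\<nu>\<close>, the term vanishes, since the path idempotent absorbs \<open>eps (A n) (last S)\<close>.\<close>

lemma eps_path_extensions:
  assumes S: "S \<in> Tab A \<iota> n"
  shows "(\<Oplus>\<^bsub>A (Suc n)\<^esub>\<nu>\<in>{\<nu>. edge A \<iota> n (last S) \<nu>}. eps_path A \<iota> (Suc n) (S @ [\<nu>])) =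
    \<iota> n (eps_path A \<iota> n S)"
proof -
  let ?s = "\<iota> n (eps_path A \<iota> n S)"
  have s: "?s \<in> carrier (A (Suc n))" using S by simp
  have zero: "?s \<otimes>\<^bsub>A (Suc n)\<^esub> eps (A (Suc n)) \<nu> = \<zero>\<^bsub>A (Suc n)\<^esub>"
    if \<nu>: "\<nu> \<in> Irr (A (Suc n))" "\<not> edge A \<iota> n (last S) \<nu>" for \<nu>
  proof -
    have l: "last S \<in> Irr (A n)" using Tab_last[OF S] .
    have c: "eps (A n) (last S) \<in> carrier (A n)" using l by simp
    have "eps_path A \<iota> n S = eps_path A \<iota> n S \<otimes>\<^bsub>A n\<^esub> eps (A n) (last S)"
      using eps_path_last[OF S] alg.centerD(2)[OF alg.eps_central[OF l]] S by simp
    then have "?s = ?s \<otimes>\<^bsub>A (Suc n)\<^esub> \<iota> n (eps (A n) (last S))" using S c by (metis \<iota>_mult eps_path_closed)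
    then have "?s \<otimes>\<^bsub>A (Suc n)\<^esub> eps (A (Suc n)) \<nu> =
        ?s \<otimes>\<^bsub>A (Suc n)\<^esub> (\<iota> n (eps (A n) (last S)) \<otimes>\<^bsub>A (Suc n)\<^esub> eps (A (Suc n)) \<nu>)"
      using s c \<nu>(1) by (metis alg.eps_closed alg.m_assoc \<iota>_closed)
    then show ?thesis using eps_mult_not_edge[OF l \<nu>] s by simp
  qed
  have "(\<Oplus>\<^bsub>A (Suc n)\<^esub>\<nu>\<in>{\<nu>. edge A \<iota> n (last S) \<nu>}. eps_path A \<iota> (Suc n) (S @ [\<nu>])) =
      (\<Oplus>\<^bsub>A (Suc n)\<^esub>\<nu>\<in>Irr (A (Suc n)). ?s \<otimes>\<^bsub>A (Suc n)\<^esub> eps (A (Suc n)) \<nu>)"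
    using zero s S
    by (intro alg.add.finprod_mono_neutral_cong_left alg.finite_Irr) (auto simp: eps_path_snoc edge_def)
  also have "\<dots> = ?s \<otimes>\<^bsub>A (Suc n)\<^esub> (\<Oplus>\<^bsub>A (Suc n)\<^esub>\<nu>\<in>Irr (A (Suc n)). eps (A (Suc n)) \<nu>)"
    using s by (intro alg.finsum_rdistr[symmetric] alg.finite_Irr) auto
  finally show ?thesis using s by (simp add: alg.eps_sum)
qed

end

section \<open>The Gelfand--Zetlin subalgebra\<close>

context mf_family
begin

lemma GZ_generators_closed: "(\<Union>k\<in>{1..n}. incl \<iota> k n ` center (A k)) \<subseteq> carrier (A n)"
  by (auto intro!: incl_closed dest: alg.centerD(1))

lemma GZ_subalg: "subalg (GZ A \<iota> n) (A n)"
  unfolding GZ_def by (rule alg.subalg_generated[OF GZ_generators_closed])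

lemma GZ_closed: "x \<in> GZ A \<iota> n \<Longrightarrow> x \<in> carrier (A n)"
  using alg.subalgD(1)[OF GZ_subalg] by blast

lemma GZ_commute:
  assumes "x \<in> GZ A \<iota> n" "y \<in> GZ A \<iota> n"
  shows "x \<otimes>\<^bsub>A n\<^esub> y = y \<otimes>\<^bsub>A n\<^esub> x"
  by (rule alg.generated_commutative[OF GZ_generators_closed])
    (use assms in \<open>auto simp: GZ_def incl_central_commute\<close>)

lemma GZ_comm_monoid: "comm_monoid ((A n)\<lparr>carrier := GZ A \<iota> n\<rparr>)"
  by (rule comm_monoidI)
    (auto simp: alg.m_assoc GZ_closed alg.subalgD(2,3)[OF GZ_subalg] intro: GZ_commute)

text \<open>The next two lemmas evaluate an interpolation product on an eigenvector of its factors.\<close>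

lemma finprod_GZ_absorb:
  assumes "finite D" "\<And>\<xi>. \<xi> \<in> D \<Longrightarrow> F \<xi> \<in> GZ A \<iota> n" "e \<in> carrier (A n)"
    and "\<And>\<xi>. \<xi> \<in> D \<Longrightarrow> F \<xi> \<otimes>\<^bsub>A n\<^esub> e = e"
  shows "finprod ((A n)\<lparr>carrier := GZ A \<iota> n\<rparr>) F D \<otimes>\<^bsub>A n\<^esub> e = e"
proof -
  interpret G: comm_monoid "(A n)\<lparr>carrier := GZ A \<iota> n\<rparr>" by (rule GZ_comm_monoid)
  show ?thesis
    using assms
  proof (induction D rule: finite_induct)
    case (insert \<xi> D)
    have c: "finprod ((A n)\<lparr>carrier := GZ A \<iota> n\<rparr>) F D \<in> GZ A \<iota> n"
      using insert.prems G.finprod_closed[of F D] by auto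
    have "finprod ((A n)\<lparr>carrier := GZ A \<iota> n\<rparr>) F (insert \<xi> D) =
        F \<xi> \<otimes>\<^bsub>A n\<^esub> finprod ((A n)\<lparr>carrier := GZ A \<iota> n\<rparr>) F D"
      using insert G.finprod_insert[of D \<xi> F] by auto
    then show ?case using insert c GZ_closed by (simp add: alg.m_assoc)
  qed simp
qed

lemma finprod_GZ_annihilate:
  assumes "finite D" "\<And>\<xi>. \<xi> \<in> D \<Longrightarrow> F \<xi> \<in> GZ A \<iota> n" "e \<in> carrier (A n)"
    and "\<xi> \<in> D" "F \<xi> \<otimes>\<^bsub>A n\<^esub> e = \<zero>\<^bsub>A n\<^esub>"
  shows "finprod ((A n)\<lparr>carrier := GZ A \<iota> n\<rparr>) F D \<otimes>\<^bsub>A n\<^esub> e = \<zero>\<^bsub>A n\<^esub>"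
proof -
  interpret G: comm_monoid "(A n)\<lparr>carrier := GZ A \<iota> n\<rparr>" by (rule GZ_comm_monoid)
  let ?Q = "finprod ((A n)\<lparr>carrier := GZ A \<iota> n\<rparr>) F (D - {\<xi>})"
  have Q: "?Q \<in> GZ A \<iota> n" using assms(2) G.finprod_closed[of F "D - {\<xi>}"] by auto
  have "finprod ((A n)\<lparr>carrier := GZ A \<iota> n\<rparr>) F (insert \<xi> (D - {\<xi>})) = F \<xi> \<otimes>\<^bsub>A n\<^esub> ?Q"
    using assms(1,2,4) G.finprod_insert[of "D - {\<xi>}" \<xi> F] by auto
  then have "finprod ((A n)\<lparr>carrier := GZ A \<iota> n\<rparr>) F D = ?Q \<otimes>\<^bsub>A n\<^esub> F \<xi>"
    using assms(2,4) Q GZ_commute by (simp add: insert_absorb)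
  then show ?thesis using assms Q GZ_closed by (simp add: alg.m_assoc)
qed

lemma eps_path_in_GZ:
  assumes T: "T \<in> Tab A \<iota> n"
  shows "eps_path A \<iota> n T \<in> GZ A \<iota> n"
proof -
  have *: "foldr (\<lambda>k x. incl \<iota> k n (eps (A k) (T ! k)) \<otimes>\<^bsub>A n\<^esub> x) ks \<one>\<^bsub>A n\<^esub> \<in> GZ A \<iota> n"
    if "set ks \<subseteq> {1..n}" for ks
    using that
  proof (induction ks)
    case Nil
    then show ?case using alg.subalgD(2)[OF GZ_subalg] by simp
  next
    case (Cons k ks)
    then have k: "k \<in> {1..n}" by simp
    then have "incl \<iota> k n (eps (A k) (T ! k)) \<in> GZ A \<iota> n"
      unfolding GZ_def using Tab_nth[OF T, of k]
      by (intro subsetD[OF alg.generated_incl] UN_I[of k] imageI alg.eps_central k) simp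
    then show ?case using Cons alg.subalgD(3)[OF GZ_subalg] by simp
  qed
  show ?thesis unfolding eps_path_def by (rule *) (auto simp del: upt_Suc)
qed

text \<open>A central element of \<open>A k\<close> is a scalar on \<open>eps (A k)\<close> of the \<open>k\<close>-th vertex, and that idempotent is one
  of the factors of \<open>eps_path A \<iota> n T\<close>; for \<open>k = 0\<close> it is \<open>1\<close>.\<close>

lemma central_scalar_on_path:
  assumes "T \<in> Tab A \<iota> n" "k \<le> n" "z \<in> center (A k)"
  shows "\<exists>c. incl \<iota> k n z \<otimes>\<^bsub>A n\<^esub> eps_path A \<iota> n T = c \<odot>\<^bsub>A n\<^esub> eps_path A \<iota> n T"
  using assms(1,2)
proof (induction n arbitrary: T)
  case 0
  obtain c where "z \<otimes>\<^bsub>A 0\<^esub> eps (A 0) (last T) = c \<odot>\<^bsub>A 0\<^esub> eps (A 0) (last T)"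
    using alg.central_scalar_on_eps[of z 0 "last T"] Tab_last[OF 0(1)] assms(3) 0(2) by auto
  then show ?case using 0 Tab_last[OF 0(1)] by (auto simp: eps_path_0 eps_0)
next
  case (Suc n)
  note zc = alg.centerD(1)[OF assms(3)]
  show ?case
  proof (cases "k = Suc n")
    case True
    have l: "last T \<in> Irr (A k)" using Tab_last[OF Suc.prems(1)] True by simp
    obtain c where c: "z \<otimes>\<^bsub>A k\<^esub> eps (A k) (last T) = c \<odot>\<^bsub>A k\<^esub> eps (A k) (last T)"
      using alg.central_scalar_on_eps[OF assms(3) l] by blast
    have "z \<otimes>\<^bsub>A k\<^esub> eps_path A \<iota> k T = (z \<otimes>\<^bsub>A k\<^esub> eps (A k) (last T)) \<otimes>\<^bsub>A k\<^esub> eps_path A \<iota> k T"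
      using eps_path_last[OF Suc.prems(1)] Suc.prems(1) zc l True by (simp add: alg.m_assoc)
    also have "\<dots> = c \<odot>\<^bsub>A k\<^esub> eps_path A \<iota> k T"
      using eps_path_last[OF Suc.prems(1)] Suc.prems(1) l True by (simp add: c[unfolded True] alg.scalar_mult_left)
    finally show ?thesis using True by auto
  next
    case False
    obtain S \<nu> where S: "T = S @ [\<nu>]" "S \<in> Tab A \<iota> n" "\<nu> \<in> Irr (A (Suc n))"
      using Suc.prems(1) by (auto elim!: Tab_SucE)
    have k: "k \<le> n" using False Suc.prems by simp
    obtain c where c: "incl \<iota> k n z \<otimes>\<^bsub>A n\<^esub> eps_path A \<iota> n S = c \<odot>\<^bsub>A n\<^esub> eps_path A \<iota> n S"
      using Suc.IH[OF S(2) k] by blast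
    have "incl \<iota> k (Suc n) z \<otimes>\<^bsub>A (Suc n)\<^esub> eps_path A \<iota> (Suc n) T =
        \<iota> n (incl \<iota> k n z \<otimes>\<^bsub>A n\<^esub> eps_path A \<iota> n S) \<otimes>\<^bsub>A (Suc n)\<^esub> eps (A (Suc n)) \<nu>"
      using S k incl_closed[OF k zc] by (simp add: eps_path_snoc incl_Suc \<iota>_mult alg.m_assoc)
    also have "\<dots> = c \<odot>\<^bsub>A (Suc n)\<^esub> eps_path A \<iota> (Suc n) T"
      using S by (simp add: c \<iota>_scalar eps_path_snoc alg.scalar_mult_left)
    finally show ?thesis by blast
  qed
qed

lemma GZ_scalar_on_path:
  assumes x: "x \<in> GZ A \<iota> n" and T: "T \<in> Tab A \<iota> n"
  shows "\<exists>c. x \<otimes>\<^bsub>A n\<^esub> eps_path A \<iota> n T = c \<odot>\<^bsub>A n\<^esub> eps_path A \<iota> n T"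
proof -
  let ?B = "{x \<in> carrier (A n). \<exists>c. \<forall>e\<in>{eps_path A \<iota> n T}. x \<otimes>\<^bsub>A n\<^esub> e = c \<odot>\<^bsub>A n\<^esub> e}"
  have "GZ A \<iota> n \<subseteq> ?B"
    unfolding GZ_def
  proof (rule alg.generated_minimal[OF alg.subalg_common_eigenvectors])
    show "(\<Union>k\<in>{1..n}. incl \<iota> k n ` center (A k)) \<subseteq> ?B"
      using GZ_generators_closed[of n] central_scalar_on_path[OF T] by auto
  qed (use T in auto)
  then show ?thesis using x by blast
qed

end

section \<open>Jucys--Murphy sequences\<close>

locale JM_family = mf_family A \<iota>
  for A :: "nat \<Rightarrow> ('k::field, 'a) module" and \<iota> :: "nat \<Rightarrow> 'a \<Rightarrow> 'a" +
  fixes J :: "nat \<Rightarrow> 'a"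
  assumes JM: "JM_sequence A \<iota> J"
begin

lemma J_in_GZ: "1 \<le> n \<Longrightarrow> J n \<in> GZ A \<iota> n"
  using JM by (simp add: JM_sequence_def)

lemma J_closed: "1 \<le> n \<Longrightarrow> J n \<in> carrier (A n)"
  using J_in_GZ GZ_closed by blast

lemma incl_J_in_GZ:
  assumes "1 \<le> k" "k \<le> n"
  shows "incl \<iota> k n (J k) \<in> GZ A \<iota> n"
proof -
  have "GZ A \<iota> n = generated_subalg (A n) ((\<lambda>k. incl \<iota> k n (J k)) ` {1..n})"
    using JM assms by (simp add: JM_sequence_def separating_def)
  then show ?thesis using assms alg.generated_incl by fastforce
qed

text \<open>For \<open>n = 0\<close> this is the empty sum, which is central as well; so the first step of the sequence needs
  no separate treatment.\<close>

definition J_sum :: "nat \<Rightarrow> 'a" where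
  "J_sum n = (\<Oplus>\<^bsub>A n\<^esub>k\<in>{1..n}. incl \<iota> k n (J k))"

lemma J_sum_central: "J_sum n \<in> center (A n)"
proof (cases "1 \<le> n")
  case True
  then show ?thesis using JM by (simp add: JM_sequence_def additively_central_def J_sum_def)
next
  case False
  then show ?thesis by (simp add: J_sum_def center_def)
qed

lemma J_sum_Suc: "J_sum (Suc n) = J (Suc n) \<oplus>\<^bsub>A (Suc n)\<^esub> \<iota> n (J_sum n)"
proof -
  have c: "incl \<iota> k n (J k) \<in> carrier (A n)" if "k \<in> {1..n}" for k
    using that J_closed incl_closed by simp
  have "J_sum (Suc n) = (\<Oplus>\<^bsub>A (Suc n)\<^esub>k\<in>insert (Suc n) {1..n}. incl \<iota> k (Suc n) (J k))"
    unfolding J_sum_def by (simp add: atLeastAtMostSuc_conv)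
  also have "\<dots> = J (Suc n) \<oplus>\<^bsub>A (Suc n)\<^esub> (\<Oplus>\<^bsub>A (Suc n)\<^esub>k\<in>{1..n}. incl \<iota> k (Suc n) (J k))"
    using c J_closed by (subst alg.finsum_insert) (auto simp: incl_Suc)
  also have "(\<Oplus>\<^bsub>A (Suc n)\<^esub>k\<in>{1..n}. incl \<iota> k (Suc n) (J k)) =
      (\<Oplus>\<^bsub>A (Suc n)\<^esub>k\<in>{1..n}. \<iota> n (incl \<iota> k n (J k)))"
    using c by (intro alg.finsum_cong') (auto simp: incl_Suc)
  also have "\<dots> = \<iota> n (J_sum n)" unfolding J_sum_def by (rule \<iota>_finsum[symmetric]) (use c in auto)
  finally show ?thesis .
qed

text \<open>This is where additive centrality enters. In \<open>J (Suc n) = J_sum (Suc n) - J_sum n\<close>, the first sum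
  is central in \<open>A (Suc n)\<close>, so it acts on a path by a scalar that depends only on its end \<open>\<nu>\<close>; the second
  is central in \<open>A n\<close>, so its scalar depends only on the vertex before.\<close>

lemma J_eigenvalue_by_last_edge:
  "\<exists>g. \<forall>S \<nu>. S \<in> Tab A \<iota> n \<longrightarrow> edge A \<iota> n (last S) \<nu> \<longrightarrow>
     J (Suc n) \<otimes>\<^bsub>A (Suc n)\<^esub> eps_path A \<iota> (Suc n) (S @ [\<nu>]) =
       g (last S) \<nu> \<odot>\<^bsub>A (Suc n)\<^esub> eps_path A \<iota> (Suc n) (S @ [\<nu>])"
proof -
  have "\<forall>\<nu>\<in>Irr (A k). \<exists>c. J_sum k \<otimes>\<^bsub>A k\<^esub> eps (A k) \<nu> = c \<odot>\<^bsub>A k\<^esub> eps (A k) \<nu>" for k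
    using alg.central_scalar_on_eps[OF J_sum_central] by blast
  then have "\<exists>f. \<forall>\<nu>\<in>Irr (A k). J_sum k \<otimes>\<^bsub>A k\<^esub> eps (A k) \<nu> = f \<nu> \<odot>\<^bsub>A k\<^esub> eps (A k) \<nu>" for k
    by (rule bchoice)
  then obtain f where f: "\<And>k \<nu>. \<nu> \<in> Irr (A k) \<Longrightarrow>
      J_sum k \<otimes>\<^bsub>A k\<^esub> eps (A k) \<nu> = f k \<nu> \<odot>\<^bsub>A k\<^esub> eps (A k) \<nu>" by metis
  have zc: "J_sum k \<in> carrier (A k)" for k using J_sum_central alg.centerD(1) by blast
  have on_path: "J_sum k \<otimes>\<^bsub>A k\<^esub> eps_path A \<iota> k T = f k (last T) \<odot>\<^bsub>A k\<^esub> eps_path A \<iota> k T"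
    if T: "T \<in> Tab A \<iota> k" for k T
  proof -
    have "J_sum k \<otimes>\<^bsub>A k\<^esub> eps_path A \<iota> k T =
        (J_sum k \<otimes>\<^bsub>A k\<^esub> eps (A k) (last T)) \<otimes>\<^bsub>A k\<^esub> eps_path A \<iota> k T"
      using eps_path_last[OF T] T zc Tab_last[OF T] by (simp add: alg.m_assoc)
    then show ?thesis using eps_path_last[OF T] T Tab_last[OF T] by (simp add: f alg.scalar_mult_left)
  qed
  have "J (Suc n) \<otimes>\<^bsub>A (Suc n)\<^esub> eps_path A \<iota> (Suc n) (S @ [\<nu>]) =
      (f (Suc n) \<nu> - f n (last S)) \<odot>\<^bsub>A (Suc n)\<^esub> eps_path A \<iota> (Suc n) (S @ [\<nu>])"
    if S: "S \<in> Tab A \<iota> n" "edge A \<iota> n (last S) \<nu>" for S \<nu>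
  proof -
    let ?e = "eps_path A \<iota> (Suc n) (S @ [\<nu>])"
    have T: "S @ [\<nu>] \<in> Tab A \<iota> (Suc n)" using S by (auto simp: Tab_Suc)
    have \<nu>: "\<nu> \<in> Irr (A (Suc n))" using S(2) by (simp add: edge_def)
    have e: "?e \<in> carrier (A (Suc n))" using T by simp
    have "J (Suc n) = J_sum (Suc n) \<ominus>\<^bsub>A (Suc n)\<^esub> \<iota> n (J_sum n)"
      using J_closed[of "Suc n"] zc by (simp add: J_sum_Suc alg.minus_eq alg.a_assoc alg.r_neg)
    then have "J (Suc n) \<otimes>\<^bsub>A (Suc n)\<^esub> ?e =
        J_sum (Suc n) \<otimes>\<^bsub>A (Suc n)\<^esub> ?e \<ominus>\<^bsub>A (Suc n)\<^esub> \<iota> n (J_sum n) \<otimes>\<^bsub>A (Suc n)\<^esub> ?e"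
      using e zc by (simp add: alg.minus_eq alg.l_distr alg.l_minus)
    also have "J_sum (Suc n) \<otimes>\<^bsub>A (Suc n)\<^esub> ?e = f (Suc n) \<nu> \<odot>\<^bsub>A (Suc n)\<^esub> ?e"
      using on_path[OF T] by simp
    also have "\<iota> n (J_sum n) \<otimes>\<^bsub>A (Suc n)\<^esub> ?e =
        \<iota> n (J_sum n \<otimes>\<^bsub>A n\<^esub> eps_path A \<iota> n S) \<otimes>\<^bsub>A (Suc n)\<^esub> eps (A (Suc n)) \<nu>"
      using S \<nu> zc by (simp add: eps_path_snoc \<iota>_mult alg.m_assoc)
    also have "\<dots> = f n (last S) \<odot>\<^bsub>A (Suc n)\<^esub> ?e"
      using S \<nu> by (simp add: on_path \<iota>_scalar eps_path_snoc alg.scalar_mult_left)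
    finally show ?thesis using e by (simp add: alg.scalar_diff_left)
  qed
  then show ?thesis by (intro exI[of _ "\<lambda>\<mu> \<nu>. f (Suc n) \<nu> - f n \<mu>"]) blast
qed

text \<open>The path idempotents sum to \<open>1\<close>, so the eigenvalues serve as coefficients of \<open>J n\<close>. As the
  idempotents are orthogonal and nonzero, multiplying an expansion by one of them recovers its
  coefficient, so no other choice is possible.\<close>

lemma JM_coeff_eq_eigenvalue:
  assumes n: "1 \<le> n"
    and c: "\<And>T. T \<in> Tab A \<iota> n \<Longrightarrow> J n \<otimes>\<^bsub>A n\<^esub> eps_path A \<iota> n T = c T \<odot>\<^bsub>A n\<^esub> eps_path A \<iota> n T"
    and T: "T \<in> Tab A \<iota> n"
  shows "JM_coeff A \<iota> J n n T = c T"
proof -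
  have Jc: "J n \<in> carrier (A n)" using J_closed n .
  have expansion: "J n = (\<Oplus>\<^bsub>A n\<^esub>T\<in>Tab A \<iota> n. c T \<odot>\<^bsub>A n\<^esub> eps_path A \<iota> n T)"
  proof -
    have "J n = J n \<otimes>\<^bsub>A n\<^esub> (\<Oplus>\<^bsub>A n\<^esub>T\<in>Tab A \<iota> n. eps_path A \<iota> n T)" using Jc by (simp add: eps_path_sum)
    also have "\<dots> = (\<Oplus>\<^bsub>A n\<^esub>T\<in>Tab A \<iota> n. J n \<otimes>\<^bsub>A n\<^esub> eps_path A \<iota> n T)"
      using Jc by (intro alg.finsum_rdistr finite_Tab) auto
    also have "\<dots> = (\<Oplus>\<^bsub>A n\<^esub>T\<in>Tab A \<iota> n. c T \<odot>\<^bsub>A n\<^esub> eps_path A \<iota> n T)"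
      by (rule alg.finsum_cong') (use c in auto)
    finally show ?thesis .
  qed
  have "JM_coeff A \<iota> J n n = restrict c (Tab A \<iota> n)"
    unfolding JM_coeff_def
  proof (rule the_equality)
    have "(\<Oplus>\<^bsub>A n\<^esub>T\<in>Tab A \<iota> n. restrict c (Tab A \<iota> n) T \<odot>\<^bsub>A n\<^esub> eps_path A \<iota> n T) =
        (\<Oplus>\<^bsub>A n\<^esub>T\<in>Tab A \<iota> n. c T \<odot>\<^bsub>A n\<^esub> eps_path A \<iota> n T)"
      by (rule alg.finsum_cong') auto
    then show "restrict c (Tab A \<iota> n) \<in> extensional (Tab A \<iota> n) \<and> incl \<iota> n n (J n) =
        (\<Oplus>\<^bsub>A n\<^esub>T\<in>Tab A \<iota> n. restrict c (Tab A \<iota> n) T \<odot>\<^bsub>A n\<^esub> eps_path A \<iota> n T)"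
      using expansion by simp
  next
    fix c' assume c': "c' \<in> extensional (Tab A \<iota> n) \<and>
      incl \<iota> n n (J n) = (\<Oplus>\<^bsub>A n\<^esub>T\<in>Tab A \<iota> n. c' T \<odot>\<^bsub>A n\<^esub> eps_path A \<iota> n T)"
    have "c' S = c S" if S: "S \<in> Tab A \<iota> n" for S
    proof (rule alg.scalar_cancel[where x = "eps_path A \<iota> n S"])
      have "J n \<otimes>\<^bsub>A n\<^esub> eps_path A \<iota> n S =
          (\<Oplus>\<^bsub>A n\<^esub>T\<in>Tab A \<iota> n. (c' T \<odot>\<^bsub>A n\<^esub> eps_path A \<iota> n T) \<otimes>\<^bsub>A n\<^esub> eps_path A \<iota> n S)"
        using c' S by (simp add: alg.finsum_ldistr[OF finite_Tab] Pi_def)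
      also have "\<dots> = (c' S \<odot>\<^bsub>A n\<^esub> eps_path A \<iota> n S) \<otimes>\<^bsub>A n\<^esub> eps_path A \<iota> n S"
        using S by (intro alg.finsum_single_term finite_Tab) (auto simp: alg.scalar_mult_left eps_path_mult)
      finally show "c' S \<odot>\<^bsub>A n\<^esub> eps_path A \<iota> n S = c S \<odot>\<^bsub>A n\<^esub> eps_path A \<iota> n S"
        using S c by (simp add: alg.scalar_mult_left eps_path_mult)
    qed (use S eps_path_nonzero in auto)
    then show "c' = restrict c (Tab A \<iota> n)" using c' by (intro extensionalityI[of _ "Tab A \<iota> n"]) auto
  qed
  then show ?thesis using T by simp
qed

text \<open>If siblings had the same eigenvalue under \<open>J (Suc n)\<close>, then each generator of the
  Gelfand--Zetlin subalgebra would act on both by one common scalar: the earlier generators lie in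
  \<open>A n\<close> and see only \<open>S\<close>. The same would be true of the idempotent of the first sibling, which lies in
  that subalgebra. But it acts as \<open>1\<close> on itself and as \<open>0\<close> on the other.\<close>

lemma siblings_separated:
  assumes S: "S \<in> Tab A \<iota> n" and \<mu>: "edge A \<iota> n (last S) \<mu>" and \<nu>: "edge A \<iota> n (last S) \<nu>"
    and c\<mu>: "J (Suc n) \<otimes>\<^bsub>A (Suc n)\<^esub> eps_path A \<iota> (Suc n) (S @ [\<mu>]) =
      c \<odot>\<^bsub>A (Suc n)\<^esub> eps_path A \<iota> (Suc n) (S @ [\<mu>])"
    and c\<nu>: "J (Suc n) \<otimes>\<^bsub>A (Suc n)\<^esub> eps_path A \<iota> (Suc n) (S @ [\<nu>]) =
      c \<odot>\<^bsub>A (Suc n)\<^esub> eps_path A \<iota> (Suc n) (S @ [\<nu>])"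
  shows "\<mu> = \<nu>"
proof (rule ccontr)
  assume ne: "\<mu> \<noteq> \<nu>"
  let ?e = "\<lambda>\<nu>. eps_path A \<iota> (Suc n) (S @ [\<nu>])"
  let ?B = "{x \<in> carrier (A (Suc n)). \<exists>c. \<forall>e\<in>{?e \<mu>, ?e \<nu>}. x \<otimes>\<^bsub>A (Suc n)\<^esub> e = c \<odot>\<^bsub>A (Suc n)\<^esub> e}"
  have T: "S @ [\<mu>] \<in> Tab A \<iota> (Suc n)" "S @ [\<nu>] \<in> Tab A \<iota> (Suc n)" using S \<mu> \<nu> by (auto simp: Tab_Suc)
  have "GZ A \<iota> (Suc n) = generated_subalg (A (Suc n)) ((\<lambda>k. incl \<iota> k (Suc n) (J k)) ` {1..Suc n})"
    using JM by (simp add: JM_sequence_def separating_def)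
  also have "\<dots> \<subseteq> ?B"
  proof (rule alg.generated_minimal[OF alg.subalg_common_eigenvectors])
    show "(\<lambda>k. incl \<iota> k (Suc n) (J k)) ` {1..Suc n} \<subseteq> ?B"
    proof (rule image_subsetI)
      fix k assume k: "k \<in> {1..Suc n}"
      have "\<exists>c. \<forall>e\<in>{?e \<mu>, ?e \<nu>}. incl \<iota> k (Suc n) (J k) \<otimes>\<^bsub>A (Suc n)\<^esub> e = c \<odot>\<^bsub>A (Suc n)\<^esub> e"
      proof (cases "k = Suc n")
        case True
        then show ?thesis using c\<mu> c\<nu> by auto
      next
        case False
        then have k': "1 \<le> k" "k \<le> n" using k by auto
        let ?x = "incl \<iota> k n (J k)"
        have x: "?x \<in> carrier (A n)" using GZ_closed incl_J_in_GZ k' by blast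
        obtain c where c: "?x \<otimes>\<^bsub>A n\<^esub> eps_path A \<iota> n S = c \<odot>\<^bsub>A n\<^esub> eps_path A \<iota> n S"
          using GZ_scalar_on_path[OF incl_J_in_GZ[OF k'] S] by blast
        have "\<iota> n ?x \<otimes>\<^bsub>A (Suc n)\<^esub> ?e \<xi> = c \<odot>\<^bsub>A (Suc n)\<^esub> ?e \<xi>" if \<xi>: "edge A \<iota> n (last S) \<xi>" for \<xi>
        proof -
          have i: "\<xi> \<in> Irr (A (Suc n))" using \<xi> by (simp add: edge_def)
          have "\<iota> n ?x \<otimes>\<^bsub>A (Suc n)\<^esub> ?e \<xi> =
              \<iota> n (?x \<otimes>\<^bsub>A n\<^esub> eps_path A \<iota> n S) \<otimes>\<^bsub>A (Suc n)\<^esub> eps (A (Suc n)) \<xi>"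
            using S i x by (simp add: eps_path_snoc \<iota>_mult alg.m_assoc)
          then show ?thesis using S i by (simp add: c \<iota>_scalar eps_path_snoc alg.scalar_mult_left)
        qed
        then show ?thesis using \<mu> \<nu> k' by (auto simp: incl_Suc)
      qed
      moreover have "incl \<iota> k (Suc n) (J k) \<in> carrier (A (Suc n))"
        using k J_closed incl_closed by simp
      ultimately show "incl \<iota> k (Suc n) (J k) \<in> ?B" by blast
    qed
  qed (use T in auto)
  finally have "?e \<mu> \<in> ?B" using eps_path_in_GZ[OF T(1)] by blast
  then obtain b where b: "?e \<mu> \<otimes>\<^bsub>A (Suc n)\<^esub> ?e \<mu> = b \<odot>\<^bsub>A (Suc n)\<^esub> ?e \<mu>"
    "?e \<mu> \<otimes>\<^bsub>A (Suc n)\<^esub> ?e \<nu> = b \<odot>\<^bsub>A (Suc n)\<^esub> ?e \<nu>" by auto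
  have "b = 0" using b(2) ne T eps_path_nonzero[OF T(2)] alg.scalar_eq_zeroD[of "Suc n" b "?e \<nu>"]
    by (simp add: eps_path_mult)
  then have "?e \<mu> = \<zero>\<^bsub>A (Suc n)\<^esub>" using b(1) T by (simp add: eps_path_mult)
  then show False using eps_path_nonzero[OF T(1)] by simp
qed

text \<open>For every path \<open>S\<close> that ends in \<open>\<mu>\<close>, the product \<open>P_path\<close> of \<open>S @ [\<nu>]\<close> is the same product over the
  other successors of \<open>\<mu>\<close>; this makes \<open>P_type\<close> well defined. Among the extensions of \<open>S\<close> it selects
  the one by \<open>\<nu>\<close>, and so does multiplication by \<open>eps (A (Suc n)) \<nu>\<close>.\<close>

lemma P_type_mult_eps:
  assumes \<mu>: "\<mu> \<in> Irr (A n)" and \<nu>: "edge A \<iota> n \<mu> \<nu>"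
  shows "P_type A \<iota> J (Suc n) \<nu> \<mu> \<otimes>\<^bsub>A (Suc n)\<^esub> \<iota> n (eps (A n) \<mu>) =
    \<iota> n (eps (A n) \<mu>) \<otimes>\<^bsub>A (Suc n)\<^esub> eps (A (Suc n)) \<nu>"
proof -
  let ?B = "A (Suc n)" and ?e = "eps_path A \<iota> (Suc n)"
  let ?G = "(A (Suc n))\<lparr>carrier := GZ A \<iota> (Suc n)\<rparr>"
  have \<nu>I: "\<nu> \<in> Irr ?B" using \<nu> by (simp add: edge_def)
  obtain g where g: "\<And>S \<nu>. S \<in> Tab A \<iota> n \<Longrightarrow> edge A \<iota> n (last S) \<nu> \<Longrightarrow>
      J (Suc n) \<otimes>\<^bsub>?B\<^esub> ?e (S @ [\<nu>]) = g (last S) \<nu> \<odot>\<^bsub>?B\<^esub> ?e (S @ [\<nu>])"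
    using J_eigenvalue_by_last_edge[of n] by blast
  have coeff: "JM_coeff A \<iota> J (Suc n) (Suc n) (S @ [\<nu>]) = g (last S) \<nu>"
    if "S \<in> Tab A \<iota> n" "edge A \<iota> n (last S) \<nu>" for S \<nu>
  proof -
    have "JM_coeff A \<iota> J (Suc n) (Suc n) (S @ [\<nu>]) =
        (\<lambda>T. g (last (butlast T)) (last T)) (S @ [\<nu>])"
      by (rule JM_coeff_eq_eigenvalue) (use g that in \<open>auto simp: Tab_Suc\<close>)
    then show ?thesis by simp
  qed
  define D where "D = {\<xi>. edge A \<iota> n \<mu> \<xi> \<and> \<xi> \<noteq> \<nu>}"
  define F where "F \<xi> = (1 / (g \<mu> \<nu> - g \<mu> \<xi>)) \<odot>\<^bsub>?B\<^esub> (J (Suc n) \<ominus>\<^bsub>?B\<^esub> g \<mu> \<xi> \<odot>\<^bsub>?B\<^esub> \<one>\<^bsub>?B\<^esub>)" for \<xi>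
  have J: "J (Suc n) \<in> carrier ?B" using J_closed by simp
  have F: "F \<xi> \<in> GZ A \<iota> (Suc n)" for \<xi>
    unfolding F_def using J_in_GZ[of "Suc n"] alg.subalgD(2,5,6)[OF GZ_subalg[of "Suc n"]] by simp
  have finD: "finite D"
    by (rule finite_subset[OF _ alg.finite_Irr[of "Suc n"]]) (auto simp: D_def edge_def)
  \<comment> \<open>the siblings of \<open>S @ [\<nu>]\<close> are indexed by \<open>D\<close>, and the coefficients involve only last edges\<close>
  have P_path: "P_path A \<iota> J (Suc n) (S @ [\<nu>]) = finprod ?G F D"
    if S: "S \<in> Tab A \<iota> n" "last S = \<mu>" for S
  proof -
    interpret G: comm_monoid ?G by (rule GZ_comm_monoid)
    let ?H = "\<lambda>T. (1 / (JM_coeff A \<iota> J (Suc n) (Suc n) (S @ [\<nu>]) - JM_coeff A \<iota> J (Suc n) (Suc n) T)) \<odot>\<^bsub>?B\<^esub>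
        (J (Suc n) \<ominus>\<^bsub>?B\<^esub> JM_coeff A \<iota> J (Suc n) (Suc n) T \<odot>\<^bsub>?B\<^esub> \<one>\<^bsub>?B\<^esub>)"
    have H: "?H (S @ [\<xi>]) = F \<xi>" if "\<xi> \<in> D" for \<xi>
      using that S \<nu> coeff by (simp add: D_def F_def)
    have "{T \<in> Tab A \<iota> (Suc n). T \<noteq> S @ [\<nu>] \<and> butlast T = butlast (S @ [\<nu>])} = (\<lambda>\<xi>. S @ [\<xi>]) ` D"
      using S by (auto simp: Tab_Suc D_def)
    then have "P_path A \<iota> J (Suc n) (S @ [\<nu>]) = finprod ?G ?H ((\<lambda>\<xi>. S @ [\<xi>]) ` D)"
      unfolding P_path_def by simp
    also have "\<dots> = finprod ?G (\<lambda>\<xi>. ?H (S @ [\<xi>])) D"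
      by (rule G.finprod_reindex) (use F H in \<open>auto simp: inj_on_def\<close>)
    also have "\<dots> = finprod ?G F D" by (rule G.finprod_cong') (use F H in auto)
    finally show ?thesis .
  qed
  have P_closed: "finprod ?G F D \<in> carrier ?B"
    using comm_monoid.finprod_closed[OF GZ_comm_monoid, of F D "Suc n"] F GZ_closed by auto
  have path: "finprod ?G F D \<otimes>\<^bsub>?B\<^esub> \<iota> n (eps_path A \<iota> n S) = \<iota> n (eps_path A \<iota> n S) \<otimes>\<^bsub>?B\<^esub> eps ?B \<nu>"
    if S: "S \<in> Tab A \<iota> n" "last S = \<mu>" for S
  proof -
    have T: "S @ [\<xi>] \<in> Tab A \<iota> (Suc n)" if "edge A \<iota> n \<mu> \<xi>" for \<xi> using S that by (auto simp: Tab_Suc)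
    have F_on: "F \<xi> \<otimes>\<^bsub>?B\<^esub> ?e (S @ [\<eta>]) = ((g \<mu> \<eta> - g \<mu> \<xi>) / (g \<mu> \<nu> - g \<mu> \<xi>)) \<odot>\<^bsub>?B\<^esub> ?e (S @ [\<eta>])"
      if "edge A \<iota> n \<mu> \<eta>" for \<xi> \<eta>
    proof -
      have e: "?e (S @ [\<eta>]) \<in> carrier ?B" using T[OF that] by simp
      have "(J (Suc n) \<ominus>\<^bsub>?B\<^esub> g \<mu> \<xi> \<odot>\<^bsub>?B\<^esub> \<one>\<^bsub>?B\<^esub>) \<otimes>\<^bsub>?B\<^esub> ?e (S @ [\<eta>]) =
          J (Suc n) \<otimes>\<^bsub>?B\<^esub> ?e (S @ [\<eta>]) \<ominus>\<^bsub>?B\<^esub> g \<mu> \<xi> \<odot>\<^bsub>?B\<^esub> ?e (S @ [\<eta>])"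
        using J e by (simp add: alg.minus_eq alg.l_distr alg.l_minus alg.scalar_mult_left)
      also have "\<dots> = (g \<mu> \<eta> - g \<mu> \<xi>) \<odot>\<^bsub>?B\<^esub> ?e (S @ [\<eta>])"
        using g[OF S(1), of \<eta>] S(2) that e by (simp add: alg.scalar_diff_left)
      finally show ?thesis using J e by (simp add: F_def alg.scalar_mult_left alg.scalar_scalar)
    qed
    have distinct: "g \<mu> \<nu> \<noteq> g \<mu> \<xi>" if "\<xi> \<in> D" for \<xi>
      using siblings_separated[OF S(1), of \<nu> \<xi> "g \<mu> \<nu>"] g[OF S(1)] S(2) \<nu> that by (auto simp: D_def)
    have kept: "finprod ?G F D \<otimes>\<^bsub>?B\<^esub> ?e (S @ [\<nu>]) = ?e (S @ [\<nu>])"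
      using finD F T[OF \<nu>] by (intro finprod_GZ_absorb) (auto simp: F_on[OF \<nu>] distinct)
    have killed: "finprod ?G F D \<otimes>\<^bsub>?B\<^esub> ?e (S @ [\<xi>]) = \<zero>\<^bsub>?B\<^esub>" if \<xi>: "edge A \<iota> n \<mu> \<xi>" "\<xi> \<noteq> \<nu>" for \<xi>
      using finD F T[OF \<xi>(1)] \<xi> by (intro finprod_GZ_annihilate[where \<xi> = \<xi>]) (auto simp: F_on D_def)
    have "finprod ?G F D \<otimes>\<^bsub>?B\<^esub> \<iota> n (eps_path A \<iota> n S) =
        finprod ?G F D \<otimes>\<^bsub>?B\<^esub> (\<Oplus>\<^bsub>?B\<^esub>\<xi>\<in>{\<xi>. edge A \<iota> n \<mu> \<xi>}. ?e (S @ [\<xi>]))"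
      using eps_path_extensions[OF S(1)] S(2) by simp
    also have "\<dots> = (\<Oplus>\<^bsub>?B\<^esub>\<xi>\<in>{\<xi>. edge A \<iota> n \<mu> \<xi>}. finprod ?G F D \<otimes>\<^bsub>?B\<^esub> ?e (S @ [\<xi>]))"
    proof (rule alg.finsum_rdistr)
      show "finite {\<xi>. edge A \<iota> n \<mu> \<xi>}"
        by (rule finite_subset[OF _ alg.finite_Irr[of "Suc n"]]) (auto simp: edge_def)
    qed (use P_closed T in auto)
    also have "\<dots> = finprod ?G F D \<otimes>\<^bsub>?B\<^esub> ?e (S @ [\<nu>])"
    proof (rule alg.finsum_single_term)
      show "finite {\<xi>. edge A \<iota> n \<mu> \<xi>}"
        by (rule finite_subset[OF _ alg.finite_Irr[of "Suc n"]]) (auto simp: edge_def)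
    qed (use P_closed T[OF \<nu>] \<nu> killed in auto)
    also have "\<dots> = \<iota> n (eps_path A \<iota> n S) \<otimes>\<^bsub>?B\<^esub> eps ?B \<nu>" using kept S \<nu>I by (simp add: eps_path_snoc)
    finally show ?thesis .
  qed
  let ?S = "{S \<in> Tab A \<iota> n. last S = \<mu>}"
  have sum: "\<iota> n (eps (A n) \<mu>) = (\<Oplus>\<^bsub>?B\<^esub>S\<in>?S. \<iota> n (eps_path A \<iota> n S))"
    by (subst eps_path_sum_type[OF \<mu>, symmetric], rule \<iota>_finsum) auto
  \<comment> \<open>some path ends in \<open>\<mu>\<close>, for otherwise \<open>P_type\<close> would not be determined by its definition\<close>
  have "?S \<noteq> {}" using eps_path_sum_type[OF \<mu>] alg.eps_nonzero[OF \<mu>] by (intro notI) simp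
  then obtain S where S: "S \<in> Tab A \<iota> n" "last S = \<mu>" by blast
  have "P_type A \<iota> J (Suc n) \<nu> \<mu> = finprod ?G F D"
    unfolding P_type_def
  proof (rule the_equality)
    show "\<forall>T\<in>Tab A \<iota> (Suc n). last T = \<nu> \<and> last (butlast T) = \<mu> \<longrightarrow>
        P_path A \<iota> J (Suc n) T = finprod ?G F D"
      using P_path by (auto simp: Tab_Suc)
    show "p = finprod ?G F D" if "\<forall>T\<in>Tab A \<iota> (Suc n). last T = \<nu> \<and> last (butlast T) = \<mu> \<longrightarrow>
        P_path A \<iota> J (Suc n) T = p" for p
    proof -
      have "S @ [\<nu>] \<in> Tab A \<iota> (Suc n)" using S \<nu> by (auto simp: Tab_Suc)
      then show ?thesis using that P_path[OF S] S(2) by force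
    qed
  qed
  then have "P_type A \<iota> J (Suc n) \<nu> \<mu> \<otimes>\<^bsub>?B\<^esub> \<iota> n (eps (A n) \<mu>) =
      (\<Oplus>\<^bsub>?B\<^esub>S\<in>?S. finprod ?G F D \<otimes>\<^bsub>?B\<^esub> \<iota> n (eps_path A \<iota> n S))"
    using P_closed finite_Tab[of n] by (simp add: sum alg.finsum_rdistr Pi_def)
  also have "\<dots> = (\<Oplus>\<^bsub>?B\<^esub>S\<in>?S. \<iota> n (eps_path A \<iota> n S) \<otimes>\<^bsub>?B\<^esub> eps ?B \<nu>)"
    by (rule alg.finsum_cong') (use path \<nu>I in auto)
  also have "\<dots> = \<iota> n (eps (A n) \<mu>) \<otimes>\<^bsub>?B\<^esub> eps ?B \<nu>"
    unfolding sum using \<nu>I finite_Tab[of n] by (intro alg.finsum_ldistr[symmetric]) auto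
  finally show ?thesis .
qed

end

theorem theorem3p11:
  fixes A :: "nat \<Rightarrow> ('k::field, 'a) module"
    and \<iota> :: "nat \<Rightarrow> 'a \<Rightarrow> 'a"
    and J :: "nat \<Rightarrow> 'a"
    and n :: nat
    and \<nu> :: "('a, 'a set) module set"
  assumes "multiplicity_free_family A \<iota>"
    and "JM_sequence A \<iota> J"
    and "n \<ge> 1"
    and "\<nu> \<in> Irr (A n)"
  shows "eps (A n) \<nu> =
    (\<Oplus>\<^bsub>A n\<^esub>\<mu>\<in>{\<mu> \<in> Irr (A (n - 1)). edge A \<iota> (n - 1) \<mu> \<nu>}.
       P_type A \<iota> J n \<nu> \<mu> \<otimes>\<^bsub>A n\<^esub> \<iota> (n - 1) (eps (A (n - 1)) \<mu>))"
proof -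
  interpret JM_family A \<iota> J
    using assms(1,2) by unfold_locales
  obtain m where n: "n = Suc m" using assms(3) by (cases n) auto
  have \<nu>: "\<nu> \<in> Irr (A (Suc m))" using assms(4) n by simp
  have "(\<Oplus>\<^bsub>A (Suc m)\<^esub>\<mu>\<in>{\<mu> \<in> Irr (A m). edge A \<iota> m \<mu> \<nu>}.
       P_type A \<iota> J (Suc m) \<nu> \<mu> \<otimes>\<^bsub>A (Suc m)\<^esub> \<iota> m (eps (A m) \<mu>)) =
     (\<Oplus>\<^bsub>A (Suc m)\<^esub>\<mu>\<in>{\<mu> \<in> Irr (A m). edge A \<iota> m \<mu> \<nu>}.
       \<iota> m (eps (A m) \<mu>) \<otimes>\<^bsub>A (Suc m)\<^esub> eps (A (Suc m)) \<nu>)"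
    by (rule alg.finsum_cong') (use \<nu> P_type_mult_eps in auto)
  also have "\<dots> = eps (A (Suc m)) \<nu>" using \<nu> by (rule eps_sum_over_predecessors)
  finally show ?thesis by (simp add: n)
qed

end
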